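(* Let $n\ge1$, ${\bf x}=(x_1,\dots,x_n)$, $\overline{x}_k=x_k^{-1}$, ${\bf a}=(a_1,a_2,\ldots)$ arbitrary with the convention $a_m=0$ for $m\le0$, and let $\lambda$ be a partition with at most $n$ parts and Young diagram $F^\lambda$. Then (i) $gl_\lambda({\bf x}|{\bf a})=\sum_{T\in{\cal T}^{gl}_\lambda}\prod_{(i,j)\in F^\lambda}{\rm wgt}(T_{ij})$, where an entry $T_{ij}=k$ has weight $x_k+a_{k+j-i}$; (ii) $so_\lambda({\bf x},\overline{{\bf x}},1|{\bf a})=\sum_{T\in{\cal T}^{oo}_\lambda}\prod_{(i,j)\in F^\lambda}{\rm wgt}(T_{ij})$, where an entry $T_{ij}=k$ has weight $x_k+a_{2k-n+j-i}$, an entry $T_{ij}=\overline{k}$ has weight $\overline{x}_k+a_{2k+1-n+j-i}$, and an entry $T_{ij}=0$ has weight $1-a_{n+1+j-i}$; (iii) $sp_\lambda({\bf x},\overline{{\bf x}}|{\bf a})=\sum_{T\in{\cal T}^{sp}_\lambda}\prod_{(i,j)\in F^\lambda}{\rm wgt}(T_{ij})$, where an entry $T_{ij}=k$ has weight $x_k+a_{2k-1-n+j-i}$ and an entry $T_{ij}=\overline{k}$ has weight $\overline{x}_k+a_{2k-n+j-i}$; (iv) $o_\lambda({\bf x},\overline{{\bf x}}|{\bf a})=\sum_{T\in{\cal T}^{eo}_\lambda}2^{\zeta(T)}\prod_{(i,j)\in F^\lambda}{\rm wgt}(T_{ij})$, where an entry $T_{ij}=k$ has weight $x_k+a_{2k-1-n+j-i+\delta_{ik}}$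 ($\delta_{ik}=1$ if $i=k$, else $0$), an entry $T_{ij}=\overline{k}$ has weight $\overline{x}_k+a_{2k-n+j-i}$, and $\zeta(T)=\sum_k\zeta_{k\overline{k}}(T)$ with $\zeta_{k\overline{k}}(T)=1$ if $T_{k-1,1}=k$ and $T_{k,1}=\overline{k}$, and $0$ otherwise.
   Context: For an indeterminate $y$ and integer $m\ge0$, $(y|{\bf a})^m=(y+a_1)\cdots(y+a_m)$ for $m>0$ and $(y|{\bf a})^0=1$. The factorial characters are ($n\times n$ determinants, $(i,j)$ entry shown): $gl_\lambda({\bf x}|{\bf a})=\left|(x_i|{\bf a})^{\lambda_j+n-j}\right|/\left|(x_i|{\bf a})^{n-j}\right|$; $sp_\lambda({\bf x},\overline{{\bf x}}|{\bf a})=\left|x_i(x_i|{\bf a})^{\lambda_j+n-j}-\overline{x}_i(\overline{x}_i|{\bf a})^{\lambda_j+n-j}\right|/\left|x_i(x_i|{\bf a})^{n-j}-\overline{x}_i(\overline{x}_i|{\bf a})^{n-j}\right|$; $so_\lambda({\bf x},\overline{{\bf x}},1|{\bf a})=\left|x_i^{1/2}(x_i|{\bf a})^{\lambda_j+n-j}-\overline{x}_i^{1/2}(\overline{x}_i|{\bf a})^{\lambda_j+n-j}\right|/\left|x_i^{1/2}(x_i|{\bf a})^{n-j}-\overline{x}_i^{1/2}(\overline{x}_i|{\bf a})^{n-j}\right|$; $o_\lambda({\bf x},\overline{{\bf x}}|{\bf a})=\eta\left|(x_i|{\bf a})^{\lambda_j+n-j}+(\overline{x}_i|{\bf a})^{\lambda_j+n-j}\right|/\big(\tfrac12\left|(x_i|{\bf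 a})^{n-j}+(\overline{x}_i|{\bf a})^{n-j}\right|\big)$ with $\eta=\tfrac12$ if $\lambda_n=0$ and $\eta=1$ if $\lambda_n>0$. Here the $a_j$ appearing are the positive-index parameters. The Young diagram is $F^\lambda=\{(i,j):1\le i\le\ell(\lambda),\ 1\le j\le\lambda_i\}$ (row $i$, column $j$, rows top to bottom). A tableau of shape $\lambda$ assigns an entry $T_{ij}$ to each box. Conditions: (T1) entries weakly increase left to right along rows; (T2) entries weakly increase top to bottom down columns; (T3) no two identical entries in any column; (T4) neither $k$ nor $\overline{k}$ appears lower than row $k$; (T5) at most one entry $0$ in any row; (T6) if an entry $k$ appears in row $k$ then any entry $\overline{k}$ in that same row must have an entry $k$ immediately above it in row $k-1$. ${\cal T}^{gl}_\lambda$: entries from $\{1<2<\cdots<n\}$ satisfying (T1)–(T3). ${\cal T}^{sp}_\lambda$: entries from $\{1<\overline{1}<2<\overline{2}<\cdots<n<\overline{n}\}$ satisfying (T1)–(T4). ${\cal T}^{oo}_\lambda$: entries from $\{1<\overline{1}<\cdots<n<\overline{n}<0\}$, all entries satisfying (T1),(T2), non-zero entries satisfying (T3),(T4), and (T5) holding. ${\cal T}^{eo}_\lambda$: entries from $\{1<\overline{1}<\cdots<n<\overline{n}\}$ satisfying (T1)–(T4) and (T6). *)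

theory Defs
  imports Main "Jordan_Normal_Form.Determinant" "HOL-Library.FuncSet"
begin

(* A partition is a function whose parts are lam 1, lam 2, ...; the value lam 0 is irrelevant. *)

definition is_partition :: "(nat \<Rightarrow> nat) \<Rightarrow> bool" where
  "is_partition lam \<longleftrightarrow>
     (\<forall>i\<ge>1. lam (Suc i) \<le> lam i) \<and> finite {i. 1 \<le> i \<and> 0 < lam i}"

definition num_parts :: "(nat \<Rightarrow> nat) \<Rightarrow> nat" where
  "num_parts lam = card {i. 1 \<le> i \<and> 0 < lam i}"

definition diagram :: "(nat \<Rightarrow> nat) \<Rightarrow> (nat \<times> nat) set" where
  "diagram lam = {(i, j). 1 \<le> i \<and> i \<le> num_parts lam \<and> 1 \<le> j \<and> j \<le> lam i}"


(* The factorial power (y|a)^m = (y + a_1) ... (y + a_m); the parameters are indexed by all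
   integers because negative indices occur in the tableau weights below. *)

definition fact_pow :: "'a::comm_ring_1 \<Rightarrow> (int \<Rightarrow> 'a) \<Rightarrow> nat \<Rightarrow> 'a" where
  "fact_pow y a m = (\<Prod>i = 1..m. y + a (int i))"

(* Matrices from Jordan_Normal_Form are indexed from 0; here f is indexed from 1. *)

definition det1 :: "nat \<Rightarrow> (nat \<Rightarrow> nat \<Rightarrow> 'a::comm_ring_1) \<Rightarrow> 'a" where
  "det1 n f = det (mat n n (\<lambda>(i, j). f (Suc i) (Suc j)))"

definition gl_char ::
  "nat \<Rightarrow> (nat \<Rightarrow> 'a::field_char_0) \<Rightarrow> (int \<Rightarrow> 'a) \<Rightarrow> (nat \<Rightarrow> nat) \<Rightarrow> 'a" where
  "gl_char n x a lam =
     det1 n (\<lambda>i j. fact_pow (x i) a (lam j + n - j)) /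
     det1 n (\<lambda>i j. fact_pow (x i) a (n - j))"

definition sp_char ::
  "nat \<Rightarrow> (nat \<Rightarrow> 'a::field_char_0) \<Rightarrow> (int \<Rightarrow> 'a) \<Rightarrow> (nat \<Rightarrow> nat) \<Rightarrow> 'a" where
  "sp_char n x a lam =
     det1 n (\<lambda>i j. x i * fact_pow (x i) a (lam j + n - j)
                  - inverse (x i) * fact_pow (inverse (x i)) a (lam j + n - j)) /
     det1 n (\<lambda>i j. x i * fact_pow (x i) a (n - j)
                  - inverse (x i) * fact_pow (inverse (x i)) a (n - j))"

(* The argument s i stands for a chosen square root of x i. *)

definition so_char ::
  "nat \<Rightarrow> (nat \<Rightarrow> 'a::field_char_0) \<Rightarrow> (nat \<Rightarrow> 'a) \<Rightarrow> (int \<Rightarrow> 'a) \<Rightarrow> (nat \<Rightarrow> nat) \<Rightarrow> 'a" where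
  "so_char n x s a lam =
     det1 n (\<lambda>i j. s i * fact_pow (x i) a (lam j + n - j)
                  - inverse (s i) * fact_pow (inverse (x i)) a (lam j + n - j)) /
     det1 n (\<lambda>i j. s i * fact_pow (x i) a (n - j)
                  - inverse (s i) * fact_pow (inverse (x i)) a (n - j))"

definition o_char ::
  "nat \<Rightarrow> (nat \<Rightarrow> 'a::field_char_0) \<Rightarrow> (int \<Rightarrow> 'a) \<Rightarrow> (nat \<Rightarrow> nat) \<Rightarrow> 'a" where
  "o_char n x a lam =
     (if lam n = 0 then 1 / 2 else 1) *
     det1 n (\<lambda>i j. fact_pow (x i) a (lam j + n - j) + fact_pow (inverse (x i)) a (lam j + n - j)) /
     (1 / 2 * det1 n (\<lambda>i j. fact_pow (x i) a (n - j) + fact_pow (inverse (x i)) a (n - j)))"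


(* Plain k, Barred k and Zero encode the entries k, k-bar and 0, ordered by
   1 < 1-bar < 2 < 2-bar < ... < 0. *)

datatype entry = Plain nat | Barred nat | Zero

instantiation entry :: linorder
begin

fun less_eq_entry :: "entry \<Rightarrow> entry \<Rightarrow> bool" where
  "less_eq_entry (Plain k) (Plain l) \<longleftrightarrow> k \<le> l"
| "less_eq_entry (Plain k) (Barred l) \<longleftrightarrow> k \<le> l"
| "less_eq_entry (Barred k) (Plain l) \<longleftrightarrow> k < l"
| "less_eq_entry (Barred k) (Barred l) \<longleftrightarrow> k \<le> l"
| "less_eq_entry Zero (Plain l) \<longleftrightarrow> False"
| "less_eq_entry Zero (Barred l) \<longleftrightarrow> False"
| "less_eq_entry e Zero \<longleftrightarrow> True"

definition less_entry :: "entry \<Rightarrow> entry \<Rightarrow> bool" where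
  "less_entry e f \<longleftrightarrow> e \<le> f \<and> \<not> f \<le> e"

instance
proof
  fix e f g :: entry
  show "e < f \<longleftrightarrow> e \<le> f \<and> \<not> f \<le> e" by (rule less_entry_def)
  show "e \<le> e" by (cases e) auto
  show "e \<le> f \<Longrightarrow> f \<le> g \<Longrightarrow> e \<le> g" by (cases e; cases f; cases g) auto
  show "e \<le> f \<Longrightarrow> f \<le> e \<Longrightarrow> e = f" by (cases e; cases f) auto
  show "e \<le> f \<or> f \<le> e" by (cases e; cases f) auto
qed

end

definition barred_alphabet :: "nat \<Rightarrow> entry set" where
  "barred_alphabet n = Plain ` {1..n} \<union> Barred ` {1..n}"

definition rows_weak :: "(nat \<Rightarrow> nat) \<Rightarrow> (nat \<times> nat \<Rightarrow> 'e::linorder) \<Rightarrow> bool" where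
  "rows_weak lam T \<longleftrightarrow> (\<forall>i j j'. (i, j) \<in> diagram lam \<longrightarrow> (i, j') \<in> diagram lam \<longrightarrow>
     j \<le> j' \<longrightarrow> T (i, j) \<le> T (i, j'))"

definition cols_weak :: "(nat \<Rightarrow> nat) \<Rightarrow> (nat \<times> nat \<Rightarrow> 'e::linorder) \<Rightarrow> bool" where
  "cols_weak lam T \<longleftrightarrow> (\<forall>i i' j. (i, j) \<in> diagram lam \<longrightarrow> (i', j) \<in> diagram lam \<longrightarrow>
     i \<le> i' \<longrightarrow> T (i, j) \<le> T (i', j))"

(* No two identical entries belonging to S occur in any column. *)

definition cols_distinct :: "(nat \<Rightarrow> nat) \<Rightarrow> 'e set \<Rightarrow> (nat \<times> nat \<Rightarrow> 'e) \<Rightarrow> bool" where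
  "cols_distinct lam S T \<longleftrightarrow> (\<forall>i i' j. (i, j) \<in> diagram lam \<longrightarrow> (i', j) \<in> diagram lam \<longrightarrow>
     i \<noteq> i' \<longrightarrow> T (i, j) \<in> S \<longrightarrow> T (i, j) \<noteq> T (i', j))"

definition row_bound :: "(nat \<Rightarrow> nat) \<Rightarrow> (nat \<times> nat \<Rightarrow> entry) \<Rightarrow> bool" where
  "row_bound lam T \<longleftrightarrow> (\<forall>i j k. (i, j) \<in> diagram lam \<longrightarrow>
     T (i, j) = Plain k \<or> T (i, j) = Barred k \<longrightarrow> i \<le> k)"

definition rows_one_zero :: "(nat \<Rightarrow> nat) \<Rightarrow> (nat \<times> nat \<Rightarrow> entry) \<Rightarrow> bool" where
  "rows_one_zero lam T \<longleftrightarrow> (\<forall>i j j'. (i, j) \<in> diagram lam \<longrightarrow> (i, j') \<in> diagram lam \<longrightarrow>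
     T (i, j) = Zero \<longrightarrow> T (i, j') = Zero \<longrightarrow> j = j')"

(* For k = 1 the conclusion is unsatisfiable (there is no row 0), so 1 and 1-bar cannot both
   occur in row 1. *)

definition even_orth_cond :: "(nat \<Rightarrow> nat) \<Rightarrow> (nat \<times> nat \<Rightarrow> entry) \<Rightarrow> bool" where
  "even_orth_cond lam T \<longleftrightarrow>
     (\<forall>k. (\<exists>j. (k, j) \<in> diagram lam \<and> T (k, j) = Plain k) \<longrightarrow>
        (\<forall>j. (k, j) \<in> diagram lam \<longrightarrow> T (k, j) = Barred k \<longrightarrow>
           (k - 1, j) \<in> diagram lam \<and> T (k - 1, j) = Plain k))"

(* Tableaux are extensional functions on the diagram, so that each filling is counted once. *)

definition gl_tableaux :: "nat \<Rightarrow> (nat \<Rightarrow> nat) \<Rightarrow> (nat \<times> nat \<Rightarrow> nat) set" where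
  "gl_tableaux n lam = {T \<in> diagram lam \<rightarrow>\<^sub>E {1..n}.
     rows_weak lam T \<and> cols_weak lam T \<and> cols_distinct lam UNIV T}"

definition sp_tableaux :: "nat \<Rightarrow> (nat \<Rightarrow> nat) \<Rightarrow> (nat \<times> nat \<Rightarrow> entry) set" where
  "sp_tableaux n lam = {T \<in> diagram lam \<rightarrow>\<^sub>E barred_alphabet n.
     rows_weak lam T \<and> cols_weak lam T \<and> cols_distinct lam UNIV T \<and> row_bound lam T}"

definition oo_tableaux :: "nat \<Rightarrow> (nat \<Rightarrow> nat) \<Rightarrow> (nat \<times> nat \<Rightarrow> entry) set" where
  "oo_tableaux n lam = {T \<in> diagram lam \<rightarrow>\<^sub>E insert Zero (barred_alphabet n).
     rows_weak lam T \<and> cols_weak lam T \<and> cols_distinct lam (- {Zero}) T \<and> row_bound lam T \<and>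
     rows_one_zero lam T}"

definition eo_tableaux :: "nat \<Rightarrow> (nat \<Rightarrow> nat) \<Rightarrow> (nat \<times> nat \<Rightarrow> entry) set" where
  "eo_tableaux n lam = {T \<in> diagram lam \<rightarrow>\<^sub>E barred_alphabet n.
     rows_weak lam T \<and> cols_weak lam T \<and> cols_distinct lam UNIV T \<and> row_bound lam T \<and>
     even_orth_cond lam T}"


(* Weights of an entry in row i and column j. In sp_wgt and eo_wgt the value at Zero is never
   used, since Zero is not in the alphabet. *)

definition gl_wgt :: "(nat \<Rightarrow> 'a::field_char_0) \<Rightarrow> (int \<Rightarrow> 'a) \<Rightarrow> nat \<Rightarrow> nat \<Rightarrow> nat \<Rightarrow> 'a" where
  "gl_wgt x a i j k = x k + a (int k + int j - int i)"

fun oo_wgt ::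
  "nat \<Rightarrow> (nat \<Rightarrow> 'a::field_char_0) \<Rightarrow> (int \<Rightarrow> 'a) \<Rightarrow> nat \<Rightarrow> nat \<Rightarrow> entry \<Rightarrow> 'a" where
  "oo_wgt n x a i j (Plain k) = x k + a (2 * int k - int n + int j - int i)"
| "oo_wgt n x a i j (Barred k) = inverse (x k) + a (2 * int k + 1 - int n + int j - int i)"
| "oo_wgt n x a i j Zero = 1 - a (int n + 1 + int j - int i)"

fun sp_wgt ::
  "nat \<Rightarrow> (nat \<Rightarrow> 'a::field_char_0) \<Rightarrow> (int \<Rightarrow> 'a) \<Rightarrow> nat \<Rightarrow> nat \<Rightarrow> entry \<Rightarrow> 'a" where
  "sp_wgt n x a i j (Plain k) = x k + a (2 * int k - 1 - int n + int j - int i)"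
| "sp_wgt n x a i j (Barred k) = inverse (x k) + a (2 * int k - int n + int j - int i)"
| "sp_wgt n x a i j Zero = 0"

fun eo_wgt ::
  "nat \<Rightarrow> (nat \<Rightarrow> 'a::field_char_0) \<Rightarrow> (int \<Rightarrow> 'a) \<Rightarrow> nat \<Rightarrow> nat \<Rightarrow> entry \<Rightarrow> 'a" where
  "eo_wgt n x a i j (Plain k) =
     x k + a (2 * int k - 1 - int n + int j - int i + (if i = k then 1 else 0))"
| "eo_wgt n x a i j (Barred k) = inverse (x k) + a (2 * int k - int n + int j - int i)"
| "eo_wgt n x a i j Zero = 0"

definition zeta_at :: "(nat \<Rightarrow> nat) \<Rightarrow> (nat \<times> nat \<Rightarrow> entry) \<Rightarrow> nat \<Rightarrow> nat" where
  "zeta_at lam T k =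
     (if (k - 1, 1) \<in> diagram lam \<and> (k, 1) \<in> diagram lam \<and>
         T (k - 1, 1) = Plain k \<and> T (k, 1) = Barred k then 1 else 0)"

definition zeta :: "nat \<Rightarrow> (nat \<Rightarrow> nat) \<Rightarrow> (nat \<times> nat \<Rightarrow> entry) \<Rightarrow> nat" where
  "zeta n lam T = (\<Sum>k = 1..n. zeta_at lam T k)"

end

theory Submission
  imports Defs "HOL-Computational_Algebra.Polynomial"
begin

text \<open>
  Each determinant satisfies the same recursion in the number of variables as the corresponding
  sum over tableaux, where the recursion for the latter removes the largest letters. Let \<open>y = x\<^sub>n\<close>.
  Newton interpolation at \<open>y\<close> gives
  \<open>(z|a)\<^sup>l - c (z|a)\<^sup>k = (z - y) \<Sum>\<^sub>m d\<^sub>m (z|a)\<^sup>m\<close> with \<open>k \<le> m < l\<close>, the \<open>d\<^sub>m\<close> being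
  products of factors \<open>y + a\<^sub>s\<close>. Subtracting from each column a multiple of the next one and expanding
  multilinearly therefore replaces the exponents \<open>\<lambda>\<^sub>j + n - j\<close> by those of the partitions that
  interlace with \<open>\<lambda>\<close>, and the coefficients are the weights of the removed horizontal strip;
  for \<open>gl\<close> the last row becomes zero except for its last entry, which lowers \<open>n\<close> by one.
  In the other cases one interpolates first at \<open>1/y\<close> (letter \<open>n\<close> barred) and then at \<open>y\<close> (letter \<open>n\<close>),
  after applying a linear functional to the variable \<open>z\<close>: the divided difference at \<open>x\<close> and \<open>1/x\<close>,
  or the sum of the values there. Since \<open>(z - y)(z - 1/y) = z (z + 1/z - y - 1/y)\<close>, both factors come
  out as \<open>x + 1/x - y - 1/y\<close>, and the remaining factor \<open>z\<close> shifts the parameters by one because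
  \<open>a\<^sub>0 = 0\<close>. In the odd orthogonal case a preliminary step \<open>(z + 1) (z|a)\<^sup>l = (z|a)\<^sup>l\<^sup>+\<^sup>1 + (1 - a\<^sub>l\<^sub>+\<^sub>1) (z|a)\<^sup>l\<close>
  removes the letters \<open>0\<close>. In the even orthogonal case the two recursions differ in the weight of
  row \<open>n\<close>, and agree after a telescoping summation over the number of letters \<open>n\<close> in that row.
\<close>

subsection \<open>Determinants with one-based indices\<close>

lemma det1_leibniz:
  "det1 n f = (\<Sum>p | p permutes {0..<n}. signof p * (\<Prod>j = 1..n. f (Suc (p (j - 1))) j))"
proof -
  have "(\<Prod>j<n. f (Suc (p j)) (Suc j)) = (\<Prod>j = 1..n. f (Suc (p (j - 1))) j)" for p :: "nat \<Rightarrow> nat"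
    by (rule prod.reindex_bij_witness[of _ "\<lambda>j. j - 1" Suc]) auto
  moreover have "(\<Prod>j<n. mat n n (\<lambda>(i, j). f (Suc i) (Suc j)) $$ (p j, j)) = (\<Prod>j<n. f (Suc (p j)) (Suc j))"
    if "p permutes {0..<n}" for p
    using permutes_in_image[OF that] by (intro prod.cong) auto
  ultimately show ?thesis
    unfolding det1_def by (subst det_col[of _ n]) auto
qed

lemma det1_cong:
  assumes "\<And>i j. 1 \<le> i \<Longrightarrow> i \<le> n \<Longrightarrow> 1 \<le> j \<Longrightarrow> j \<le> n \<Longrightarrow> f i j = g i j"
  shows "det1 n f = det1 n g"
  unfolding det1_def using assms by (intro arg_cong[of _ _ det] eq_matI) auto

lemma det1_0 [simp]: "det1 0 f = 1"
  by (simp add: det1_def)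

lemma det1_row_scale: "det1 n (\<lambda>i j. r i * f i j) = (\<Prod>i = 1..n. r i) * det1 n f"
proof -
  have "(\<Prod>j = 1..n. r (Suc (p (j - 1)))) = (\<Prod>i = 1..n. r i)" if "p permutes {0..<n}" for p
  proof -
    have "(\<Prod>j = 1..n. r (Suc (p (j - 1)))) = (\<Prod>j\<in>{0..<n}. r (Suc (p j)))"
      by (rule prod.reindex_bij_witness[of _ Suc "\<lambda>j. j - 1"]) auto
    also have "\<dots> = (\<Prod>j\<in>{0..<n}. r (Suc j))"
      using prod.permute[OF that, of "\<lambda>j. r (Suc j)"] by (simp add: o_def)
    also have "\<dots> = (\<Prod>i = 1..n. r i)"
      by (rule prod.reindex_bij_witness[of _ "\<lambda>j. j - 1" Suc]) auto
    finally show ?thesis .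
  qed
  then show ?thesis
    unfolding det1_leibniz sum_distrib_left
    by (intro sum.cong refl) (simp add: prod.distrib)
qed

lemma det1_column_scale: "det1 n (\<lambda>i j. r j * f i j) = (\<Prod>j = 1..n. r j) * det1 n f"
  by (simp add: det1_leibniz prod.distrib sum_distrib_left mult.left_commute)

text \<open>Distributing the product over the sums in each Leibniz term and exchanging the two
  summations leaves one determinant for each choice function \<kappa>.\<close>

lemma det1_multilinear:
  assumes "\<And>j. finite (K j)"
  shows "det1 n (\<lambda>i j. \<Sum>k\<in>K j. w j k * \<psi> j k i) =
    (\<Sum>\<kappa>\<in>PiE {1..n} K. (\<Prod>j = 1..n. w j (\<kappa> j)) * det1 n (\<lambda>i j. \<psi> j (\<kappa> j) i))"
proof -
  have "det1 n (\<lambda>i j. \<Sum>k\<in>K j. w j k * \<psi> j k i) =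
    (\<Sum>p | p permutes {0..<n}. signof p *
      (\<Sum>\<kappa>\<in>PiE {1..n} K. (\<Prod>j = 1..n. w j (\<kappa> j) * \<psi> j (\<kappa> j) (Suc (p (j - 1))))))"
    unfolding det1_leibniz using assms by (subst prod_sum_PiE) auto
  also have "\<dots> = (\<Sum>\<kappa>\<in>PiE {1..n} K. (\<Sum>p | p permutes {0..<n}. signof p *
      (\<Prod>j = 1..n. w j (\<kappa> j) * \<psi> j (\<kappa> j) (Suc (p (j - 1))))))"
    unfolding sum_distrib_left by (rule sum.swap)
  finally show ?thesis
    by (simp add: det1_leibniz prod.distrib sum_distrib_left mult.left_commute mult.assoc)
qed

text \<open>All column operations are done at once, by right multiplication with a unit lower
  bidiagonal matrix; each column thus subtracts a multiple of the original next column.\<close>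

lemma det1_column_op:
  "det1 n (\<lambda>i j. if j < n then f i j - c j * f i (Suc j) else f i j) =
    det1 n (f :: nat \<Rightarrow> nat \<Rightarrow> 'a::idom)"
proof -
  define A where "A = mat n n (\<lambda>(i, j). f (Suc i) (Suc j))"
  define U where "U = mat n n (\<lambda>(i, j). if i = j then 1 else if i = Suc j then - c (Suc j) else (0::'a))"
  have cA: "A \<in> carrier_mat n n" and cU: "U \<in> carrier_mat n n"
    by (auto simp: A_def U_def)
  have "det U = 1"
  proof -
    have "det U = prod_list (diag_mat U)"
      by (rule det_lower_triangular[OF _ cU]) (auto simp: U_def)
    also have "diag_mat U = map (\<lambda>i. 1) [0..<n]"
      by (auto simp: diag_mat_def U_def)
    finally show ?thesis by (simp add: map_replicate_const)
  qed
  have "mat n n (\<lambda>(i, j). (\<lambda>i j. if j < n then f i j - c j * f i (Suc j) else f i j) (Suc i) (Suc j)) = A * U"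
  proof (rule eq_matI)
    fix i j assume "i < dim_row (A * U)" "j < dim_col (A * U)"
    then have i: "i < n" and j: "j < n" using cA cU by auto
    have "(A * U) $$ (i, j) = (\<Sum>k = 0..<n. f (Suc i) (Suc k) *
       (if k = j then 1 else if k = Suc j then - c (Suc j) else 0))"
      using i j by (auto simp: A_def U_def scalar_prod_def intro!: sum.cong)
    also have "\<dots> = (\<Sum>k\<in>{0..<n}. (if k = j then f (Suc i) (Suc j) else 0) +
        (if k = Suc j then - c (Suc j) * f (Suc i) (Suc (Suc j)) else 0))"
      by (intro sum.cong) auto
    also have "\<dots> = f (Suc i) (Suc j) + (if Suc j < n then - c (Suc j) * f (Suc i) (Suc (Suc j)) else 0)"
      using j by (simp add: sum.distrib)
    finally show "mat n n (\<lambda>(i, j). (\<lambda>i j. if j < n then f i j - c j * f i (Suc j) else f i j) (Suc i) (Suc j)) $$ (i, j)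
      = (A * U) $$ (i, j)"
      using i j by auto
  qed (use cA cU in auto)
  then show ?thesis
    unfolding det1_def using det_mult[OF cA cU] \<open>det U = 1\<close> by (simp add: A_def)
qed

lemma det1_last_row:
  assumes "\<And>j. 1 \<le> j \<Longrightarrow> j \<le> n \<Longrightarrow> f (Suc n) j = (0 :: 'a::comm_ring_1)"
  shows "det1 (Suc n) f = f (Suc n) (Suc n) * det1 n f"
proof -
  define A where "A = mat (Suc n) (Suc n) (\<lambda>(i, j). f (Suc i) (Suc j))"
  have "det A = (\<Sum>j<Suc n. A $$ (n, j) * cofactor A n j)"
    by (rule laplace_expansion_row) (auto simp: A_def)
  also have "\<dots> = A $$ (n, n) * cofactor A n n"
    using assms by (auto simp: A_def intro!: sum.neutral)
  also have "mat_delete A n n = mat n n (\<lambda>(i, j). f (Suc i) (Suc j))"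
    by (rule eq_matI) (auto simp: A_def mat_delete_def)
  then have "cofactor A n n = det1 n f"
    by (simp add: cofactor_def det1_def)
  finally show ?thesis
    by (simp add: det1_def A_def)
qed

lemma det1_identical_columns:
  assumes "j \<in> {1..n}" "j' \<in> {1..n}" "j \<noteq> j'" "\<And>i. 1 \<le> i \<Longrightarrow> i \<le> n \<Longrightarrow> f i j = f i j'"
  shows "det1 n f = 0"
  unfolding det1_def
  by (rule det_identical_columns[of _ n "j - 1" "j' - 1"])
    (use assms in \<open>auto intro!: eq_vecI\<close>)

lemma det1_zero_column:
  assumes "j \<in> {1..n}" "\<And>i. 1 \<le> i \<Longrightarrow> i \<le> n \<Longrightarrow> f i j = 0"
  shows "det1 n f = 0"
proof -
  have "(\<Prod>j = 1..n. f (Suc (p (j - 1))) j) = 0" if "p permutes {0..<n}" for p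
    using assms permutes_in_image[OF that, of "j - 1"]
    by (intro prod_zero bexI[of _ j]) auto
  then show ?thesis
    by (auto simp: det1_leibniz intro!: sum.neutral)
qed

subsection \<open>Bounded partitions and horizontal strips\<close>

text \<open>At most \<open>n\<close> parts, with the bound explicit so that an induction on
  \<open>n\<close> can lower it.\<close>

definition bounded_partition :: "nat \<Rightarrow> (nat \<Rightarrow> nat) \<Rightarrow> bool" where
  "bounded_partition n lam \<longleftrightarrow> (\<forall>i\<ge>1. lam (Suc i) \<le> lam i) \<and> (\<forall>i>n. lam i = 0)"

text \<open>The shapes \<open>nu\<close> for which \<open>lam/nu\<close> is a horizontal strip.
  Fixing \<open>nu 0\<close> lets each shape occur exactly once in sums.\<close>

definition hstrips :: "(nat \<Rightarrow> nat) \<Rightarrow> (nat \<Rightarrow> nat) set" where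
  "hstrips lam = {nu. nu 0 = 0 \<and> (\<forall>i\<ge>1. lam (Suc i) \<le> nu i \<and> nu i \<le> lam i)}"

lemma bounded_partition_antimono:
  assumes "bounded_partition n lam" "1 \<le> i" "i \<le> j"
  shows "lam j \<le> lam i"
  using assms(3)
proof (induction j rule: dec_induct)
  case (step k)
  then show ?case using assms(1,2) unfolding bounded_partition_def
    by (meson le_trans)
qed simp

lemma hstrips_bounded_partition:
  assumes "bounded_partition n lam" "nu \<in> hstrips lam"
  shows "bounded_partition n nu"
  unfolding bounded_partition_def
proof (intro conjI allI impI)
  fix i :: nat assume "i \<ge> 1"
  then show "nu (Suc i) \<le> nu i"
    using assms(2) le_trans[of "nu (Suc i)" "lam (Suc i)" "nu i"] by (auto simp: hstrips_def)
next
  fix i assume "i > n"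
  then show "nu i = 0"
    using assms spec[of "\<lambda>i. 1 \<le> i \<longrightarrow> lam (Suc i) \<le> nu i \<and> nu i \<le> lam i" i]
    by (simp add: hstrips_def bounded_partition_def)
qed

text \<open>Choice functions in a multilinear expansion are \<open>undefined\<close> outside
  \<open>1..n\<close>, whereas partitions are zero there; the bijection exchanges the two
  defaults.\<close>

lemma bij_betw_restrict_PiE:
  "bij_betw (\<lambda>nu. restrict nu {1..n}) {nu. \<forall>i::nat. nu i \<in> (if i \<in> {1..n} then K i else {0::nat})} (PiE {1..n} K)"
proof (rule bij_betw_byWitness[where f' = "\<lambda>\<kappa> i. if i \<in> {1..n} then \<kappa> i else 0"])
  show "\<forall>nu\<in>{nu. \<forall>i. nu i \<in> (if i \<in> {1..n} then K i else {0})}.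
      (\<lambda>i. if i \<in> {1..n} then restrict nu {1..n} i else 0) = nu"
    by (auto simp: fun_eq_iff split: if_splits)
  show "\<forall>\<kappa>\<in>PiE {1..n} K. restrict (\<lambda>i. if i \<in> {1..n} then \<kappa> i else 0) {1..n} = \<kappa>"
    by (auto simp: PiE_iff extensional_def fun_eq_iff)
  show "(\<lambda>nu. restrict nu {1..n}) ` {nu. \<forall>i. nu i \<in> (if i \<in> {1..n} then K i else {0})} \<subseteq> PiE {1..n} K"
    by (auto split: if_splits)
qed (auto simp: PiE_iff)

lemma sum_PiE_extend_zero:
  assumes "\<And>\<kappa> \<kappa>'. (\<And>i. i \<in> {1..n} \<Longrightarrow> \<kappa> i = \<kappa>' i) \<Longrightarrow> F \<kappa> = F \<kappa>'"
  shows "(\<Sum>\<kappa>\<in>PiE {1..n} K. F \<kappa>) =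
    (\<Sum>nu | \<forall>i::nat. nu i \<in> (if i \<in> {1..n} then K i else {0::nat}). F nu)"
proof -
  have "(\<Sum>\<kappa>\<in>PiE {1..n} K. F \<kappa>) = (\<Sum>nu | \<forall>i. nu i \<in> (if i \<in> {1..n} then K i else {0}). F (restrict nu {1..n}))"
    by (rule sum.reindex_bij_betw[OF bij_betw_restrict_PiE, symmetric])
  also have "\<dots> = (\<Sum>nu | \<forall>i. nu i \<in> (if i \<in> {1..n} then K i else {0}). F nu)"
    by (intro sum.cong refl assms) simp
  finally show ?thesis .
qed

lemma hstrips_eq:
  assumes "bounded_partition n lam"
  shows "hstrips lam = {nu. \<forall>i. nu i \<in> (if i \<in> {1..n} then {lam (Suc i)..lam i} else {0})}"
proof -
  have 0: "lam i = 0" "lam (Suc i) = 0" if "n < i" for i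
    using assms that by (auto simp: bounded_partition_def)
  show ?thesis
    unfolding hstrips_def
  proof (intro Collect_cong iffI allI conjI impI)
    fix nu :: "nat \<Rightarrow> nat" and i :: nat
    assume nu: "nu 0 = 0 \<and> (\<forall>i\<ge>1. lam (Suc i) \<le> nu i \<and> nu i \<le> lam i)"
    then show "nu i \<in> (if i \<in> {1..n} then {lam (Suc i)..lam i} else {0})"
      using 0(1)[of i] spec[OF conjunct2[OF nu], of i] by (cases "i = 0"; cases "i \<le> n") auto
  next
    fix nu :: "nat \<Rightarrow> nat" and i :: nat
    assume nu: "\<forall>i. nu i \<in> (if i \<in> {1..n} then {lam (Suc i)..lam i} else {0})"
    show "nu 0 = 0" using spec[OF nu, of 0] by simp
    assume "1 \<le> i"
    then show "lam (Suc i) \<le> nu i" "nu i \<le> lam i"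
      using spec[OF nu, of i] 0[of i] by (cases "i \<le> n"; simp)+
  qed
qed

lemma hstrips_smaller_eq:
  assumes "bounded_partition (Suc n) lam"
  shows "{nu \<in> hstrips lam. nu (Suc n) = 0} =
    {nu. \<forall>i. nu i \<in> (if i \<in> {1..n} then {lam (Suc i)..lam i} else {0})}"
proof -
  let ?A = "\<lambda>nu i. nu i \<in> (if i \<in> {1..Suc n} then {lam (Suc i)..lam i} else {0})"
  let ?B = "\<lambda>nu i. nu i \<in> (if i \<in> {1..n} then {lam (Suc i)..lam i} else {0})"
  have "lam (Suc (Suc n)) = 0"
    using assms by (auto simp: bounded_partition_def)
  then have "nu (Suc n) = 0 \<Longrightarrow> ?A nu (Suc n)" "?B nu (Suc n) \<longleftrightarrow> nu (Suc n) = 0" for nu :: "nat \<Rightarrow> nat"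
    by auto
  moreover have "?A nu i \<longleftrightarrow> ?B nu i" if "i \<noteq> Suc n" for nu :: "nat \<Rightarrow> nat" and i
    using that by auto
  ultimately have "(\<forall>i. ?A nu i) \<and> nu (Suc n) = 0 \<longleftrightarrow> (\<forall>i. ?B nu i)" for nu :: "nat \<Rightarrow> nat"
    by metis
  then show ?thesis
    unfolding hstrips_eq[OF assms] by blast
qed

lemma sum_hstrips:
  assumes "bounded_partition n lam"
    and "\<And>\<kappa> \<kappa>'. (\<And>i. i \<in> {1..n} \<Longrightarrow> \<kappa> i = \<kappa>' i) \<Longrightarrow> F \<kappa> = F \<kappa>'"
  shows "(\<Sum>\<kappa>\<in>PiE {1..n} (\<lambda>j. {lam (Suc j)..lam j}). F \<kappa>) = (\<Sum>nu\<in>hstrips lam. F nu)"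
  unfolding hstrips_eq[OF assms(1)] by (rule sum_PiE_extend_zero) (rule assms(2))

lemma finite_hstrips:
  assumes "bounded_partition n lam"
  shows "finite (hstrips lam)"
  unfolding hstrips_eq[OF assms] bij_betw_finite[OF bij_betw_restrict_PiE]
  by (intro finite_PiE) auto

text \<open>The substitution \<open>k = \<nu>\<^sub>j + n - j\<close> turns the sums over exponents between two
  neighbouring columns into sums over the parts of the partitions interlacing with \<open>\<lambda>\<close>.\<close>

lemma det1_hstrip_same:
  fixes \<phi> \<psi> :: "nat \<Rightarrow> nat \<Rightarrow> 'a::idom"
  assumes lam: "bounded_partition n lam"
    and diff: "\<And>l l'. l' < l \<Longrightarrow> \<exists>c. \<forall>i\<in>{1..n}. \<phi> l i - c * \<phi> l' i = (\<Sum>k = Suc l'..l. w k l * \<psi> k i)"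
    and last: "\<And>i. i \<in> {1..n} \<Longrightarrow> \<phi> (lam n) i = (\<Sum>k = 0..lam n. w k (lam n) * \<psi> k i)"
  shows "det1 n (\<lambda>i j. \<phi> (lam j + n - j) i) =
    (\<Sum>nu\<in>hstrips lam. (\<Prod>j = 1..n. w (nu j + n - j) (lam j + n - j)) * det1 n (\<lambda>i j. \<psi> (nu j + n - j) i))"
proof -
  \<comment> \<open>The multiplier depends on the two exponents but not on the row, so subtracting
    it is a genuine column operation.\<close>
  define c where "c l l' = (SOME c. \<forall>i\<in>{1..n}. \<phi> l i - c * \<phi> l' i = (\<Sum>k = Suc l'..l. w k l * \<psi> k i))" for l l'
  have c: "\<phi> l i - c l l' * \<phi> l' i = (\<Sum>k = Suc l'..l. w k l * \<psi> k i)"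
    if "l' < l" "i \<in> {1..n}" for l l' i
    using someI_ex[OF diff[OF that(1)]] that(2) unfolding c_def by blast
  have eq: "(if j < n then \<phi> (lam j + n - j) i - c (lam j + n - j) (lam (Suc j) + n - Suc j) * \<phi> (lam (Suc j) + n - Suc j) i
       else \<phi> (lam j + n - j) i) =
      (\<Sum>v\<in>{lam (Suc j)..lam j}. w (v + n - j) (lam j + n - j) * \<psi> (v + n - j) i)"
    if "1 \<le> i" "i \<le> n" "1 \<le> j" "j \<le> n" for i j
  proof (cases "j < n")
    case True
    have "lam (Suc j) \<le> lam j"
      using lam that by (auto simp: bounded_partition_def)
    then have "\<phi> (lam j + n - j) i - c (lam j + n - j) (lam (Suc j) + n - Suc j) * \<phi> (lam (Suc j) + n - Suc j) i
      = (\<Sum>k = Suc (lam (Suc j) + n - Suc j)..lam j + n - j. w k (lam j + n - j) * \<psi> k i)"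
      using True that by (intro c) auto
    also have "\<dots> = (\<Sum>v\<in>{lam (Suc j)..lam j}. w (v + n - j) (lam j + n - j) * \<psi> (v + n - j) i)"
      using True by (intro sum.reindex_bij_witness[of _ "\<lambda>v. v + n - j" "\<lambda>k. k + j - n"]) auto
    finally show ?thesis using True by simp
  next
    case False
    then have [simp]: "j = n" using that by simp
    \<comment> \<open>The last column has no right neighbour; its expansion from exponent 0 fits the
      same pattern because the next part is zero.\<close>
    have "lam (Suc n) = 0"
      using lam by (auto simp: bounded_partition_def)
    then show ?thesis using last that by simp
  qed
  have "det1 n (\<lambda>i j. \<phi> (lam j + n - j) i) =
    det1 n (\<lambda>i j. \<Sum>v\<in>{lam (Suc j)..lam j}. w (v + n - j) (lam j + n - j) * \<psi> (v + n - j) i)"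
    by (subst det1_column_op[symmetric,
        where c = "\<lambda>j. c (lam j + n - j) (lam (Suc j) + n - Suc j)"])
      (intro det1_cong eq)
  also have "\<dots> = (\<Sum>nu\<in>PiE {1..n} (\<lambda>j. {lam (Suc j)..lam j}).
     (\<Prod>j = 1..n. w (nu j + n - j) (lam j + n - j)) * det1 n (\<lambda>i j. \<psi> (nu j + n - j) i))"
    by (rule det1_multilinear) simp
  also have "\<dots> = (\<Sum>nu\<in>hstrips lam. (\<Prod>j = 1..n. w (nu j + n - j) (lam j + n - j)) * det1 n (\<lambda>i j. \<psi> (nu j + n - j) i))"
    by (rule sum_hstrips[OF lam]) (auto intro!: arg_cong2[of _ _ _ _ "(*)"] det1_cong prod.cong)
  finally show ?thesis .
qed

text \<open>Since \<open>d (Suc n) = 0\<close>, the column operations clear the last row except for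
  its corner entry, which sits in the unmodified last column. The other \<open>d i\<close> are row
  factors of the remaining minor. The range \<open>l'..<l\<close>, one lower than in
  \<open>det1_hstrip_same\<close>, makes the new exponents fit a determinant of size
  \<open>n\<close>.\<close>

lemma det1_hstrip_smaller:
  fixes \<phi> \<psi> :: "nat \<Rightarrow> nat \<Rightarrow> 'a::idom"
  assumes lam: "bounded_partition (Suc n) lam"
    and diff: "\<And>l l'. l' < l \<Longrightarrow>
      \<exists>c. \<forall>i\<in>{1..Suc n}. \<phi> l i - c * \<phi> l' i = d i * (\<Sum>k = l'..<l. w k l * \<psi> k i)"
    and d: "d (Suc n) = 0"
  shows "det1 (Suc n) (\<lambda>i j. \<phi> (lam j + Suc n - j) i) =
    \<phi> (lam (Suc n)) (Suc n) * (\<Prod>i = 1..n. d i) *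
    (\<Sum>mu | mu \<in> hstrips lam \<and> mu (Suc n) = 0. (\<Prod>j = 1..n. w (mu j + n - j) (lam j + Suc n - j)) *
       det1 n (\<lambda>i j. \<psi> (mu j + n - j) i))"
proof -
  define c where "c l l' = (SOME c. \<forall>i\<in>{1..Suc n}. \<phi> l i - c * \<phi> l' i = d i * (\<Sum>k = l'..<l. w k l * \<psi> k i))" for l l'
  have c: "\<phi> l i - c l l' * \<phi> l' i = d i * (\<Sum>k = l'..<l. w k l * \<psi> k i)"
    if "l' < l" "i \<in> {1..Suc n}" for l l' i
    using someI_ex[OF diff[OF that(1)]] that(2) unfolding c_def by blast
  have eq: "\<phi> (lam j + Suc n - j) i - c (lam j + Suc n - j) (lam (Suc j) + n - j) * \<phi> (lam (Suc j) + n - j) i =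
      d i * (\<Sum>v\<in>{lam (Suc j)..lam j}. w (v + n - j) (lam j + Suc n - j) * \<psi> (v + n - j) i)"
    if "1 \<le> i" "i \<le> Suc n" "1 \<le> j" "j \<le> n" for i j
  proof -
    have "lam (Suc j) \<le> lam j"
      using lam that by (auto simp: bounded_partition_def)
    then have "\<phi> (lam j + Suc n - j) i - c (lam j + Suc n - j) (lam (Suc j) + n - j) * \<phi> (lam (Suc j) + n - j) i
      = d i * (\<Sum>k = lam (Suc j) + n - j..<lam j + Suc n - j. w k (lam j + Suc n - j) * \<psi> k i)"
      using that by (intro c) auto
    also have "(\<Sum>k = lam (Suc j) + n - j..<lam j + Suc n - j. w k (lam j + Suc n - j) * \<psi> k i)
       = (\<Sum>v\<in>{lam (Suc j)..lam j}. w (v + n - j) (lam j + Suc n - j) * \<psi> (v + n - j) i)"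
      using that by (intro sum.reindex_bij_witness[of _ "\<lambda>v. v + n - j" "\<lambda>k. k + j - n"]) auto
    finally show ?thesis .
  qed
  have "det1 (Suc n) (\<lambda>i j. \<phi> (lam j + Suc n - j) i) =
    det1 (Suc n) (\<lambda>i j. if j < Suc n then \<phi> (lam j + Suc n - j) i -
       c (lam j + Suc n - j) (lam (Suc j) + n - j) * \<phi> (lam (Suc j) + n - j) i else \<phi> (lam j + Suc n - j) i)"
    using det1_column_op[of "Suc n" "\<lambda>i j. \<phi> (lam j + Suc n - j) i"
        "\<lambda>j. c (lam j + Suc n - j) (lam (Suc j) + n - j)", symmetric]
    by (simp only: add_Suc_right diff_Suc_Suc)
  also have "\<dots> = \<phi> (lam (Suc n)) (Suc n) * det1 n (\<lambda>i j. if j < Suc n then \<phi> (lam j + Suc n - j) i -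
       c (lam j + Suc n - j) (lam (Suc j) + n - j) * \<phi> (lam (Suc j) + n - j) i else \<phi> (lam j + Suc n - j) i)"
    by (subst det1_last_row) (use eq[of "Suc n"] d in simp_all)
  also have "det1 n (\<lambda>i j. if j < Suc n then \<phi> (lam j + Suc n - j) i -
       c (lam j + Suc n - j) (lam (Suc j) + n - j) * \<phi> (lam (Suc j) + n - j) i else \<phi> (lam j + Suc n - j) i) =
     det1 n (\<lambda>i j. d i * (\<Sum>v\<in>{lam (Suc j)..lam j}. w (v + n - j) (lam j + Suc n - j) * \<psi> (v + n - j) i))"
    by (rule det1_cong) (use eq in simp)
  also have "\<dots> = (\<Prod>i = 1..n. d i) * (\<Sum>mu\<in>PiE {1..n} (\<lambda>j. {lam (Suc j)..lam j}).
     (\<Prod>j = 1..n. w (mu j + n - j) (lam j + Suc n - j)) * det1 n (\<lambda>i j. \<psi> (mu j + n - j) i))"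
    by (subst det1_row_scale, subst det1_multilinear) simp_all
  also have "(\<Sum>mu\<in>PiE {1..n} (\<lambda>j. {lam (Suc j)..lam j}).
     (\<Prod>j = 1..n. w (mu j + n - j) (lam j + Suc n - j)) * det1 n (\<lambda>i j. \<psi> (mu j + n - j) i)) =
    (\<Sum>mu | mu \<in> hstrips lam \<and> mu (Suc n) = 0. (\<Prod>j = 1..n. w (mu j + n - j) (lam j + Suc n - j)) *
       det1 n (\<lambda>i j. \<psi> (mu j + n - j) i))"
    unfolding hstrips_smaller_eq[OF lam]
    by (rule sum_PiE_extend_zero) (auto intro!: arg_cong2[of _ _ _ _ "(*)"] det1_cong prod.cong)
  finally show ?thesis by (simp add: mult.assoc)
qed

subsection \<open>Removing the largest letter of a tableau\<close>

text \<open>Positive parts occupy an initial segment of the rows, so a box in row \<open>i\<close>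
  already forces \<open>i \<le> num_parts lam\<close>.\<close>

lemma diagram_eq:
  assumes "bounded_partition n lam"
  shows "diagram lam = {(i, j). 1 \<le> i \<and> 1 \<le> j \<and> j \<le> lam i}"
proof -
  let ?S = "{i. 1 \<le> i \<and> 0 < lam i}"
  have "?S \<subseteq> {1..n}"
    using assms by (auto simp: bounded_partition_def not_less[symmetric])
  then have fin: "finite ?S" by (rule finite_subset) simp
  have "i \<le> num_parts lam" if "1 \<le> i" "0 < lam i" for i
  proof -
    have "{1..i} \<subseteq> ?S"
      using that bounded_partition_antimono[OF assms, of _ i] by fastforce
    then have "card {1..i} \<le> card ?S" by (rule card_mono[OF fin])
    then show ?thesis by (simp add: num_parts_def)
  qed
  then show ?thesis by (auto simp: diagram_def)
qed

lemma is_partition_imp_bounded: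
  assumes "is_partition lam" "num_parts lam \<le> n"
  shows "bounded_partition n lam"
proof -
  let ?S = "{i. 1 \<le> i \<and> 0 < lam i}"
  have fin: "finite ?S" and part: "\<And>i. i \<ge> 1 \<Longrightarrow> lam (Suc i) \<le> lam i"
    using assms(1) by (auto simp: is_partition_def)
  have anti: "lam j \<le> lam i" if "1 \<le> i" "i \<le> j" for i j
    using that(2)
  proof (induction j rule: dec_induct)
    case (step k)
    then show ?case using part[of k] that(1) by simp
  qed simp
  have "lam i = 0" if "i > n" for i
  proof (rule ccontr)
    assume "lam i \<noteq> 0"
    then have "{1..i} \<subseteq> ?S"
      using anti[of _ i] by fastforce
    then have "card {1..i} \<le> card ?S" by (rule card_mono[OF fin])
    then show False using that assms(2) by (simp add: num_parts_def)
  qed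
  then show ?thesis using part by (simp add: bounded_partition_def)
qed

text \<open>The letters in \<open>V\<close> form vertical strips and all other letters form horizontal strips;
  \<open>R i e\<close> says that the letter \<open>e\<close> may occur in row \<open>i\<close>.\<close>

definition tableaux ::
  "'e::linorder set \<Rightarrow> 'e set \<Rightarrow> (nat \<Rightarrow> 'e \<Rightarrow> bool) \<Rightarrow> (nat \<Rightarrow> nat) \<Rightarrow> (nat \<times> nat \<Rightarrow> 'e) set" where
  "tableaux A V R lam = {T \<in> diagram lam \<rightarrow>\<^sub>E A.
     rows_weak lam T \<and> cols_weak lam T \<and> cols_distinct lam (- V) T \<and>
     (\<forall>i j j'. (i, j) \<in> diagram lam \<longrightarrow> (i, j') \<in> diagram lam \<longrightarrow>
        T (i, j) \<in> V \<longrightarrow> T (i, j) = T (i, j') \<longrightarrow> j = j') \<and>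
     (\<forall>i j. (i, j) \<in> diagram lam \<longrightarrow> R i (T (i, j)))}"

text \<open>The shapes \<open>nu\<close> for which \<open>lam/nu\<close> is a vertical strip. In
  contrast to horizontal strips, the inequalities alone do not make \<open>nu\<close> a
  partition.\<close>

definition vstrips :: "nat \<Rightarrow> (nat \<Rightarrow> nat) \<Rightarrow> (nat \<Rightarrow> nat) set" where
  "vstrips n lam = {nu. nu 0 = 0 \<and> bounded_partition n nu \<and> (\<forall>i\<ge>1. nu i \<le> lam i \<and> lam i \<le> Suc (nu i))}"

definition fill :: "(nat \<Rightarrow> nat) \<Rightarrow> (nat \<Rightarrow> nat) \<Rightarrow> 'e \<Rightarrow> (nat \<times> nat \<Rightarrow> 'e) \<Rightarrow> nat \<times> nat \<Rightarrow> 'e" where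
  "fill lam nu m T = (\<lambda>c. if c \<in> diagram nu then T c else if c \<in> diagram lam then m else undefined)"

definition shape_without ::
  "'e \<Rightarrow> (nat \<Rightarrow> nat) \<Rightarrow> (nat \<times> nat \<Rightarrow> 'e) \<Rightarrow> nat \<Rightarrow> nat" where
  "shape_without m lam T = (\<lambda>i. if i = 0 then 0 else card {j \<in> {1..lam i}. T (i, j) \<noteq> m})"

lemma finite_diagram:
  assumes "bounded_partition n lam"
  shows "finite (diagram lam)"
proof -
  have "diagram lam = Sigma {1..n} (\<lambda>i. {1..lam i})"
    using assms unfolding diagram_eq[OF assms]
    by (auto simp: bounded_partition_def not_less[symmetric])
  then show ?thesis by simp
qed

lemma finite_tableaux:
  assumes "bounded_partition n lam" "finite A"
  shows "finite (tableaux A V R lam)"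
proof (rule finite_subset)
  show "tableaux A V R lam \<subseteq> diagram lam \<rightarrow>\<^sub>E A" by (auto simp: tableaux_def)
qed (intro finite_PiE assms finite_diagram[OF assms(1)])

lemma finite_vstrips: "finite (vstrips n lam)"
proof (rule finite_subset)
  show "vstrips n lam \<subseteq> {nu. \<forall>i. nu i \<in> (if i \<in> {1..n} then {..lam i} else {0})}"
    by (auto simp: vstrips_def bounded_partition_def not_less_eq_eq)
  show "finite {nu. \<forall>i. nu i \<in> (if i \<in> {1..n} then {..lam i} else {0})}"
    unfolding bij_betw_finite[OF bij_betw_restrict_PiE] by (intro finite_PiE) auto
qed

lemma tableaux_le_top:
  assumes "T \<in> tableaux (insert m A) V R lam" "\<And>e. e \<in> A \<Longrightarrow> e < m" "(i, j) \<in> diagram lam"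
  shows "T (i, j) \<le> m"
  using assms by (auto simp: tableaux_def PiE_iff less_imp_le)

lemma tableaux_row_distinct:
  assumes "T \<in> tableaux A V R lam" "(i, j) \<in> diagram lam" "(i, j') \<in> diagram lam"
    "T (i, j) \<in> V" "T (i, j) = T (i, j')"
  shows "j = j'"
  using assms unfolding tableaux_def by blast

context
  fixes n :: nat and lam :: "nat \<Rightarrow> nat" and m :: "'e::linorder" and A V :: "'e set"
    and R :: "nat \<Rightarrow> 'e \<Rightarrow> bool"
  assumes lam: "bounded_partition n lam"
    and top: "\<And>e. e \<in> A \<Longrightarrow> e < m"
begin

text \<open>Since \<open>m\<close> is the largest letter and rows increase weakly, the boxes without
  \<open>m\<close> form an initial segment of each row; hence counting them locates them.\<close>

lemma shape_without_iff:
  assumes T: "T \<in> tableaux (insert m A) V R lam" and ij: "(i, j) \<in> diagram lam"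
  shows "j \<le> shape_without m lam T i \<longleftrightarrow> T (i, j) \<noteq> m"
proof -
  let ?S = "{j \<in> {1..lam i}. T (i, j) \<noteq> m}"
  have i: "i \<ge> 1" and j: "1 \<le> j" "j \<le> lam i"
    using ij by (auto simp: diagram_eq[OF lam])
  have down: "j1 \<in> ?S" if "j2 \<in> ?S" "1 \<le> j1" "j1 \<le> j2" for j1 j2
  proof -
    have d: "(i, j1) \<in> diagram lam" "(i, j2) \<in> diagram lam"
      using that i by (auto simp: diagram_eq[OF lam])
    have "T (i, j1) \<le> T (i, j2)"
      using T d that(3) unfolding tableaux_def rows_weak_def by blast
    moreover have "T (i, j2) \<le> m"
      by (rule tableaux_le_top[OF T top d(2)])
    ultimately have "T (i, j1) \<noteq> m" using that(1) by auto
    then show ?thesis using that by auto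
  qed
  show ?thesis
  proof
    assume "j \<le> shape_without m lam T i"
    then have le: "j \<le> card ?S" using i by (simp add: shape_without_def)
    show "T (i, j) \<noteq> m"
    proof
      assume eq: "T (i, j) = m"
      have "?S \<subseteq> {1..<j}"
        using down[of _ j] eq j by (fastforce simp: not_less[symmetric])
      then have "card ?S \<le> card {1..<j}" by (rule card_mono[rotated]) simp
      then show False using le j by simp
    qed
  next
    assume "T (i, j) \<noteq> m"
    then have "j \<in> ?S" using j by simp
    have "{1..j} \<subseteq> ?S"
    proof
      fix k assume "k \<in> {1..j}"
      then have "1 \<le> k" "k \<le> j" by simp_all
      then show "k \<in> ?S" by (rule down[OF \<open>j \<in> ?S\<close>])
    qed
    then have "card {1..j} \<le> card ?S" by (rule card_mono[rotated]) simp
    then show "j \<le> shape_without m lam T i" using i by (simp add: shape_without_def)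
  qed
qed

lemma shape_without_le: "i \<ge> 1 \<Longrightarrow> shape_without m lam T i \<le> lam i"
proof -
  assume "i \<ge> 1"
  have "card {j \<in> {1..lam i}. T (i, j) \<noteq> m} \<le> card {1..lam i}"
    by (rule card_mono) auto
  then show ?thesis by (simp add: shape_without_def)
qed

lemma shape_without_bounded:
  assumes T: "T \<in> tableaux (insert m A) V R lam"
  shows "bounded_partition n (shape_without m lam T)"
  unfolding bounded_partition_def
proof (intro conjI allI impI)
  fix i :: nat assume i: "i \<ge> 1"
  define j where "j = shape_without m lam T (Suc i)"
  show "shape_without m lam T (Suc i) \<le> shape_without m lam T i"
  proof (cases "j = 0")
    case False
    have "j \<le> lam (Suc i)" unfolding j_def by (rule shape_without_le) simp
    moreover have "lam (Suc i) \<le> lam i"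
      using lam i by (simp add: bounded_partition_def)
    ultimately have d: "(i, j) \<in> diagram lam" "(Suc i, j) \<in> diagram lam"
      using i False by (auto simp: diagram_eq[OF lam])
    have "T (i, j) \<le> T (Suc i, j)"
      using T d le_SucI[OF order_refl, of i] unfolding tableaux_def cols_weak_def by blast
    moreover have "T (Suc i, j) \<le> m" by (rule tableaux_le_top[OF T top d(2)])
    moreover have "T (Suc i, j) \<noteq> m"
      using shape_without_iff[OF T d(2)] by (simp add: j_def)
    ultimately have "T (i, j) \<noteq> m" by auto
    then show ?thesis
      using shape_without_iff[OF T d(1)] by (simp add: j_def)
  qed (simp add: j_def)
next
  fix i assume "i > n"
  then show "shape_without m lam T i = 0"
    using lam by (simp add: shape_without_def bounded_partition_def)
qed

text \<open>If \<open>m\<close> is in \<open>V\<close>, two boxes with \<open>m\<close> in one row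
  contradict the row condition; otherwise two such boxes in adjacent rows of one column contradict
  distinctness.\<close>

lemma shape_without_strip:
  assumes T: "T \<in> tableaux (insert m A) V R lam"
  shows "shape_without m lam T \<in> (if m \<in> V then vstrips n lam else hstrips lam)"
proof -
  have 0: "shape_without m lam T 0 = 0" by (simp add: shape_without_def)
  have "lam i \<le> Suc (shape_without m lam T i)" if V: "m \<in> V" and i: "i \<ge> 1" for i
  proof (rule ccontr)
    assume less: "\<not> lam i \<le> Suc (shape_without m lam T i)"
    let ?j = "Suc (shape_without m lam T i)"
    have d: "(i, ?j) \<in> diagram lam" "(i, Suc ?j) \<in> diagram lam"
      using less i by (auto simp: diagram_eq[OF lam])
    have "T (i, ?j) = m" "T (i, Suc ?j) = m"
      using shape_without_iff[OF T d(1)] shape_without_iff[OF T d(2)] by auto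
    then have "?j = Suc ?j"
      using V by (intro tableaux_row_distinct[OF T d]) simp_all
    then show False by simp
  qed
  moreover have "lam (Suc i) \<le> shape_without m lam T i" if V: "m \<notin> V" and i: "i \<ge> 1" for i
  proof (cases "lam (Suc i) = 0")
    case False
    let ?j = "lam (Suc i)"
    have "lam (Suc i) \<le> lam i"
      using lam i by (simp add: bounded_partition_def)
    then have d: "(i, ?j) \<in> diagram lam" "(Suc i, ?j) \<in> diagram lam"
      using i False by (auto simp: diagram_eq[OF lam])
    have le: "T (i, ?j) \<le> T (Suc i, ?j)"
      using T d le_SucI[OF order_refl, of i] unfolding tableaux_def cols_weak_def by blast
    have top': "T (Suc i, ?j) \<le> m" by (rule tableaux_le_top[OF T top d(2)])
    have "T (i, ?j) \<noteq> m"
    proof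
      assume m: "T (i, ?j) = m"
      then have "T (Suc i, ?j) = m" using le top' by simp
      moreover have "T (i, ?j) \<noteq> T (Suc i, ?j)"
      proof -
        have "cols_distinct lam (- V) T" using T by (simp add: tableaux_def)
        then show ?thesis using d m V unfolding cols_distinct_def by (metis ComplI n_not_Suc_n)
      qed
      ultimately show False using m by simp
    qed
    then show ?thesis using shape_without_iff[OF T d(1)] by simp
  qed simp
  ultimately show ?thesis
    using 0 shape_without_bounded[OF T] shape_without_le
    by (auto simp: vstrips_def hstrips_def)
qed

lemma strip_bounded:
  assumes "nu \<in> (if m \<in> V then vstrips n lam else hstrips lam)"
  shows "bounded_partition n nu"
  using assms hstrips_bounded_partition[OF lam] by (auto simp: vstrips_def split: if_splits)

lemma strip_diagram_subset:
  assumes "nu \<in> (if m \<in> V then vstrips n lam else hstrips lam)"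
  shows "diagram nu \<subseteq> diagram lam"
  using assms unfolding diagram_eq[OF lam] diagram_eq[OF strip_bounded[OF assms]]
  by (auto simp: vstrips_def hstrips_def split: if_splits intro: le_trans)

lemma restrict_in_tableaux:
  assumes T: "T \<in> tableaux (insert m A) V R lam"
  defines "nu \<equiv> shape_without m lam T"
  shows "restrict T (diagram nu) \<in> tableaux A V R nu"
proof -
  have nu: "bounded_partition n nu" unfolding nu_def by (rule shape_without_bounded[OF T])
  have sub: "diagram nu \<subseteq> diagram lam"
    unfolding nu_def by (rule strip_diagram_subset[OF shape_without_strip[OF T]])
  have ne: "T (i, j) \<noteq> m" if "(i, j) \<in> diagram nu" for i j
  proof -
    have "j \<le> nu i" using that by (auto simp: diagram_eq[OF nu])
    then show ?thesis
      using shape_without_iff[OF T subsetD[OF sub that]] by (simp add: nu_def)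
  qed
  have A: "T c \<in> A" if "c \<in> diagram nu" for c
  proof -
    have "T c \<in> insert m A" using T that sub unfolding tableaux_def PiE_iff by blast
    then show ?thesis using ne that by (cases c) auto
  qed
  have "restrict T (diagram nu) \<in> diagram nu \<rightarrow>\<^sub>E A"
    using A by auto
  moreover have "rows_weak nu (restrict T (diagram nu))" "cols_weak nu (restrict T (diagram nu))"
    "cols_distinct nu (- V) (restrict T (diagram nu))"
    using T sub unfolding tableaux_def rows_weak_def cols_weak_def cols_distinct_def
    by (simp_all add: subset_iff)
  moreover have "j = j'" if "(i, j) \<in> diagram nu" "(i, j') \<in> diagram nu"
      "restrict T (diagram nu) (i, j) \<in> V" "restrict T (diagram nu) (i, j) = restrict T (diagram nu) (i, j')"
    for i j j'
    using that sub by (intro tableaux_row_distinct[OF T, of i]) auto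
  moreover have "R i (restrict T (diagram nu) (i, j))" if "(i, j) \<in> diagram nu" for i j
    using T sub that unfolding tableaux_def by auto
  ultimately show ?thesis
    unfolding tableaux_def by blast
qed

lemma fill_in_tableaux:
  assumes R: "\<And>i. i \<in> {1..n} \<Longrightarrow> R i m"
    and nu: "nu \<in> (if m \<in> V then vstrips n lam else hstrips lam)"
    and T: "T \<in> tableaux A V R nu"
  shows "fill lam nu m T \<in> tableaux (insert m A) V R lam"
proof -
  note nub = strip_bounded[OF nu]
  note sub = strip_diagram_subset[OF nu]
  have TA: "T c \<in> A" if "c \<in> diagram nu" for c
    using T that by (auto simp: tableaux_def)
  have 1: "rows_weak lam (fill lam nu m T)"
    unfolding rows_weak_def
  proof (intro allI impI)
    fix i j j' assume d: "(i, j) \<in> diagram lam" "(i, j') \<in> diagram lam" "j \<le> j'"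
    show "fill lam nu m T (i, j) \<le> fill lam nu m T (i, j')"
    proof (cases "(i, j') \<in> diagram nu")
      case True
      then have "(i, j) \<in> diagram nu"
        using d by (auto simp: diagram_eq[OF nub] diagram_eq[OF lam])
      then show ?thesis
        using T True d(3) by (simp add: fill_def tableaux_def rows_weak_def)
    next
      case False
      then show ?thesis
        using d TA[of "(i, j)"] top by (auto simp: fill_def less_imp_le)
    qed
  qed
  have 2: "cols_weak lam (fill lam nu m T)"
    unfolding cols_weak_def
  proof (intro allI impI)
    fix i i' j assume d: "(i, j) \<in> diagram lam" "(i', j) \<in> diagram lam" "i \<le> i'"
    show "fill lam nu m T (i, j) \<le> fill lam nu m T (i', j)"
    proof (cases "(i', j) \<in> diagram nu")
      case True
      then have "(i, j) \<in> diagram nu"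
        using d bounded_partition_antimono[OF nub, of i i']
        by (auto simp: diagram_eq[OF nub] diagram_eq[OF lam])
      then show ?thesis
        using T True d(3) by (simp add: fill_def tableaux_def cols_weak_def)
    next
      case False
      then show ?thesis
        using d TA[of "(i, j)"] top by (auto simp: fill_def less_imp_le)
    qed
  qed
  \<comment> \<open>Horizontal strips satisfy \<open>lam (Suc i) \<le> nu i\<close>, so below a box
    added in row \<open>i\<close> there is no box of \<open>lam\<close> at all.\<close>
  have outside: False
    if "m \<notin> V" "i < i'" "(i, j) \<in> diagram lam" "(i, j) \<notin> diagram nu" "(i', j) \<in> diagram lam" for i i' j
  proof -
    have "lam i' \<le> lam (Suc i)"
      using that by (intro bounded_partition_antimono[OF lam]) auto
    moreover have "lam (Suc i) \<le> nu i"
      using nu that by (auto simp: hstrips_def diagram_eq[OF lam])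
    ultimately show False
      using that by (auto simp: diagram_eq[OF lam] diagram_eq[OF nub])
  qed
  have 3: "cols_distinct lam (- V) (fill lam nu m T)"
    unfolding cols_distinct_def
  proof (intro allI impI)
    fix i i' j assume d: "(i, j) \<in> diagram lam" "(i', j) \<in> diagram lam" "i \<noteq> i'"
      "fill lam nu m T (i, j) \<in> - V"
    show "fill lam nu m T (i, j) \<noteq> fill lam nu m T (i', j)"
    proof (cases "(i, j) \<in> diagram nu")
      case True
      show ?thesis
      proof (cases "(i', j) \<in> diagram nu")
        case True
        then show ?thesis
          using T d \<open>(i, j) \<in> diagram nu\<close> by (simp add: fill_def tableaux_def cols_distinct_def)
      next
        case False
        then show ?thesis
          using TA[OF True] top[of "T (i, j)"] True d by (auto simp: fill_def)
      qed
    next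
      case False
      then have "m \<notin> V" using d by (simp add: fill_def)
      show ?thesis
      proof (cases "(i', j) \<in> diagram nu")
        case True
        then show ?thesis
          using TA[OF True] top[of "T (i', j)"] False d by (auto simp: fill_def)
      next
        case False2: False
        then show ?thesis
          using outside[OF \<open>m \<notin> V\<close>, of i i' j] outside[OF \<open>m \<notin> V\<close>, of i' i j] d False
          by (cases "i < i'") auto
      qed
    qed
  qed
  have 4: "j = j'" if d: "(i, j) \<in> diagram lam" "(i, j') \<in> diagram lam"
      "fill lam nu m T (i, j) \<in> V" "fill lam nu m T (i, j) = fill lam nu m T (i, j')" for i j j'
  proof (cases "(i, j) \<in> diagram nu")
    case True
    show ?thesis
    proof (cases "(i, j') \<in> diagram nu")
      case True2: True
      then have "T (i, j) \<in> V" "T (i, j) = T (i, j')"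
        using d True by (auto simp: fill_def)
      then show ?thesis
        using T True True2 unfolding tableaux_def by blast
    next
      case False
      then show ?thesis
        using TA[OF True] top[of "T (i, j)"] True d by (auto simp: fill_def)
    qed
  next
    case False
    then have V: "m \<in> V" using d by (simp add: fill_def)
    show ?thesis
    proof (cases "(i, j') \<in> diagram nu")
      case True
      then show ?thesis
        using TA[OF True] top[of "T (i, j')"] False d by (auto simp: fill_def)
    next
      case False2: False
      have "lam i \<le> Suc (nu i)"
        using nu V d by (auto simp: vstrips_def diagram_eq[OF lam])
      then show ?thesis
        using False False2 d by (auto simp: diagram_eq[OF lam] diagram_eq[OF nub])
    qed
  qed
  have 5: "R i (fill lam nu m T (i, j))" if d: "(i, j) \<in> diagram lam" for i j
  proof (cases "(i, j) \<in> diagram nu")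
    case True
    then show ?thesis using T by (simp add: fill_def tableaux_def)
  next
    case False
    have "i \<le> n"
      using d lam by (auto simp: diagram_eq[OF lam] bounded_partition_def not_less[symmetric])
    then show ?thesis using False d R by (auto simp: fill_def diagram_eq[OF lam])
  qed
  have 6: "fill lam nu m T \<in> diagram lam \<rightarrow>\<^sub>E insert m A"
    using TA sub by (auto simp: fill_def)
  show ?thesis
    unfolding tableaux_def using 1 2 3 6 by (blast intro: 4 5)
qed

lemma shape_without_fill:
  assumes nu: "nu \<in> (if m \<in> V then vstrips n lam else hstrips lam)"
    and T: "T \<in> tableaux A V R nu"
  shows "shape_without m lam (fill lam nu m T) = nu"
proof
  fix i
  note nub = strip_bounded[OF nu]
  note sub = strip_diagram_subset[OF nu]
  show "shape_without m lam (fill lam nu m T) i = nu i"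
  proof (cases "i = 0")
    case True
    then show ?thesis using nu by (auto simp: shape_without_def vstrips_def hstrips_def split: if_splits)
  next
    case False
    have ne: "T c \<noteq> m" if "c \<in> diagram nu" for c
      using T that top[of "T c"] by (auto simp: tableaux_def)
    have le: "nu i \<le> lam i"
      using nu False by (auto simp: vstrips_def hstrips_def split: if_splits)
    have "{j \<in> {1..lam i}. fill lam nu m T (i, j) \<noteq> m} = {1..nu i}"
    proof (intro equalityI subsetI)
      fix j assume "j \<in> {j \<in> {1..lam i}. fill lam nu m T (i, j) \<noteq> m}"
      then show "j \<in> {1..nu i}"
        using False by (auto simp: fill_def diagram_eq[OF lam] diagram_eq[OF nub] split: if_splits)
    next
      fix j assume "j \<in> {1..nu i}"
      then have "(i, j) \<in> diagram nu" using False by (auto simp: diagram_eq[OF nub])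
      then show "j \<in> {j \<in> {1..lam i}. fill lam nu m T (i, j) \<noteq> m}"
        using ne le \<open>j \<in> {1..nu i}\<close> by (auto simp: fill_def)
    qed
    then show ?thesis using False by (simp add: shape_without_def)
  qed
qed

lemma fill_restrict:
  assumes T: "T \<in> tableaux (insert m A) V R lam"
  shows "fill lam (shape_without m lam T) m (restrict T (diagram (shape_without m lam T))) = T"
proof
  fix c :: "nat \<times> nat"
  obtain i j where c: "c = (i, j)" by (cases c)
  note nub = shape_without_bounded[OF T]
  show "fill lam (shape_without m lam T) m (restrict T (diagram (shape_without m lam T))) c = T c"
  proof (cases "(i, j) \<in> diagram lam")
    case True
    then show ?thesis
      using shape_without_iff[OF T True]
      by (auto simp: c fill_def diagram_eq[OF nub] diagram_eq[OF lam])
  next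
    case False
    then have "T (i, j) = undefined"
      using T by (auto simp: tableaux_def PiE_iff extensional_def)
    moreover have "(i, j) \<notin> diagram (shape_without m lam T)"
      using strip_diagram_subset[OF shape_without_strip[OF T]] False by blast
    ultimately show ?thesis using False by (simp add: c fill_def)
  qed
qed

text \<open>Branching rule: a tableau corresponds to the shape of its boxes without \<open>m\<close>
  together with its restriction to that shape. \<open>F\<close> is arbitrary because the even
  orthogonal weight is not a product over boxes.\<close>

lemma sum_tableaux_insert:
  assumes R: "\<And>i. i \<in> {1..n} \<Longrightarrow> R i m" and A: "finite A"
  shows "(\<Sum>T\<in>tableaux (insert m A) V R lam. F T) =
    (\<Sum>nu\<in>(if m \<in> V then vstrips n lam else hstrips lam). \<Sum>T\<in>tableaux A V R nu. F (fill lam nu m T))"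
proof -
  let ?S = "if m \<in> V then vstrips n lam else hstrips lam"
  have "(\<Sum>nu\<in>?S. \<Sum>T\<in>tableaux A V R nu. F (fill lam nu m T)) =
     (\<Sum>(nu, T)\<in>Sigma ?S (tableaux A V R). F (fill lam nu m T))"
    using finite_vstrips finite_hstrips[OF lam] finite_tableaux[OF strip_bounded A]
    by (intro sum.Sigma) auto
  also have "\<dots> = (\<Sum>T\<in>tableaux (insert m A) V R lam. F T)"
  proof (rule sum.reindex_bij_witness[of _
        "\<lambda>T. (shape_without m lam T, restrict T (diagram (shape_without m lam T)))"
        "\<lambda>(nu, T). fill lam nu m T"])
    fix p assume "p \<in> Sigma ?S (tableaux A V R)"
    then obtain nu T where p: "p = (nu, T)" "nu \<in> ?S" "T \<in> tableaux A V R nu" by blast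
    have "restrict (fill lam nu m T) (diagram nu) = T"
      using p(3) by (auto simp: fun_eq_iff fill_def tableaux_def PiE_iff extensional_def)
    then show "(shape_without m lam (case p of (nu, T) \<Rightarrow> fill lam nu m T),
        restrict (case p of (nu, T) \<Rightarrow> fill lam nu m T)
          (diagram (shape_without m lam (case p of (nu, T) \<Rightarrow> fill lam nu m T)))) = p"
      using shape_without_fill[OF p(2,3)] by (simp add: p)
    show "(case p of (nu, T) \<Rightarrow> fill lam nu m T) \<in> tableaux (insert m A) V R lam"
      using fill_in_tableaux[OF R p(2,3)] by (simp add: p)
  qed (use fill_restrict shape_without_strip restrict_in_tableaux in \<open>simp_all add: case_prod_beta\<close>)
  finally show ?thesis ..
qed

end

section \<open>Product weights along a strip\<close>

lemma prod_diagram: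
  assumes "bounded_partition n lam"
  shows "(\<Prod>(i, j)\<in>diagram lam. g i j) = (\<Prod>i = 1..n. \<Prod>j = 1..lam i. g i j)"
proof -
  have "diagram lam = Sigma {1..n} (\<lambda>i. {1..lam i})"
    using assms unfolding diagram_eq[OF assms]
    by (auto simp: bounded_partition_def not_less[symmetric])
  then show ?thesis by (simp add: prod.Sigma)
qed

lemma prod_diagram_fill:
  assumes lam: "bounded_partition n lam" and nu: "bounded_partition n nu"
    and le: "\<And>i. i \<ge> 1 \<Longrightarrow> nu i \<le> lam i"
  shows "(\<Prod>(i, j)\<in>diagram lam. w i j (fill lam nu m T (i, j))) =
    (\<Prod>i = 1..n. \<Prod>j = Suc (nu i)..lam i. w i j m) * (\<Prod>(i, j)\<in>diagram nu. w i j (T (i, j)))"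
proof -
  have "(\<Prod>j = 1..lam i. w i j (fill lam nu m T (i, j))) =
      (\<Prod>j = 1..nu i. w i j (T (i, j))) * (\<Prod>j = Suc (nu i)..lam i. w i j m)"
    if "i \<in> {1..n}" for i
  proof -
    have "{1..lam i} = {1..nu i} \<union> {Suc (nu i)..lam i}"
      using le[of i] that by auto
    then have "(\<Prod>j = 1..lam i. w i j (fill lam nu m T (i, j))) =
      (\<Prod>j = 1..nu i. w i j (fill lam nu m T (i, j))) * (\<Prod>j = Suc (nu i)..lam i. w i j (fill lam nu m T (i, j)))"
      by (simp only:) (intro prod.union_disjoint; auto)
    also have "\<dots> = (\<Prod>j = 1..nu i. w i j (T (i, j))) * (\<Prod>j = Suc (nu i)..lam i. w i j m)"
      using that by (intro arg_cong2[of _ _ _ _ "(*)"] prod.cong)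
        (auto simp: fill_def diagram_eq[OF nu] diagram_eq[OF lam])
    finally show ?thesis .
  qed
  then show ?thesis
    unfolding prod_diagram[OF lam, of "\<lambda>i j. w i j (fill lam nu m T (i, j))"]
      prod_diagram[OF nu, of "\<lambda>i j. w i j (T (i, j))"]
    by (simp add: prod.distrib mult.commute)
qed

subsection \<open>Newton interpolation of factorial powers\<close>

text \<open>The factorial power as a polynomial in its argument, so that linear functionals other
  than evaluation can be applied to it.\<close>

definition fact_poly :: "(int \<Rightarrow> 'a::comm_ring_1) \<Rightarrow> nat \<Rightarrow> 'a poly" where
  "fact_poly a m = (\<Prod>i = 1..m. [:a (int i), 1:])"

lemma poly_fact_poly: "poly (fact_poly a m) y = fact_pow y a m"
  by (simp add: fact_poly_def fact_pow_def poly_prod add.commute)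

lemma fact_poly_0 [simp]: "fact_poly a 0 = 1"
  by (simp add: fact_poly_def)

lemma fact_poly_Suc: "fact_poly a (Suc m) = fact_poly a m * [:a (int (Suc m)), 1:]"
  by (simp add: fact_poly_def)

text \<open>Multiplication by the variable prepends a factor whose parameter is zero. This is where
  the convention on parameters enters: \<open>b m = a (m - 1)\<close> starts with
  \<open>b 1 = a 0 = 0\<close>.\<close>

lemma pCons_fact_poly:
  assumes "b 1 = 0" "\<And>i. i \<ge> 1 \<Longrightarrow> b (int (Suc i)) = a (int i)"
  shows "pCons 0 (fact_poly a m) = fact_poly b (Suc m)"
proof (induction m)
  case 0
  show ?case using assms(1) by (simp add: fact_poly_def one_pCons)
next
  case (Suc m)
  have X: "pCons 0 p = [:0, 1:] * p" for p :: "'a poly" by simp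
  have "pCons 0 (fact_poly a (Suc m)) = pCons 0 (fact_poly a m) * [:a (int (Suc m)), 1:]"
    by (simp only: fact_poly_Suc X[of "fact_poly a m"] X[of "fact_poly a m * [:a (int (Suc m)), 1:]"] mult.assoc)
  moreover have "b (int (Suc (Suc m))) = a (int (Suc m))"
    by (rule assms(2)) simp
  ultimately show ?case
    by (simp only: Suc.IH fact_poly_Suc[of b "Suc m"])
qed

lemma smult_sum_right: "smult c (sum f A) = (\<Sum>x\<in>A. smult c (f x))"
  by (induction A rule: infinite_finite_induct) (simp_all add: smult_add_right)

text \<open>Induction on \<open>l\<close> with \<open>z + a_(l+1) = (y + a_(l+1)) + (z - y)\<close>:
  the first summand multiplies all earlier coefficients, the second adds the term
  \<open>k = l\<close> with coefficient 1.\<close>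

lemma fact_poly_newton:
  fixes a :: "int \<Rightarrow> 'a::comm_ring_1"
  assumes "l' \<le> l"
  shows "fact_poly a l - smult (\<Prod>s = Suc l'..l. y + a (int s)) (fact_poly a l') =
    [:- y, 1:] * (\<Sum>k = l'..<l. smult (\<Prod>s = k + 2..l. y + a (int s)) (fact_poly a k))"
  using assms
proof (induction l rule: dec_induct)
  case base
  then show ?case by simp
next
  case (step l)
  let ?c = "y + a (int (Suc l))"
  have 1: "fact_poly a (Suc l) = smult ?c (fact_poly a l) + [:- y, 1:] * fact_poly a l"
    by (simp add: fact_poly_Suc smult_add_left algebra_simps)
  have 2: "(\<Prod>s = Suc l'..Suc l. y + a (int s)) = ?c * (\<Prod>s = Suc l'..l. y + a (int s))"
    using step.hyps by (simp add: prod.nat_ivl_Suc' mult.commute)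
  have 3: "(\<Sum>k = l'..<Suc l. smult (\<Prod>s = k + 2..Suc l. y + a (int s)) (fact_poly a k)) =
     smult ?c (\<Sum>k = l'..<l. smult (\<Prod>s = k + 2..l. y + a (int s)) (fact_poly a k)) + fact_poly a l"
    using step.hyps by (simp add: prod.nat_ivl_Suc' smult_sum_right mult.commute cong: sum.cong_simp)
  have "fact_poly a (Suc l) - smult (\<Prod>s = Suc l'..Suc l. y + a (int s)) (fact_poly a l') =
    smult ?c (fact_poly a l - smult (\<Prod>s = Suc l'..l. y + a (int s)) (fact_poly a l')) + [:- y, 1:] * fact_poly a l"
    by (simp only: 1 2 smult_smult[symmetric] smult_diff_right) simp
  also have "\<dots> = [:- y, 1:] * (\<Sum>k = l'..<Suc l. smult (\<Prod>s = k + 2..Suc l. y + a (int s)) (fact_poly a k))"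
    by (simp only: step.IH 3 ring_distribs mult_smult_right)
  finally show ?case .
qed

definition poly_functional :: "('a::comm_ring_1 poly \<Rightarrow> 'a) \<Rightarrow> bool" where
  "poly_functional L \<longleftrightarrow> (\<forall>p q. L (p + q) = L p + L q) \<and> (\<forall>c p. L (smult c p) = c * L p)"

lemma poly_functional_simps:
  assumes "poly_functional L"
  shows "L (p + q) = L p + L q" "L (smult c p) = c * L p" "L 0 = 0" "L (- p) = - L p"
    "L (p - q) = L p - L q" "L (sum f A) = (\<Sum>x\<in>A. L (f x))"
proof -
  show add: "L (p + q) = L p + L q" for p q
    using assms by (simp add: poly_functional_def)
  show sm: "L (smult c p) = c * L p" for c p
    using assms by (simp add: poly_functional_def)
  show 0: "L 0 = 0" using sm[of 0 0] by simp
  show uminus: "L (- p) = - L p" for p using sm[of "-1" p] by simp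
  show "L (p - q) = L p - L q"
    using add[of p "- q"] by (simp add: uminus)
  show "L (sum f A) = (\<Sum>x\<in>A. L (f x))"
    by (induction A rule: infinite_finite_induct) (simp_all add: 0 add)
qed

text \<open>The prefactor \<open>p\<close> permits a second interpolation: after the one at
  \<open>1/y\<close> with \<open>p = 1\<close>, the one at \<open>y\<close> is applied with
  \<open>p = z - 1/y\<close>.\<close>

lemma functional_newton:
  fixes a :: "int \<Rightarrow> 'a::comm_ring_1"
  assumes "poly_functional L" "l' \<le> l"
  shows "L (p * fact_poly a l) - (\<Prod>s = Suc l'..l. y + a (int s)) * L (p * fact_poly a l') =
    (\<Sum>k = l'..<l. (\<Prod>s = k + 2..l. y + a (int s)) * L (p * [:- y, 1:] * fact_poly a k))"
proof -
  have "L (p * fact_poly a l) - (\<Prod>s = Suc l'..l. y + a (int s)) * L (p * fact_poly a l') =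
    L (p * (fact_poly a l - smult (\<Prod>s = Suc l'..l. y + a (int s)) (fact_poly a l')))"
    using poly_functional_simps[OF assms(1)] by (simp add: right_diff_distrib)
  also have "\<dots> = L (\<Sum>k = l'..<l. smult (\<Prod>s = k + 2..l. y + a (int s)) (p * [:- y, 1:] * fact_poly a k))"
    unfolding fact_poly_newton[OF assms(2)] mult.assoc[symmetric]
    by (simp only: sum_distrib_left mult_smult_right)
  also have "\<dots> = (\<Sum>k = l'..<l. (\<Prod>s = k + 2..l. y + a (int s)) * L (p * [:- y, 1:] * fact_poly a k))"
    by (simp only: poly_functional_simps[OF assms(1)])
  finally show ?thesis .
qed

text \<open>Going down to exponent 0 leaves a multiple of \<open>L 1\<close>, which is 0 for divided
  differences and 2 for the sum of two values.\<close>

lemma functional_newton_0: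
  fixes a :: "int \<Rightarrow> 'a::comm_ring_1"
  assumes "poly_functional L"
  shows "L (fact_poly a l) = fact_pow y a l * L 1 +
    (\<Sum>k = 0..<l. (\<Prod>s = k + 2..l. y + a (int s)) * L ([:- y, 1:] * fact_poly a k))"
  using functional_newton[OF assms, of 0 l 1 a y] by (simp add: fact_pow_def algebra_simps)

lemma quadratic_factor:
  fixes y :: "'a::field"
  assumes "y \<noteq> 0"
  shows "[:- inverse y, 1:] * [:- y, 1:] = [:1, - (y + inverse y), 1:]"
  using assms by (simp add: algebra_simps)

subsection \<open>Divided differences\<close>

text \<open>Synthetic division yields the quotient of \<open>p - p(x)\<close> by
  \<open>X - x\<close>; its value at \<open>y\<close> is \<open>(p(x) - p(y)) / (x - y)\<close>,
  written without division and hence meaningful also for \<open>x = y\<close>.\<close>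

definition divdiff :: "'a::comm_ring_1 \<Rightarrow> 'a \<Rightarrow> 'a poly \<Rightarrow> 'a" where
  "divdiff x y p = poly (synthetic_div p x) y"

lemma divdiff_0 [simp]: "divdiff x y 0 = 0"
  by (simp add: divdiff_def)

lemma divdiff_pCons [simp]: "divdiff x y (pCons c p) = poly p x + y * divdiff x y p"
  by (simp add: divdiff_def)

lemma divdiff_add: "divdiff x y (p + q) = divdiff x y p + divdiff x y q"
  by (induction p q rule: poly_induct2) (simp_all add: algebra_simps)

lemma divdiff_smult: "divdiff x y (smult c p) = c * divdiff x y p"
  by (induction p) (simp_all add: algebra_simps)

lemma divdiff_1 [simp]: "divdiff x y 1 = 0"
  by (simp add: one_pCons)

lemma poly_functional_divdiff: "poly_functional (divdiff x y)"
  by (simp add: poly_functional_def divdiff_add divdiff_smult)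

lemma divdiff_mult: "divdiff x y (p * q) = divdiff x y p * poly q x + poly p y * divdiff x y q"
  by (induction p) (simp_all add: divdiff_add divdiff_smult algebra_simps)

lemma divdiff_mult_diff: "(x - y) * divdiff x y p = poly p x - poly p y"
proof (induction p)
  case (pCons c p)
  have "(x - y) * divdiff x y (pCons c p) = (x - y) * poly p x + y * ((x - y) * divdiff x y p)"
    by (simp add: algebra_simps)
  also have "\<dots> = poly (pCons c p) x - poly (pCons c p) y"
    unfolding pCons.IH by (simp add: algebra_simps)
  finally show ?case .
qed simp

text \<open>\<open>1 - t z + z^2 = z (z + 1/z - t)\<close>, and \<open>z + 1/z\<close> takes the
  same value at \<open>x\<close> and \<open>1/x\<close>, so that factor comes out as a scalar while
  \<open>z\<close> stays inside.\<close>

lemma divdiff_quadratic: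
  fixes x :: "'a::field"
  assumes "x \<noteq> 0"
  shows "divdiff x (inverse x) ([:1, - t, 1:] * p) = (x + inverse x - t) * divdiff x (inverse x) (pCons 0 p)"
  using assms by (simp only: divdiff_mult) (simp add: field_simps)

section \<open>Sums of two values\<close>

definition symmetrized :: "'a::comm_ring_1 \<Rightarrow> 'a \<Rightarrow> 'a poly \<Rightarrow> 'a" where
  "symmetrized x y p = poly p x + poly p y"

lemma poly_functional_symmetrized: "poly_functional (symmetrized x y)"
  by (simp add: poly_functional_def symmetrized_def algebra_simps)

lemma symmetrized_quadratic:
  fixes x :: "'a::field"
  assumes "x \<noteq> 0"
  shows "symmetrized x (inverse x) ([:1, - t, 1:] * p) =
    (x + inverse x - t) * symmetrized x (inverse x) (pCons 0 p)"
  using assms by (simp add: symmetrized_def field_simps)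

lemma poly_functional_poly: "poly_functional (\<lambda>p. poly p x)"
  by (simp add: poly_functional_def)

subsection \<open>Weighted tableau sums\<close>

lemma bounded_partition_pred:
  assumes "bounded_partition (Suc n) mu" "mu (Suc n) = 0"
  shows "bounded_partition n mu"
proof -
  have "mu i = 0" if "i > n" for i
    using assms that by (cases "i = Suc n") (auto simp: bounded_partition_def)
  then show ?thesis using assms(1) by (simp add: bounded_partition_def)
qed

lemma tableaux_empty_diagram:
  assumes "diagram lam = {}"
  shows "tableaux A V R lam = {\<lambda>_. undefined}"
  using assms by (auto simp: tableaux_def rows_weak_def cols_weak_def cols_distinct_def)

lemma diagram_bounded_0: "bounded_partition 0 lam \<Longrightarrow> diagram lam = {}"
  by (subst diagram_eq) (auto simp: bounded_partition_def)

lemma tableaux_empty: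
  assumes "(i, j) \<in> diagram lam" "\<And>e. e \<in> A \<Longrightarrow> \<not> R i e"
  shows "tableaux A V R lam = {}"
  using assms by (force simp: tableaux_def)

lemma sum_tableaux_insert_weighted:
  fixes w :: "nat \<Rightarrow> nat \<Rightarrow> 'e::linorder \<Rightarrow> 'b::comm_ring_1"
  assumes lam: "bounded_partition n lam" and top: "\<And>e. e \<in> A \<Longrightarrow> e < m"
    and R: "\<And>i. i \<in> {1..n} \<Longrightarrow> R i m" and A: "finite A"
  shows "(\<Sum>T\<in>tableaux (insert m A) V R lam. \<Prod>(i, j)\<in>diagram lam. w i j (T (i, j))) =
    (\<Sum>nu\<in>(if m \<in> V then vstrips n lam else hstrips lam).
       (\<Prod>i = 1..n. \<Prod>j = Suc (nu i)..lam i. w i j m) *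
       (\<Sum>T\<in>tableaux A V R nu. \<Prod>(i, j)\<in>diagram nu. w i j (T (i, j))))"
proof -
  have eq: "(\<Prod>(i, j)\<in>diagram lam. w i j (fill lam nu m T (i, j))) =
      (\<Prod>i = 1..n. \<Prod>j = Suc (nu i)..lam i. w i j m) * (\<Prod>(i, j)\<in>diagram nu. w i j (T (i, j)))"
    if nu: "nu \<in> (if m \<in> V then vstrips n lam else hstrips lam)" for nu T
    using nu hstrips_bounded_partition[OF lam, of nu]
    by (intro prod_diagram_fill[OF lam]) (auto simp: vstrips_def hstrips_def split: if_splits)
  show ?thesis
    unfolding sum_distrib_left
    by (subst sum_tableaux_insert[where n = n and lam = lam and m = m and A = A and R = R, OF lam top R A])
      (assumption+, intro sum.cong refl eq)
qed

text \<open>The parameter index grows by one from box to box in a row, so a row of a strip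
  contributes a product over consecutive indices, offset by \<open>k\<close>.\<close>

lemma prod_row_cells:
  fixes a :: "int \<Rightarrow> 'a::comm_ring_1"
  assumes "\<And>j. c j = int j + int k" "u' = Suc u + k" "v' = v + k"
  shows "(\<Prod>j = Suc u..v. y + a (c j)) = (\<Prod>s = u'..v'. y + a (int s))"
  by (simp only: assms prod.shift_bounds_cl_nat_ivl of_nat_add)

section \<open>Vandermonde products\<close>

definition vandermonde :: "(nat \<Rightarrow> 'a::comm_ring_1) \<Rightarrow> nat \<Rightarrow> 'a" where
  "vandermonde t n = (\<Prod>k = 1..n. \<Prod>i = 1..<k. t i - t k)"

lemma vandermonde_0 [simp]: "vandermonde t 0 = 1"
  by (simp add: vandermonde_def)

lemma vandermonde_Suc: "vandermonde t (Suc n) = vandermonde t n * (\<Prod>i = 1..n. t i - t (Suc n))"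
  by (simp add: vandermonde_def atLeastLessThanSuc_atLeastAtMost)

lemma vandermonde_nonzero:
  fixes t :: "nat \<Rightarrow> 'a::idom"
  assumes "inj_on t {1..n}"
  shows "vandermonde t n \<noteq> 0"
proof -
  have "t i \<noteq> t k" if "k \<in> {1..n}" "i \<in> {1..<k}" for i k
    using that inj_onD[OF assms, of i k] by auto
  then show ?thesis by (simp add: vandermonde_def)
qed

subsection \<open>The general linear case\<close>

lemma gl_det_eq_tableau_sum:
  fixes x :: "nat \<Rightarrow> 'a::field_char_0"
  assumes "bounded_partition n lam"
  shows "det1 n (\<lambda>i j. fact_pow (x i) a (lam j + n - j)) =
    vandermonde x n * (\<Sum>T\<in>tableaux {1..n} {} (\<le>) lam. \<Prod>(i, j)\<in>diagram lam. gl_wgt x a i j (T (i, j)))"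
  using assms
proof (induction n arbitrary: lam)
  case 0
  then show ?case by (simp add: diagram_bounded_0 tableaux_empty_diagram)
next
  case (Suc n)
  define y where "y = x (Suc n)"
  define w where "w k l = (\<Prod>s = k + 2..l. y + a (int s))" for k l :: nat
  let ?S = "\<lambda>n lam. \<Sum>T\<in>tableaux {1..n} {} (\<le>) lam. \<Prod>(i, j)\<in>diagram lam. gl_wgt x a i j (T (i, j))"
  have "det1 (Suc n) (\<lambda>i j. fact_pow (x i) a (lam j + Suc n - j)) =
    fact_pow (x (Suc n)) a (lam (Suc n)) * (\<Prod>i = 1..n. x i - y) *
    (\<Sum>mu | mu \<in> hstrips lam \<and> mu (Suc n) = 0. (\<Prod>j = 1..n. w (mu j + n - j) (lam j + Suc n - j)) *
       det1 n (\<lambda>i j. fact_pow (x i) a (mu j + n - j)))"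
  proof (rule det1_hstrip_smaller[OF Suc.prems])
    fix l l' :: nat assume "l' < l"
    then have "fact_pow (x i) a l - (\<Prod>s = Suc l'..l. y + a (int s)) * fact_pow (x i) a l' =
        (x i - y) * (\<Sum>k = l'..<l. w k l * fact_pow (x i) a k)" for i
      using functional_newton[OF poly_functional_poly[of "x i"], of l' l 1 a y]
      by (simp add: poly_fact_poly w_def sum_distrib_left algebra_simps)
    then show "\<exists>c. \<forall>i\<in>{1..Suc n}. fact_pow (x i) a l - c * fact_pow (x i) a l' =
        (x i - y) * (\<Sum>k = l'..<l. w k l * fact_pow (x i) a k)" by blast
  qed (simp add: y_def)
  also have "\<dots> = vandermonde x (Suc n) *
    (\<Sum>mu | mu \<in> hstrips lam \<and> mu (Suc n) = 0. fact_pow y a (lam (Suc n)) *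
       (\<Prod>j = 1..n. w (mu j + n - j) (lam j + Suc n - j)) * ?S n mu)"
  proof -
    have "det1 n (\<lambda>i j. fact_pow (x i) a (mu j + n - j)) = vandermonde x n * ?S n mu"
      if "mu \<in> hstrips lam" "mu (Suc n) = 0" for mu
    proof (rule Suc.IH)
      show "bounded_partition n mu"
        using hstrips_bounded_partition[OF Suc.prems that(1)] that(2) by (rule bounded_partition_pred)
    qed
    then show ?thesis
      by (simp add: vandermonde_Suc sum_distrib_left y_def mult_ac)
  qed
  also have "(\<Sum>mu | mu \<in> hstrips lam \<and> mu (Suc n) = 0. fact_pow y a (lam (Suc n)) *
       (\<Prod>j = 1..n. w (mu j + n - j) (lam j + Suc n - j)) * ?S n mu) =
     (\<Sum>mu\<in>hstrips lam. (\<Prod>i = 1..Suc n. \<Prod>j = Suc (mu i)..lam i. gl_wgt x a i j (Suc n)) * ?S n mu)"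
  proof (rule sum.mono_neutral_cong_left)
    \<comment> \<open>No letter up to \<open>n\<close> may stand in row \<open>n + 1\<close>, so the
      additional shapes carry no tableaux.\<close>
    show "\<forall>mu\<in>hstrips lam - {mu \<in> hstrips lam. mu (Suc n) = 0}.
       (\<Prod>i = 1..Suc n. \<Prod>j = Suc (mu i)..lam i. gl_wgt x a i j (Suc n)) * ?S n mu = 0"
    proof
      fix mu assume mu: "mu \<in> hstrips lam - {mu \<in> hstrips lam. mu (Suc n) = 0}"
      then have "(Suc n, 1) \<in> diagram mu"
        by (subst diagram_eq[OF hstrips_bounded_partition[OF Suc.prems]]) auto
      then have "tableaux {1..n} {} (\<le>) mu = {}"
        by (rule tableaux_empty) simp
      then show "(\<Prod>i = 1..Suc n. \<Prod>j = Suc (mu i)..lam i. gl_wgt x a i j (Suc n)) * ?S n mu = 0"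
        by simp
    qed
  next
    fix mu assume mu: "mu \<in> {mu \<in> hstrips lam. mu (Suc n) = 0}"
    \<comment> \<open>With \<open>k = mu i + n - i\<close>, the box in column
      \<open>mu i + 1\<close> has parameter index \<open>n + 1 + (mu i + 1) - i = k + 2\<close>, the
      lower limit in \<open>w\<close>.\<close>
    have "(\<Prod>j = Suc (mu i)..lam i. gl_wgt x a i j (Suc n)) = w (mu i + n - i) (lam i + Suc n - i)"
      if "i \<in> {1..n}" for i
      unfolding w_def gl_wgt_def y_def using that by (intro prod_row_cells[where k = "Suc n - i"]) auto
    moreover have "(\<Prod>j = Suc (mu (Suc n))..lam (Suc n). gl_wgt x a (Suc n) j (Suc n)) = fact_pow y a (lam (Suc n))"
      using mu by (simp add: gl_wgt_def fact_pow_def y_def)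
    ultimately show "fact_pow y a (lam (Suc n)) * (\<Prod>j = 1..n. w (mu j + n - j) (lam j + Suc n - j)) * ?S n mu =
       (\<Prod>i = 1..Suc n. \<Prod>j = Suc (mu i)..lam i. gl_wgt x a i j (Suc n)) * ?S n mu"
      by (simp add: mult.commute)
  qed (use finite_hstrips[OF Suc.prems] in auto)
  also have "\<dots> = ?S (Suc n) lam"
  proof -
    have "{1..Suc n} = insert (Suc n) {1..n}" by auto
    then show ?thesis
      by (simp only: sum_tableaux_insert_weighted[OF Suc.prems, of "{1..n}" "Suc n"])
        (subst sum_tableaux_insert_weighted[OF Suc.prems], auto)
  qed
  finally show ?case .
qed

subsection \<open>The symplectic and odd orthogonal cases\<close>

fun row_ok :: "nat \<Rightarrow> entry \<Rightarrow> bool" where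
  "row_ok i (Plain k) \<longleftrightarrow> i \<le> k"
| "row_ok i (Barred k) \<longleftrightarrow> i \<le> k"
| "row_ok i Zero \<longleftrightarrow> True"

lemma barred_alphabet_Suc:
  "barred_alphabet (Suc n) = insert (Barred (Suc n)) (insert (Plain (Suc n)) (barred_alphabet n))"
proof -
  have "{1..Suc n} = insert (Suc n) {1..n}" by auto
  then show ?thesis by (simp add: barred_alphabet_def insert_commute)
qed

lemma finite_barred_alphabet: "finite (barred_alphabet n)"
  by (simp add: barred_alphabet_def)

lemma barred_alphabet_0 [simp]: "barred_alphabet 0 = {}"
  by (simp add: barred_alphabet_def)

lemma less_Plain_Suc: "e \<in> barred_alphabet n \<Longrightarrow> e < Plain (Suc n)"
  by (auto simp: barred_alphabet_def less_entry_def)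

lemma less_Barred_Suc: "e \<in> insert (Plain (Suc n)) (barred_alphabet n) \<Longrightarrow> e < Barred (Suc n)"
  by (auto simp: barred_alphabet_def less_entry_def)

lemma less_Zero: "e \<in> barred_alphabet n \<Longrightarrow> e < Zero"
  by (auto simp: barred_alphabet_def less_entry_def)

lemma tableaux_barred_alphabet_empty:
  assumes "bounded_partition (Suc n) mu" "mu (Suc n) \<noteq> 0"
  shows "tableaux (barred_alphabet n) V row_ok mu = {}"
proof (rule tableaux_empty)
  show "(Suc n, 1) \<in> diagram mu"
    using assms by (subst diagram_eq) auto
qed (auto simp: barred_alphabet_def)

lemma sum_tableaux_Plain:
  fixes w :: "nat \<Rightarrow> nat \<Rightarrow> entry \<Rightarrow> 'b::comm_ring_1"
  assumes nu: "bounded_partition (Suc n) nu" and V: "V \<subseteq> {Zero}"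
  shows "(\<Sum>T\<in>tableaux (insert (Plain (Suc n)) (barred_alphabet n)) V row_ok nu. \<Prod>(i, j)\<in>diagram nu. w i j (T (i, j))) =
    (\<Sum>mu | mu \<in> hstrips nu \<and> mu (Suc n) = 0. (\<Prod>i = 1..Suc n. \<Prod>j = Suc (mu i)..nu i. w i j (Plain (Suc n))) *
       (\<Sum>T\<in>tableaux (barred_alphabet n) V row_ok mu. \<Prod>(i, j)\<in>diagram mu. w i j (T (i, j))))"
proof -
  have "Plain (Suc n) \<notin> V" using V by auto
  then have "(\<Sum>T\<in>tableaux (insert (Plain (Suc n)) (barred_alphabet n)) V row_ok nu. \<Prod>(i, j)\<in>diagram nu. w i j (T (i, j))) =
    (\<Sum>mu\<in>hstrips nu. (\<Prod>i = 1..Suc n. \<Prod>j = Suc (mu i)..nu i. w i j (Plain (Suc n))) *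
       (\<Sum>T\<in>tableaux (barred_alphabet n) V row_ok mu. \<Prod>(i, j)\<in>diagram mu. w i j (T (i, j))))"
    using less_Plain_Suc finite_barred_alphabet
    by (subst sum_tableaux_insert_weighted[OF nu]) auto
  also have "\<dots> = (\<Sum>mu | mu \<in> hstrips nu \<and> mu (Suc n) = 0. (\<Prod>i = 1..Suc n. \<Prod>j = Suc (mu i)..nu i. w i j (Plain (Suc n))) *
       (\<Sum>T\<in>tableaux (barred_alphabet n) V row_ok mu. \<Prod>(i, j)\<in>diagram mu. w i j (T (i, j))))"
    using tableaux_barred_alphabet_empty[OF hstrips_bounded_partition[OF nu]] finite_hstrips[OF nu]
    by (intro sum.mono_neutral_right) auto
  finally show ?thesis .
qed

lemma sum_tableaux_Barred:
  fixes w :: "nat \<Rightarrow> nat \<Rightarrow> entry \<Rightarrow> 'b::comm_ring_1"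
  assumes lam: "bounded_partition (Suc n) lam" and V: "V \<subseteq> {Zero}"
  shows "(\<Sum>T\<in>tableaux (barred_alphabet (Suc n)) V row_ok lam. \<Prod>(i, j)\<in>diagram lam. w i j (T (i, j))) =
    (\<Sum>nu\<in>hstrips lam. (\<Prod>i = 1..Suc n. \<Prod>j = Suc (nu i)..lam i. w i j (Barred (Suc n))) *
       (\<Sum>T\<in>tableaux (insert (Plain (Suc n)) (barred_alphabet n)) V row_ok nu. \<Prod>(i, j)\<in>diagram nu. w i j (T (i, j))))"
proof -
  have "Barred (Suc n) \<notin> V" using V by auto
  then show ?thesis
    unfolding barred_alphabet_Suc using less_Barred_Suc finite_barred_alphabet
    by (subst sum_tableaux_insert_weighted[OF lam]) auto
qed

text \<open>Lowering \<open>n\<close> by one raises every parameter index by one. The compensating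
  shift of \<open>b\<close> is the one produced by multiplication with \<open>z\<close>.\<close>

lemma oo_wgt_shift:
  assumes "e \<in> barred_alphabet n"
  shows "oo_wgt (Suc n) x b i j e = oo_wgt n x (\<lambda>m. b (m - 1)) i j e"
  using assms by (auto simp: barred_alphabet_def algebra_simps)

lemma tableaux_cell: "T \<in> tableaux A V R lam \<Longrightarrow> c \<in> diagram lam \<Longrightarrow> T c \<in> A"
  by (auto simp: tableaux_def)

lemma divdiff_det_eq_tableau_sum:
  fixes x :: "nat \<Rightarrow> 'a::field_char_0"
  assumes "bounded_partition n lam" "V \<subseteq> {Zero}" "\<And>m. m \<le> 0 \<Longrightarrow> b m = 0" "\<And>i. i \<in> {1..n} \<Longrightarrow> x i \<noteq> 0"
  shows "det1 n (\<lambda>i j. divdiff (x i) (inverse (x i)) (fact_poly b (Suc (lam j + n - j)))) =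
    vandermonde (\<lambda>i. x i + inverse (x i)) n *
    (\<Sum>T\<in>tableaux (barred_alphabet n) V row_ok lam. \<Prod>(i, j)\<in>diagram lam. oo_wgt n x b i j (T (i, j)))"
  using assms
proof (induction n arbitrary: lam b)
  case 0
  then show ?case by (simp add: diagram_bounded_0 tableaux_empty_diagram)
next
  case (Suc n)
  define N where "N = Suc n"
  define y where "y = x N"
  define t where "t i = x i + inverse (x i)" for i
  define b' where "b' = (\<lambda>m. b (m - 1))"
  define D where "D i = divdiff (x i) (inverse (x i))" for i
  define w where "w k l = (\<Prod>s = k + 2..l. y + b (int s))" for k l :: nat
  define w' where "w' k l = (\<Prod>s = k + 2..Suc l. inverse y + b (int s))" for k l :: nat
  have lam: "bounded_partition N lam" using Suc.prems(1) by (simp add: N_def)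
  have x0: "x i \<noteq> 0" if "i \<in> {1..N}" for i using Suc.prems(4) that by (simp add: N_def)
  then have y0: "y \<noteq> 0" by (simp add: y_def N_def)
  have D: "poly_functional (D i)" for i by (simp add: D_def poly_functional_divdiff)
  have shift: "pCons 0 (fact_poly b k) = fact_poly b' (Suc k)" for k
    by (rule pCons_fact_poly) (use Suc.prems(3) in \<open>auto simp: b'_def\<close>)
  \<comment> \<open>The linear factors of both interpolations become a row factor that vanishes in
    row \<open>N\<close>, and a shift of the parameters.\<close>
  have quad: "D i ([:- inverse y, 1:] * [:- y, 1:] * fact_poly b k) = (t i - t N) * D i (fact_poly b' (Suc k))"
    if "i \<in> {1..N}" for i k
    unfolding quadratic_factor[OF y0] D_def divdiff_quadratic[OF x0[OF that]] shift
    by (simp add: t_def y_def)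
  let ?S = "\<lambda>n b A lam. \<Sum>T\<in>tableaux A V row_ok lam. \<Prod>(i, j)\<in>diagram lam. oo_wgt n x b i j (T (i, j))"
  have inner: "det1 N (\<lambda>i j. D i ([:- inverse y, 1:] * fact_poly b (nu j + N - j))) =
      vandermonde t N * ?S N b (insert (Plain N) (barred_alphabet n)) nu"
    if nu: "nu \<in> hstrips lam" for nu
  proof -
    have nub: "bounded_partition (Suc n) nu"
      using hstrips_bounded_partition[OF lam nu] by (simp add: N_def)
    have "det1 N (\<lambda>i j. D i ([:- inverse y, 1:] * fact_poly b (nu j + N - j))) =
      D N ([:- inverse y, 1:] * fact_poly b (nu N)) * (\<Prod>i = 1..n. t i - t N) *
      (\<Sum>mu | mu \<in> hstrips nu \<and> mu N = 0. (\<Prod>j = 1..n. w (mu j + n - j) (nu j + N - j)) *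
         det1 n (\<lambda>i j. D i (fact_poly b' (Suc (mu j + n - j)))))"
      unfolding N_def
    proof (rule det1_hstrip_smaller[OF nub])
      fix l l' :: nat assume l: "l' < l"
      have "D i ([:- inverse y, 1:] * fact_poly b l) - (\<Prod>s = Suc l'..l. y + b (int s)) * D i ([:- inverse y, 1:] * fact_poly b l') =
          (t i - t N) * (\<Sum>k = l'..<l. w k l * D i (fact_poly b' (Suc k)))" if "i \<in> {1..N}" for i
        unfolding functional_newton[OF D less_imp_le[OF l]] quad[OF that] sum_distrib_left w_def
        by (simp only: mult.left_commute)
      then show "\<exists>c. \<forall>i\<in>{1..Suc n}. D i ([:- inverse y, 1:] * fact_poly b l) - c * D i ([:- inverse y, 1:] * fact_poly b l') =
          (t i - t (Suc n)) * (\<Sum>k = l'..<l. w k l * D i (fact_poly b' (Suc k)))"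
        unfolding N_def by blast
    qed simp
    \<comment> \<open>In row \<open>N\<close> the two nodes are \<open>y\<close> and
      \<open>1/y\<close>. The factor \<open>z - 1/y\<close> has divided difference 1 and vanishes at
      \<open>1/y\<close>, so the product rule leaves the value at \<open>y\<close>.\<close>
    also have "D N ([:- inverse y, 1:] * fact_poly b (nu N)) = fact_pow y b (nu N)"
      unfolding D_def by (simp only: divdiff_mult) (simp add: poly_fact_poly y_def)
    also have "(\<Sum>mu | mu \<in> hstrips nu \<and> mu N = 0. (\<Prod>j = 1..n. w (mu j + n - j) (nu j + N - j)) *
         det1 n (\<lambda>i j. D i (fact_poly b' (Suc (mu j + n - j))))) =
      vandermonde t n * (\<Sum>mu | mu \<in> hstrips nu \<and> mu N = 0. (\<Prod>j = 1..n. w (mu j + n - j) (nu j + N - j)) *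
         ?S N b (barred_alphabet n) mu)"
    proof -
      have "det1 n (\<lambda>i j. D i (fact_poly b' (Suc (mu j + n - j)))) = vandermonde t n * ?S N b (barred_alphabet n) mu"
        if "mu \<in> hstrips nu" "mu N = 0" for mu
      proof -
        have "bounded_partition n mu"
          using hstrips_bounded_partition[OF nub that(1)] that(2) unfolding N_def by (rule bounded_partition_pred)
        then have "det1 n (\<lambda>i j. D i (fact_poly b' (Suc (mu j + n - j)))) = vandermonde t n * ?S n b' (barred_alphabet n) mu"
          unfolding D_def t_def
          by (rule Suc.IH) (use Suc.prems in \<open>auto simp: b'_def\<close>)
        also have "?S n b' (barred_alphabet n) mu = ?S N b (barred_alphabet n) mu"
          unfolding N_def b'_def
          by (intro sum.cong prod.cong) (auto simp: oo_wgt_shift dest: tableaux_cell)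
        finally show ?thesis .
      qed
      then show ?thesis by (simp add: sum_distrib_left mult.left_commute)
    qed
    also have "fact_pow y b (nu N) * (\<Prod>i = 1..n. t i - t N) * (vandermonde t n *
        (\<Sum>mu | mu \<in> hstrips nu \<and> mu N = 0. (\<Prod>j = 1..n. w (mu j + n - j) (nu j + N - j)) *
         ?S N b (barred_alphabet n) mu)) = vandermonde t N *
        (\<Sum>mu | mu \<in> hstrips nu \<and> mu N = 0. (\<Prod>j = 1..n. w (mu j + n - j) (nu j + N - j)) * fact_pow y b (nu N) *
         ?S N b (barred_alphabet n) mu)"
      by (simp add: vandermonde_Suc N_def sum_distrib_left mult_ac)
    also have "(\<Sum>mu | mu \<in> hstrips nu \<and> mu N = 0. (\<Prod>j = 1..n. w (mu j + n - j) (nu j + N - j)) * fact_pow y b (nu N) *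
         ?S N b (barred_alphabet n) mu) =
       (\<Sum>mu | mu \<in> hstrips nu \<and> mu N = 0. (\<Prod>i = 1..N. \<Prod>j = Suc (mu i)..nu i. oo_wgt N x b i j (Plain N)) *
         ?S N b (barred_alphabet n) mu)"
    proof (intro sum.cong refl arg_cong2[of _ _ _ _ "(*)"])
      fix mu assume mu: "mu \<in> {mu \<in> hstrips nu. mu N = 0}"
      have "(\<Prod>j = Suc (mu i)..nu i. oo_wgt N x b i j (Plain N)) = w (mu i + n - i) (nu i + N - i)"
        if "i \<in> {1..n}" for i
        unfolding w_def oo_wgt.simps y_def using that by (intro prod_row_cells[where k = "N - i"]) (auto simp: N_def)
      moreover have "(\<Prod>j = Suc (mu N)..nu N. oo_wgt N x b N j (Plain N)) = fact_pow y b (nu N)"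
        using mu by (simp add: fact_pow_def y_def)
      ultimately show "(\<Prod>j = 1..n. w (mu j + n - j) (nu j + N - j)) * fact_pow y b (nu N) =
          (\<Prod>i = 1..N. \<Prod>j = Suc (mu i)..nu i. oo_wgt N x b i j (Plain N))"
        by (simp add: N_def)
    qed
    also have "\<dots> = ?S N b (insert (Plain N) (barred_alphabet n)) nu"
      unfolding N_def by (rule sum_tableaux_Plain[OF nub Suc.prems(2), symmetric])
    finally show ?thesis .
  qed
  have "det1 N (\<lambda>i j. D i (fact_poly b (Suc (lam j + N - j)))) =
    (\<Sum>nu\<in>hstrips lam. (\<Prod>j = 1..N. w' (nu j + N - j) (lam j + N - j)) *
      det1 N (\<lambda>i j. D i ([:- inverse y, 1:] * fact_poly b (nu j + N - j))))"
  \<comment> \<open>The columns have degree \<open>Suc l\<close>, so interpolation runs from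
    \<open>Suc l'\<close> to \<open>Suc l\<close> and yields the range \<open>Suc l'..l\<close>
    required when the size stays the same.\<close>
  proof (rule det1_hstrip_same[OF lam])
    fix l l' :: nat assume "l' < l"
    then have l: "Suc l' \<le> Suc l" by simp
    have "D i (fact_poly b (Suc l)) - (\<Prod>s = Suc (Suc l')..Suc l. inverse y + b (int s)) * D i (fact_poly b (Suc l')) =
        (\<Sum>k = Suc l'..l. w' k l * D i ([:- inverse y, 1:] * fact_poly b k))" for i
      using functional_newton[OF D l, of i 1 b "inverse y"]
      by (simp only: w'_def mult_1_left atLeastLessThanSuc_atLeastAtMost)
    then show "\<exists>c. \<forall>i\<in>{1..N}. D i (fact_poly b (Suc l)) - c * D i (fact_poly b (Suc l')) =
        (\<Sum>k = Suc l'..l. w' k l * D i ([:- inverse y, 1:] * fact_poly b k))" by blast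
  next
    fix i
    \<comment> \<open>The divided difference of 1 is zero, so the last column expands without
      remainder.\<close>
    show "D i (fact_poly b (Suc (lam N))) = (\<Sum>k = 0..lam N. w' k (lam N) * D i ([:- inverse y, 1:] * fact_poly b k))"
      unfolding functional_newton_0[OF D, of i b "Suc (lam N)" "inverse y"] w'_def atLeastLessThanSuc_atLeastAtMost
      by (simp add: D_def)
  qed
  also have "\<dots> = vandermonde t N * (\<Sum>nu\<in>hstrips lam. (\<Prod>i = 1..N. \<Prod>j = Suc (nu i)..lam i. oo_wgt N x b i j (Barred N)) *
      ?S N b (insert (Plain N) (barred_alphabet n)) nu)"
  proof -
    have "(\<Prod>j = Suc (nu i)..lam i. oo_wgt N x b i j (Barred N)) = w' (nu i + N - i) (lam i + N - i)"
      if "i \<in> {1..N}" for i nu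
      unfolding w'_def oo_wgt.simps y_def using that by (intro prod_row_cells[where k = "Suc N - i"]) auto
    then have row: "(\<Prod>i = 1..N. \<Prod>j = Suc (nu i)..lam i. oo_wgt N x b i j (Barred N)) =
        (\<Prod>j = 1..N. w' (nu j + N - j) (lam j + N - j))" for nu
      by (intro prod.cong refl)
    show ?thesis
      by (subst sum_distrib_left, intro sum.cong refl) (simp only: inner row mult.left_commute)
  qed
  also have "(\<Sum>nu\<in>hstrips lam. (\<Prod>i = 1..N. \<Prod>j = Suc (nu i)..lam i. oo_wgt N x b i j (Barred N)) *
      ?S N b (insert (Plain N) (barred_alphabet n)) nu) = ?S N b (barred_alphabet N) lam"
    unfolding N_def by (rule sum_tableaux_Barred[OF Suc.prems(1,2), symmetric])
  finally show ?case by (simp add: N_def D_def t_def)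
qed

text \<open>Collects the square roots of a row in one factor \<open>s - 1/s\<close>. It follows from
  the product rule and \<open>(s - 1/s) (1 + 1/x) = (x - 1/x) / s\<close>, valid for
  \<open>s^2 = x\<close>.\<close>

lemma divdiff_half_power:
  fixes s :: "'a::field"
  assumes "s \<noteq> 0" "s\<^sup>2 = x"
  shows "s * poly p x - inverse s * poly p (inverse x) = (s - inverse s) * divdiff x (inverse x) ([:1, 1:] * p)"
proof -
  let ?d = "divdiff x (inverse x) p"
  have "(s - inverse s) * divdiff x (inverse x) ([:1, 1:] * p) =
      (s - inverse s) * (poly p x + (1 + inverse x) * ?d)"
    by (simp only: divdiff_mult) simp
  also have "(s - inverse s) * (1 + inverse x) = inverse s * (x - inverse x)"
    using assms by (auto simp: field_simps power2_eq_square)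
  then have "(s - inverse s) * (poly p x + (1 + inverse x) * ?d) =
      (s - inverse s) * poly p x + inverse s * ((x - inverse x) * ?d)"
    by (simp add: distrib_left flip: mult.assoc)
  also have "\<dots> = s * poly p x - inverse s * poly p (inverse x)"
    unfolding divdiff_mult_diff by (simp add: algebra_simps)
  finally show ?thesis ..
qed

lemma one_plus_X_fact_poly:
  "[:1, 1:] * fact_poly a l = fact_poly a (Suc l) + smult (1 - a (int (Suc l))) (fact_poly a l)"
  by (simp add: fact_poly_Suc algebra_simps smult_diff_left)

text \<open>Expanding each column into its two summands, a choice of exponents that is not strictly
  decreasing produces two equal columns, and the exponent \<open>0\<close> produces a zero column.\<close>

lemma det1_vstrips:
  fixes \<phi> :: "nat \<Rightarrow> nat \<Rightarrow> 'a::idom"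
  assumes lam: "bounded_partition n lam" and n: "n \<ge> 1" and zero: "\<And>i. \<phi> 0 i = 0"
  shows "det1 n (\<lambda>i j. \<phi> (Suc (lam j + n - j)) i + c (Suc (lam j + n - j)) * \<phi> (lam j + n - j) i) =
    (\<Sum>nu\<in>vstrips n lam. (\<Prod>j = 1..n. if nu j = lam j then 1 else c (Suc (lam j + n - j))) *
       det1 n (\<lambda>i j. \<phi> (Suc (nu j + n - j)) i))"
proof -
  define l where "l j = lam j + n - j" for j
  define K where "K j = {l j, Suc (l j)}" for j
  define w where "w j k = (if k = Suc (l j) then 1 else c (Suc (l j)))" for j k
  define F where "F \<kappa> = (\<Prod>j = 1..n. w j (\<kappa> j)) * det1 n (\<lambda>i j. \<phi> (\<kappa> j) i)" for \<kappa>
  \<comment> \<open>The choices that survive: strictly decreasing exponents, the last of them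
    positive.\<close>
  define G where "G = {\<kappa> \<in> PiE {1..n} K. \<kappa> n \<ge> 1 \<and> (\<forall>j\<in>{1..<n}. \<kappa> (Suc j) < \<kappa> j)}"
  have l_Suc: "l (Suc j) < l j" if "j \<in> {1..<n}" for j
    using lam that by (auto simp: l_def bounded_partition_def intro!: add_le_less_mono)
  have "det1 n (\<lambda>i j. \<phi> (Suc (l j)) i + c (Suc (l j)) * \<phi> (l j) i) =
      det1 n (\<lambda>i j. \<Sum>k\<in>K j. w j k * \<phi> k i)"
    by (rule det1_cong) (simp add: K_def w_def)
  also have "\<dots> = (\<Sum>\<kappa>\<in>PiE {1..n} K. F \<kappa>)"
    unfolding F_def by (rule det1_multilinear) (simp add: K_def)
  also have "\<dots> = (\<Sum>\<kappa>\<in>G. F \<kappa>)"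
  proof (rule sum.mono_neutral_right)
    show "\<forall>\<kappa>\<in>PiE {1..n} K - G. F \<kappa> = 0"
    proof
      fix \<kappa> assume \<kappa>: "\<kappa> \<in> PiE {1..n} K - G"
      have in_K: "\<kappa> j \<in> K j" if "j \<in> {1..n}" for j
        using \<kappa> that by auto
      consider "\<kappa> n = 0" | j where "j \<in> {1..<n}" "\<kappa> j \<le> \<kappa> (Suc j)"
        using \<kappa> by (auto simp: G_def not_less)
      then have "det1 n (\<lambda>i j. \<phi> (\<kappa> j) i) = 0"
      proof cases
        case 1
        then show ?thesis using n zero by (intro det1_zero_column[of n]) auto
      next
        case (2 j)
        \<comment> \<open>Neighbouring ranges share at most one value, as \<open>\<kappa> (Suc j)
          \<le> Suc (l (Suc j)) \<le> l j \<le> \<kappa> j\<close>; a failure of strict decrease is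
          therefore an equality.\<close>
        then have "\<kappa> j = \<kappa> (Suc j)"
          using in_K[of j] in_K[of "Suc j"] l_Suc[of j] by (auto simp: K_def)
        then show ?thesis
          using 2 by (intro det1_identical_columns[of j _ "Suc j"]) auto
      qed
      then show "F \<kappa> = 0" by (simp add: F_def)
    qed
  qed (auto simp: G_def K_def intro!: finite_PiE)
  also have "\<dots> = (\<Sum>nu\<in>vstrips n lam. (\<Prod>j = 1..n. if nu j = lam j then 1 else c (Suc (l j))) *
       det1 n (\<lambda>i j. \<phi> (Suc (nu j + n - j)) i))"
  proof (rule sum.reindex_bij_witness[of _ "\<lambda>nu. restrict (\<lambda>j. Suc (nu j + n - j)) {1..n}"
        "\<lambda>\<kappa> j. if j \<in> {1..n} then \<kappa> j + j - Suc n else 0"])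
    fix \<kappa> assume \<kappa>: "\<kappa> \<in> G"
    \<comment> \<open>Strict decrease down to \<open>\<kappa> n \<ge> 1\<close> makes the natural
      subtraction \<open>\<kappa> j + j - Suc n\<close> exact.\<close>
    have ge: "Suc n \<le> \<kappa> j + j" if "j \<in> {1..n}" for j
    proof -
      have "j \<le> n" "1 \<le> j" using that by auto
      then show ?thesis
      proof (induction j rule: inc_induct)
        case base
        then show ?case using \<kappa> by (simp add: G_def)
      next
        case (step j)
        then have "Suc n \<le> \<kappa> (Suc j) + Suc j" by simp
        moreover have "\<kappa> (Suc j) < \<kappa> j" using \<kappa> step by (auto simp: G_def)
        ultimately show ?case by simp
      qed
    qed
    have idx: "Suc (\<kappa> j + j - Suc n + n - j) = \<kappa> j" if "j \<in> {1..n}" for j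
      using ge[OF that] that by auto
    have in_K: "\<kappa> j \<in> K j" if "j \<in> {1..n}" for j
      using \<kappa> that by (auto simp: G_def)
    let ?nu = "\<lambda>j. if j \<in> {1..n} then \<kappa> j + j - Suc n else 0"
    show "restrict (\<lambda>j. Suc (?nu j + n - j)) {1..n} = \<kappa>"
    proof
      fix j show "restrict (\<lambda>j. Suc (?nu j + n - j)) {1..n} j = \<kappa> j"
        using \<kappa> ge[of j] by (cases "j \<in> {1..n}") (auto simp: G_def PiE_iff extensional_def)
    qed
    have 0: "lam j = 0" if "j > n" for j using lam that by (simp add: bounded_partition_def)
    have "?nu j \<le> lam j \<and> lam j \<le> Suc (?nu j)" if "j \<ge> 1" for j
      using in_K[of j] ge[of j] 0[of j] that by (cases "j \<le> n") (auto simp: K_def l_def)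
    moreover have "?nu (Suc j) \<le> ?nu j" if "j \<ge> 1" for j
      using \<kappa> that by (force simp: G_def)
    ultimately show "?nu \<in> vstrips n lam"
      by (simp add: vstrips_def bounded_partition_def)
    have "(if ?nu j = lam j then 1 else c (Suc (l j))) = w j (\<kappa> j)" if "j \<in> {1..n}" for j
      using in_K[OF that] ge[OF that] that by (auto simp: w_def K_def l_def)
    then show "(\<Prod>j = 1..n. if ?nu j = lam j then 1 else c (Suc (l j))) *
       det1 n (\<lambda>i j. \<phi> (Suc (?nu j + n - j)) i) = F \<kappa>"
      unfolding F_def using idx by (intro arg_cong2[of _ _ _ _ "(*)"] prod.cong det1_cong arg_cong2[of _ _ _ _ \<phi>]) auto
  next
    fix nu assume nu: "nu \<in> vstrips n lam"
    then have nub: "bounded_partition n nu" and nu0: "nu 0 = 0"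
      and le: "\<And>i. i \<ge> 1 \<Longrightarrow> nu i \<le> lam i \<and> lam i \<le> Suc (nu i)"
      by (auto simp: vstrips_def)
    let ?\<kappa> = "restrict (\<lambda>j. Suc (nu j + n - j)) {1..n}"
    show "(\<lambda>j. if j \<in> {1..n} then ?\<kappa> j + j - Suc n else 0) = nu"
    proof
      fix j show "(if j \<in> {1..n} then ?\<kappa> j + j - Suc n else 0) = nu j"
        using nub nu0 by (cases "j = 0"; cases "j \<le> n") (auto simp: bounded_partition_def)
    qed
    have "?\<kappa> j \<in> K j" if "j \<in> {1..n}" for j
      using le[of j] that by (auto simp: K_def l_def)
    moreover have "?\<kappa> (Suc j) < ?\<kappa> j" if "j \<in> {1..<n}" for j
      using nub that by (auto simp: bounded_partition_def intro!: add_le_less_mono)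
    ultimately show "?\<kappa> \<in> G"
      using n by (auto simp: G_def PiE_iff)
  qed
  finally show ?thesis by (simp only: l_def)
qed

lemma prod_singleton_or_empty:
  assumes "u \<le> v" "v \<le> Suc u"
  shows "(\<Prod>j = Suc u..v. g j) = (if u = v then 1 else g v)"
proof (cases "u = v")
  case False
  then have "v = Suc u" using assms by simp
  then show ?thesis by simp
qed simp

lemma so_det_eq_tableau_sum:
  fixes x :: "nat \<Rightarrow> 'a::field_char_0"
  assumes lam: "bounded_partition n lam" and n: "n \<ge> 1" and a: "\<And>m. m \<le> 0 \<Longrightarrow> a m = 0"
    and x: "\<And>i. i \<in> {1..n} \<Longrightarrow> x i \<noteq> 0" and s: "\<And>i. i \<in> {1..n} \<Longrightarrow> (s i)\<^sup>2 = x i"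
  shows "det1 n (\<lambda>i j. s i * fact_pow (x i) a (lam j + n - j)
                  - inverse (s i) * fact_pow (inverse (x i)) a (lam j + n - j)) =
    (\<Prod>i = 1..n. s i - inverse (s i)) * vandermonde (\<lambda>i. x i + inverse (x i)) n *
    (\<Sum>T\<in>tableaux (insert Zero (barred_alphabet n)) {Zero} row_ok lam.
       \<Prod>(i, j)\<in>diagram lam. oo_wgt n x a i j (T (i, j)))"
proof -
  define D where "D i = divdiff (x i) (inverse (x i))" for i
  let ?V = "vandermonde (\<lambda>i. x i + inverse (x i)) n"
  let ?S = "\<lambda>nu. \<Sum>T\<in>tableaux (barred_alphabet n) {Zero} row_ok nu. \<Prod>(i, j)\<in>diagram nu. oo_wgt n x a i j (T (i, j))"
  have "s i * fact_pow (x i) a l - inverse (s i) * fact_pow (inverse (x i)) a l =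
     (s i - inverse (s i)) * (D i (fact_poly a (Suc l)) + (1 - a (int (Suc l))) * D i (fact_poly a l))"
    if "i \<in> {1..n}" for i l
  proof -
    have "s i \<noteq> 0" using s[OF that] x[OF that] by auto
    then show ?thesis
      using divdiff_half_power[OF \<open>s i \<noteq> 0\<close> s[OF that], of "fact_poly a l"]
      by (simp only: poly_fact_poly one_plus_X_fact_poly D_def divdiff_add divdiff_smult)
  qed
  then have "det1 n (\<lambda>i j. s i * fact_pow (x i) a (lam j + n - j)
                  - inverse (s i) * fact_pow (inverse (x i)) a (lam j + n - j)) =
     det1 n (\<lambda>i j. (s i - inverse (s i)) * (D i (fact_poly a (Suc (lam j + n - j))) +
        (1 - a (int (Suc (lam j + n - j)))) * D i (fact_poly a (lam j + n - j))))"
    by (intro det1_cong) auto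
  also have "\<dots> = (\<Prod>i = 1..n. s i - inverse (s i)) *
      (\<Sum>nu\<in>vstrips n lam. (\<Prod>j = 1..n. if nu j = lam j then 1 else 1 - a (int (Suc (lam j + n - j)))) *
         det1 n (\<lambda>i j. D i (fact_poly a (Suc (nu j + n - j)))))"
    unfolding det1_row_scale
    by (subst det1_vstrips[OF lam n, where \<phi> = "\<lambda>l i. D i (fact_poly a l)" and c = "\<lambda>m. 1 - a (int m)"])
      (simp_all add: D_def)
  also have "(\<Sum>nu\<in>vstrips n lam. (\<Prod>j = 1..n. if nu j = lam j then 1 else 1 - a (int (Suc (lam j + n - j)))) *
         det1 n (\<lambda>i j. D i (fact_poly a (Suc (nu j + n - j))))) =
     (\<Sum>nu\<in>vstrips n lam. ?V * ((\<Prod>i = 1..n. \<Prod>j = Suc (nu i)..lam i. oo_wgt n x a i j Zero) * ?S nu))"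
  proof (rule sum.cong[OF refl])
    fix nu assume nu: "nu \<in> vstrips n lam"
    then have nub: "bounded_partition n nu" by (simp add: vstrips_def)
    have "(\<Prod>j = Suc (nu i)..lam i. oo_wgt n x a i j Zero) =
        (if nu i = lam i then 1 else 1 - a (int (Suc (lam i + n - i))))" if "i \<in> {1..n}" for i
    proof -
      \<comment> \<open>A vertical strip adds at most one box to row \<open>i\<close>, in column
        \<open>lam i\<close>; its parameter index is the exponent of column \<open>i\<close> plus
        one.\<close>
      have "int n + 1 + int (lam i) - int i = int (Suc (lam i + n - i))" using that by auto
      then show ?thesis
        using nu that by (subst prod_singleton_or_empty) (auto simp: vstrips_def algebra_simps)
    qed
    moreover have "det1 n (\<lambda>i j. D i (fact_poly a (Suc (nu j + n - j)))) = ?V * ?S nu"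
      unfolding D_def using a x by (intro divdiff_det_eq_tableau_sum[OF nub]) auto
    ultimately show "(\<Prod>j = 1..n. if nu j = lam j then 1 else 1 - a (int (Suc (lam j + n - j)))) *
         det1 n (\<lambda>i j. D i (fact_poly a (Suc (nu j + n - j)))) =
       ?V * ((\<Prod>i = 1..n. \<Prod>j = Suc (nu i)..lam i. oo_wgt n x a i j Zero) * ?S nu)"
      by (simp only: mult.left_commute cong: prod.cong)
  qed
  also have "\<dots> = ?V * (\<Sum>T\<in>tableaux (insert Zero (barred_alphabet n)) {Zero} row_ok lam.
       \<Prod>(i, j)\<in>diagram lam. oo_wgt n x a i j (T (i, j)))"
    unfolding sum_distrib_left[symmetric] using less_Zero finite_barred_alphabet
    by (subst sum_tableaux_insert_weighted[OF lam]) auto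
  finally show ?thesis by (simp only: mult.assoc)
qed

text \<open>The matrix entry for \<open>p\<close> is \<open>x - 1/x\<close> times the divided
  difference of \<open>z p\<close>. The factor \<open>z\<close> is absorbed in the shifted
  parameters \<open>b\<close>, which turn \<open>oo_wgt\<close> into \<open>sp_wgt\<close>.\<close>

lemma sp_det_eq_tableau_sum:
  fixes x :: "nat \<Rightarrow> 'a::field_char_0"
  assumes lam: "bounded_partition n lam" and a: "\<And>m. m \<le> 0 \<Longrightarrow> a m = 0"
    and x: "\<And>i. i \<in> {1..n} \<Longrightarrow> x i \<noteq> 0"
  shows "det1 n (\<lambda>i j. x i * fact_pow (x i) a (lam j + n - j)
                  - inverse (x i) * fact_pow (inverse (x i)) a (lam j + n - j)) =
    (\<Prod>i = 1..n. x i - inverse (x i)) * vandermonde (\<lambda>i. x i + inverse (x i)) n *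
    (\<Sum>T\<in>tableaux (barred_alphabet n) {} row_ok lam.
       \<Prod>(i, j)\<in>diagram lam. sp_wgt n x a i j (T (i, j)))"
proof -
  define b where "b = (\<lambda>m. a (m - 1))"
  have shift: "pCons 0 (fact_poly a k) = fact_poly b (Suc k)" for k
    by (rule pCons_fact_poly) (use a in \<open>auto simp: b_def\<close>)
  have "x i * fact_pow (x i) a l - inverse (x i) * fact_pow (inverse (x i)) a l =
      (x i - inverse (x i)) * divdiff (x i) (inverse (x i)) (fact_poly b (Suc l))" for i l
    unfolding divdiff_mult_diff shift[symmetric] by (simp add: poly_fact_poly)
  then have "det1 n (\<lambda>i j. x i * fact_pow (x i) a (lam j + n - j)
                  - inverse (x i) * fact_pow (inverse (x i)) a (lam j + n - j)) =
    (\<Prod>i = 1..n. x i - inverse (x i)) *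
      det1 n (\<lambda>i j. divdiff (x i) (inverse (x i)) (fact_poly b (Suc (lam j + n - j))))"
    by (simp only: det1_row_scale)
  also have "det1 n (\<lambda>i j. divdiff (x i) (inverse (x i)) (fact_poly b (Suc (lam j + n - j)))) =
    vandermonde (\<lambda>i. x i + inverse (x i)) n *
    (\<Sum>T\<in>tableaux (barred_alphabet n) {} row_ok lam. \<Prod>(i, j)\<in>diagram lam. oo_wgt n x b i j (T (i, j)))"
    using a x by (intro divdiff_det_eq_tableau_sum[OF lam]) (auto simp: b_def)
  also have "(\<Sum>T\<in>tableaux (barred_alphabet n) {} row_ok lam. \<Prod>(i, j)\<in>diagram lam. oo_wgt n x b i j (T (i, j))) =
    (\<Sum>T\<in>tableaux (barred_alphabet n) {} row_ok lam. \<Prod>(i, j)\<in>diagram lam. sp_wgt n x a i j (T (i, j)))"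
  proof -
    have "oo_wgt n x b i j e = sp_wgt n x a i j e" if "e \<in> barred_alphabet n" for i j e
      using that by (auto simp: barred_alphabet_def b_def algebra_simps)
    then show ?thesis by (intro sum.cong prod.cong) (auto dest: tableaux_cell)
  qed
  finally show ?thesis by (simp only: mult.assoc)
qed

subsection \<open>The even orthogonal case\<close>

text \<open>The even orthogonal condition becomes a zero weight, so that sums run over
  \<open>tableaux\<close> and the branching rule applies.\<close>

definition eo_term ::
  "nat \<Rightarrow> (nat \<Rightarrow> 'a::field_char_0) \<Rightarrow> (int \<Rightarrow> 'a) \<Rightarrow> (nat \<Rightarrow> nat) \<Rightarrow> (nat \<times> nat \<Rightarrow> entry) \<Rightarrow> 'a" where
  "eo_term n x a lam T = (if even_orth_cond lam T
     then 2 ^ zeta n lam T * (\<Prod>(i, j)\<in>diagram lam. eo_wgt n x a i j (T (i, j))) else 0)"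

text \<open>The contribution of row \<open>n\<close> of length \<open>l\<close> whose first \<open>v\<close> entries are \<open>n\<close> and whose other
  entries are barred, when the entries of row \<open>n - 1\<close> smaller than \<open>n\<close> occupy \<open>m\<close> boxes.\<close>

definition eo_row_weight ::
  "nat \<Rightarrow> 'a::field_char_0 \<Rightarrow> (int \<Rightarrow> 'a) \<Rightarrow> nat \<Rightarrow> nat \<Rightarrow> nat \<Rightarrow> 'a" where
  "eo_row_weight n y a l m v =
     (if v = 0 \<or> v = l \<or> (1 < n \<and> m \<le> v) then
        (if 1 < n \<and> m = 0 \<and> v = 0 \<and> l \<noteq> 0 then 2 else 1) *
        ((\<Prod>s = Suc v..l. inverse y + a (int s)) * fact_pow y a v)
      else 0)"

text \<open>The corner entry left by the determinant recursion at exponent \<open>v\<close>: for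
  \<open>v > 0\<close> the sum of \<open>(z - 1/y) (z|a)^(v-1)\<close> over \<open>z = y\<close> and
  \<open>z = 1/y\<close>, for \<open>v = 0\<close> a normalizing constant.\<close>

definition eo_corner :: "'a::field_char_0 \<Rightarrow> (int \<Rightarrow> 'a) \<Rightarrow> nat \<Rightarrow> nat \<Rightarrow> 'a" where
  "eo_corner y a l v = (if v = 0 then (if l = 0 then 1 else 2) else (y - inverse y) * fact_pow y a (v - 1))"

lemma fact_pow_Suc: "fact_pow y a (Suc m) = fact_pow y a m * (y + a (int (Suc m)))"
  by (simp add: fact_pow_def)

text \<open>Let \<open>P v\<close> be \<open>(y|a)^v\<close> times the product of
  \<open>1/y + a_s\<close> over \<open>v < s \<le> l\<close>. As
  \<open>y - 1/y = (y + a_v) - (1/y + a_v)\<close>, the summand for \<open>v \<ge> 1\<close> is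
  \<open>P v - P (v - 1)\<close>, and the sum telescopes. The summand for \<open>v = 0\<close> is
  \<open>2 P 0\<close>, or \<open>P 0\<close> if \<open>l = 0\<close>.\<close>

lemma sum_eo_corner:
  assumes "M \<le> l"
  shows "(\<Sum>v = 0..M. (\<Prod>s = Suc v..l. inverse y + a (int s)) * eo_corner y a l v) =
    fact_pow y a M * (\<Prod>s = Suc M..l. inverse y + a (int s)) +
    (if l = 0 then 0 else fact_pow (inverse y) a l)"
  using assms
proof (induction M)
  case 0
  then show ?case by (simp add: eo_corner_def fact_pow_def)
next
  case (Suc M)
  have "(\<Prod>s = Suc M..l. inverse y + a (int s)) =
      (inverse y + a (int (Suc M))) * (\<Prod>s = Suc (Suc M)..l. inverse y + a (int s))"
    using Suc.prems by (simp add: prod.atLeast_Suc_atMost)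
  then show ?case
    using Suc by (simp add: eo_corner_def fact_pow_Suc algebra_simps)
qed

text \<open>\<open>M\<close> is the largest possible number of letters \<open>n\<close> in row
  \<open>n\<close>. In the range up to \<open>M\<close> only \<open>v = 0\<close> and
  \<open>v = M\<close> have a row weight that is not zero by definition, and they match the boundary
  terms of the telescoped sum. If \<open>M = 0 < l\<close> the two coincide, which the factor 2 from
  \<open>zeta\<close> accounts for.\<close>

lemma sum_eo_row_weight:
  assumes M: "M = (if n \<le> 1 then l else min l m)"
  shows "(\<Sum>v = 0..M. eo_row_weight n y a l m v) =
    (\<Sum>v = 0..M. (\<Prod>s = Suc v..l. inverse y + a (int s)) * eo_corner y a l v)"
proof (cases "M = 0")
  case True
  then show ?thesis
    using M by (auto simp: eo_row_weight_def eo_corner_def fact_pow_def min_def split: if_splits)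
next
  case False
  have "M \<le> l" using M by auto
  have "(\<Sum>v = 0..M. eo_row_weight n y a l m v) = (\<Sum>v\<in>{0, M}. eo_row_weight n y a l m v)"
    using False M by (intro sum.mono_neutral_right) (auto simp: eo_row_weight_def min_def split: if_splits)
  also have "\<dots> = fact_pow y a M * (\<Prod>s = Suc M..l. inverse y + a (int s)) + fact_pow (inverse y) a l"
    using False M by (auto simp: eo_row_weight_def fact_pow_def min_def split: if_splits)
  finally show ?thesis
    using False \<open>M \<le> l\<close> by (simp add: sum_eo_corner)
qed

text \<open>The value \<open>nu N\<close> is bounded only by \<open>lam N\<close> and, if there is a
  row \<open>n\<close> above, by \<open>mu n\<close>. It can thus be summed over an interval with
  all else fixed; the shapes with \<open>nu N = 0\<close> represent the rest.\<close>

lemma sum_hstrips_split_last: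
  fixes g :: "(nat \<Rightarrow> nat) \<Rightarrow> (nat \<Rightarrow> nat) \<Rightarrow> 'a::comm_ring_1"
  assumes lam: "bounded_partition N lam" and N: "N = Suc n"
    and g: "\<And>nu v mu. g (nu(N := v)) mu = g nu mu"
  shows "(\<Sum>nu\<in>hstrips lam. \<Sum>mu | mu \<in> hstrips nu \<and> mu N = 0. g nu mu * h (nu N) mu) =
    (\<Sum>nu | nu \<in> hstrips lam \<and> nu N = 0. \<Sum>mu | mu \<in> hstrips nu \<and> mu N = 0.
       g nu mu * (\<Sum>v = 0..(if N \<le> 1 then lam N else min (lam N) (mu n)). h v mu))"
proof -
  let ?M = "\<lambda>mu. if N \<le> 1 then lam N else min (lam N) (mu n)"
  let ?A = "Sigma (hstrips lam) (\<lambda>nu. {mu. mu \<in> hstrips nu \<and> mu N = 0})"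
  let ?B = "Sigma {nu. nu \<in> hstrips lam \<and> nu N = 0} (\<lambda>nu. Sigma {mu. mu \<in> hstrips nu \<and> mu N = 0} (\<lambda>mu. {0..?M mu}))"
  have fin: "finite {nu. nu \<in> hstrips lam \<and> nu N = 0}" "finite (hstrips lam)"
    using finite_hstrips[OF lam] by auto
  have fin': "finite {mu. mu \<in> hstrips nu \<and> mu N = 0}" if "nu \<in> hstrips lam" for nu
    using finite_hstrips[OF hstrips_bounded_partition[OF lam that]] by auto
  have lam_Suc: "lam (Suc N) = 0" using lam by (simp add: bounded_partition_def)
  have nu_hstrips: "nu(N := v) \<in> hstrips lam" if "nu \<in> hstrips lam" "v \<le> lam N" for nu v
    using that N lam_Suc by (auto simp: hstrips_def)
  \<comment> \<open>As \<open>mu N = 0\<close>, the only interlacing condition on the value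
    \<open>v\<close> in row \<open>N\<close> is the one with \<open>mu n\<close>, which is absent if
    \<open>n = 0\<close>.\<close>
  have mu_hstrips: "mu \<in> hstrips (nu(N := v)) \<longleftrightarrow> mu \<in> hstrips (nu(N := 0)) \<and> (n \<noteq> 0 \<longrightarrow> v \<le> mu n)"
    if "mu N = 0" for mu nu v
  proof -
    have "(\<forall>i\<ge>1. (nu(N := v)) (Suc i) \<le> mu i \<and> mu i \<le> (nu(N := v)) i) \<longleftrightarrow>
      (\<forall>i\<ge>1. (nu(N := 0)) (Suc i) \<le> mu i \<and> mu i \<le> (nu(N := 0)) i) \<and> (n \<noteq> 0 \<longrightarrow> v \<le> mu n)" (is "?L \<longleftrightarrow> ?R1 \<and> ?R2")
    proof (intro iffI conjI)
      assume L: ?L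
      show ?R1
      proof (intro allI impI)
        fix i :: nat assume "i \<ge> 1"
        then show "(nu(N := 0)) (Suc i) \<le> mu i \<and> mu i \<le> (nu(N := 0)) i"
          using spec[OF L, of i] that N by (cases "i = n"; cases "i = N") auto
      qed
      show ?R2 using spec[OF L, of n] N by auto
    next
      assume R: "?R1 \<and> ?R2"
      show ?L
      proof (intro allI impI)
        fix i :: nat assume "i \<ge> 1"
        then show "(nu(N := v)) (Suc i) \<le> mu i \<and> mu i \<le> (nu(N := v)) i"
          using spec[OF conjunct1[OF R], of i] conjunct2[OF R] that N by (cases "i = n"; cases "i = N") auto
      qed
    qed
    then show ?thesis by (simp add: hstrips_def)
  qed
  have "(\<Sum>nu | nu \<in> hstrips lam \<and> nu N = 0. \<Sum>mu | mu \<in> hstrips nu \<and> mu N = 0.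
       g nu mu * (\<Sum>v = 0..?M mu. h v mu)) = (\<Sum>(nu, mu, v)\<in>?B. g nu mu * h v mu)"
    using fin fin' by (subst sum.Sigma[symmetric]) (auto simp: sum.Sigma[symmetric] sum_distrib_left)
  also have "\<dots> = (\<Sum>(nu, mu)\<in>?A. g nu mu * h (nu N) mu)"
  proof (rule sum.reindex_bij_witness[of _ "\<lambda>(nu, mu). (nu(N := 0), mu, nu N)" "\<lambda>(nu, mu, v). (nu(N := v), mu)"])
    fix p assume p: "p \<in> ?B"
    then obtain nu mu v where [simp]: "p = (nu, mu, v)" and
      nu: "nu \<in> hstrips lam" "nu N = 0" and mu: "mu \<in> hstrips nu" "mu N = 0" and v: "v \<le> ?M mu"
      by auto
    have [simp]: "nu(N := 0) = nu" using nu by (simp add: fun_upd_idem)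
    show "(case case p of (nu, mu, v) \<Rightarrow> (nu(N := v), mu) of (nu, mu) \<Rightarrow> (nu(N := 0), mu, nu N)) = p"
      by simp
    have "mu \<in> hstrips (nu(N := v))"
      unfolding mu_hstrips[where mu = mu and nu = nu and v = v, OF mu(2)] \<open>nu(N := 0) = nu\<close>
      using mu(1) v N by (simp split: if_splits)
    then show "(case p of (nu, mu, v) \<Rightarrow> (nu(N := v), mu)) \<in> ?A"
      using nu_hstrips[OF nu(1), of v] v mu by (auto split: if_splits)
    show "(case case p of (nu, mu, v) \<Rightarrow> (nu(N := v), mu) of (nu, mu) \<Rightarrow> g nu mu * h (nu N) mu) =
       (case p of (nu, mu, v) \<Rightarrow> g nu mu * h v mu)"
      by (simp add: g)
  next
    fix p assume p: "p \<in> ?A"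
    then obtain nu mu where [simp]: "p = (nu, mu)" and
      nu: "nu \<in> hstrips lam" and mu: "mu \<in> hstrips nu" "mu N = 0"
      by auto
    show "(case case p of (nu, mu) \<Rightarrow> (nu(N := 0), mu, nu N) of (nu, mu, v) \<Rightarrow> (nu(N := v), mu)) = p"
      by simp
    have "nu N \<le> lam N" using nu N by (auto simp: hstrips_def)
    moreover have "mu \<in> hstrips (nu(N := 0))" "n \<noteq> 0 \<longrightarrow> nu N \<le> mu n"
      using mu mu_hstrips[where mu = mu and nu = nu and v = "nu N", OF mu(2)] by auto
    ultimately show "(case p of (nu, mu) \<Rightarrow> (nu(N := 0), mu, nu N)) \<in> ?B"
      using nu_hstrips[OF nu, of 0] mu(2) N by auto
  qed
  also have "\<dots> = (\<Sum>nu\<in>hstrips lam. \<Sum>mu | mu \<in> hstrips nu \<and> mu N = 0. g nu mu * h (nu N) mu)"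
    using fin fin' by (subst sum.Sigma) auto
  finally show ?thesis ..
qed

lemma eo_wgt_shift:
  assumes "e \<in> barred_alphabet n"
  shows "eo_wgt (Suc n) x a i j e = eo_wgt n x (\<lambda>m. a (m - 1)) i j e"
  using assms by (auto simp: barred_alphabet_def algebra_simps)

text \<open>Adding the letters \<open>N\<close> and barred \<open>N\<close> leaves the conditions
  and zeta contributions of all \<open>k \<noteq> N\<close> unchanged, and those for
  \<open>N\<close> depend only on rows \<open>n\<close> and \<open>N\<close>. Hence the term splits
  into the factors of rows \<open>1..n\<close>, a weight of row \<open>N\<close>, and the term of
  \<open>T\<close> with shifted parameters.\<close>

lemma eo_term_fill:
  fixes x :: "nat \<Rightarrow> 'a::field_char_0" and a :: "int \<Rightarrow> 'a"
  assumes lam: "bounded_partition N lam" and N: "N = Suc n" and nu: "nu \<in> hstrips lam"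
    and mu: "mu \<in> hstrips nu" "mu N = 0"
    and T: "T \<in> tableaux (barred_alphabet n) {} row_ok mu"
  shows "eo_term N x a lam (fill lam nu (Barred N) (fill nu mu (Plain N) T)) =
    ((\<Prod>i = 1..n. \<Prod>j = Suc (nu i)..lam i. inverse (x N) + a (int N + int j - int i)) *
     (\<Prod>i = 1..n. \<Prod>j = Suc (mu i)..nu i. x N + a (int n + int j - int i))) *
    eo_row_weight N (x N) a (lam N) (mu n) (nu N) * eo_term n x (\<lambda>m. a (m - 1)) mu T"
proof -
  define T2 where "T2 = fill lam nu (Barred N) (fill nu mu (Plain N) T)"
  have nub: "bounded_partition N nu" by (rule hstrips_bounded_partition[OF lam nu])
  have mub: "bounded_partition N mu" by (rule hstrips_bounded_partition[OF nub mu(1)])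
  have nu_le: "nu i \<le> lam i" if "i \<ge> 1" for i using nu that by (simp add: hstrips_def)
  have mu_le: "mu i \<le> nu i" if "i \<ge> 1" for i using mu that by (simp add: hstrips_def)
  note dl = diagram_eq[OF lam] and dn = diagram_eq[OF nub] and dm = diagram_eq[OF mub]
  have TA: "T c \<in> barred_alphabet n" if "c \<in> diagram mu" for c
    using tableaux_cell[OF T that] .
  have T_ne: "T c \<noteq> Plain N \<and> T c \<noteq> Barred N" if "c \<in> diagram mu" for c
    using TA[OF that] N by (auto simp: barred_alphabet_def)
  have sub: "diagram mu \<subseteq> diagram nu" "diagram nu \<subseteq> diagram lam"
    using mu_le nu_le by (auto simp: dl dn dm intro: le_trans)
  \<comment> \<open>Membership and equality are joined so that statements about letters other than
    \<open>N\<close> pass from \<open>T2\<close> to \<open>T\<close> by rewriting.\<close>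
  have old: "c \<in> diagram lam \<and> T2 c = e \<longleftrightarrow> c \<in> diagram mu \<and> T c = e"
    if "e \<noteq> Plain N" "e \<noteq> Barred N" for c e
    using that sub by (auto simp: T2_def fill_def)
  have plain: "c \<in> diagram lam \<and> T2 c = Plain N \<longleftrightarrow> c \<in> diagram nu \<and> c \<notin> diagram mu" for c
    using sub T_ne[of c] by (auto simp: T2_def fill_def)
  have barred: "c \<in> diagram lam \<and> T2 c = Barred N \<longleftrightarrow> c \<in> diagram lam \<and> c \<notin> diagram nu" for c
    using sub T_ne[of c] by (auto simp: T2_def fill_def)
  define P where "P S U k \<longleftrightarrow> (\<exists>j. (k, j) \<in> diagram S \<and> U (k, j) = Plain k) \<longrightarrow>
     (\<forall>j. (k, j) \<in> diagram S \<and> U (k, j) = Barred k \<longrightarrow> (k - 1, j) \<in> diagram S \<and> U (k - 1, j) = Plain k)"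
    for S U k
  have cond: "even_orth_cond S U \<longleftrightarrow> (\<forall>k. P S U k)" for S U
    by (auto simp: even_orth_cond_def P_def)
  have P_old: "P lam T2 k \<longleftrightarrow> P mu T k" if "k \<noteq> N" for k
    using that unfolding P_def by (simp add: old)
  have "(N, j) \<notin> diagram mu" for j using mu(2) by (simp add: dm)
  then have P_mu: "P mu T N" by (simp add: P_def)
  \<comment> \<open>A box above row \<open>N\<close> thus lies in \<open>nu\<close> and cannot
    contain barred \<open>N\<close>; it contains \<open>N\<close> exactly if it lies outside
    \<open>mu\<close>.\<close>
  have row: "lam N \<le> nu n" if "n \<noteq> 0"
    using nu that N by (auto simp: hstrips_def)
  have P_N: "P lam T2 N \<longleftrightarrow> nu N = 0 \<or> nu N = lam N \<or> (1 < N \<and> mu n \<le> nu N)"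
  proof -
    have "(\<exists>j. (N, j) \<in> diagram lam \<and> T2 (N, j) = Plain N) \<longleftrightarrow> nu N \<noteq> 0"
      unfolding plain using mu(2) N by (auto simp: dn dm intro: exI[of _ "1::nat"])
    moreover have "(\<forall>j. (N, j) \<in> diagram lam \<and> T2 (N, j) = Barred N \<longrightarrow> (N - 1, j) \<in> diagram lam \<and> T2 (N - 1, j) = Plain N)
       \<longleftrightarrow> (\<forall>j. nu N < j \<and> j \<le> lam N \<longrightarrow> 1 < N \<and> mu n < j)"
    proof (intro iffI allI impI)
      fix j assume all: "\<forall>j. (N, j) \<in> diagram lam \<and> T2 (N, j) = Barred N \<longrightarrow>
          (N - 1, j) \<in> diagram lam \<and> T2 (N - 1, j) = Plain N"
        and j: "nu N < j \<and> j \<le> lam N"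
      then have "(N, j) \<in> diagram lam \<and> (N, j) \<notin> diagram nu"
        using N by (auto simp: dl dn)
      then have "(n, j) \<in> diagram nu \<and> (n, j) \<notin> diagram mu"
        using all N unfolding barred plain by auto
      then show "1 < N \<and> mu n < j" using N by (auto simp: dn dm)
    next
      fix j assume all: "\<forall>j. nu N < j \<and> j \<le> lam N \<longrightarrow> 1 < N \<and> mu n < j"
        and "(N, j) \<in> diagram lam \<and> T2 (N, j) = Barred N"
      then have "nu N < j" "j \<le> lam N" unfolding barred using N by (auto simp: dl dn)
      then have "(n, j) \<in> diagram nu \<and> (n, j) \<notin> diagram mu"
        using spec[OF all, of j] row N by (auto simp: dn dm)
      then show "(N - 1, j) \<in> diagram lam \<and> T2 (N - 1, j) = Plain N"
        using plain[of "(N - 1, j)"] N by auto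
    qed
    moreover have "(\<forall>j. nu N < j \<and> j \<le> lam N \<longrightarrow> 1 < N \<and> mu n < j) \<longleftrightarrow>
        nu N = lam N \<or> (1 < N \<and> mu n \<le> nu N)"
    proof
      assume "\<forall>j. nu N < j \<and> j \<le> lam N \<longrightarrow> 1 < N \<and> mu n < j"
      \<comment> \<open>The leftmost barred box of the row gives the strongest condition.\<close>
      from spec[OF this, of "Suc (nu N)"] show "nu N = lam N \<or> (1 < N \<and> mu n \<le> nu N)"
        using nu_le[of N] N by auto
    qed auto
    ultimately show ?thesis unfolding P_def by blast
  qed
  have cond_eq: "even_orth_cond lam T2 \<longleftrightarrow>
      (nu N = 0 \<or> nu N = lam N \<or> (1 < N \<and> mu n \<le> nu N)) \<and> even_orth_cond mu T"
    unfolding cond using P_N P_old P_mu by metis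
  have zeta_old: "zeta_at lam T2 k = zeta_at mu T k" if "k \<noteq> N" for k
  proof -
    have "(k - 1, 1) \<in> diagram lam \<and> (k, 1) \<in> diagram lam \<and> T2 (k - 1, 1) = Plain k \<and> T2 (k, 1) = Barred k \<longleftrightarrow>
      (k - 1, 1) \<in> diagram mu \<and> (k, 1) \<in> diagram mu \<and> T (k - 1, 1) = Plain k \<and> T (k, 1) = Barred k"
      using old[of "Plain k" "(k - 1, 1)"] old[of "Barred k" "(k, 1)"] that by auto
    then show ?thesis by (simp only: zeta_at_def)
  qed
  have zeta_N: "zeta_at lam T2 N = (if 1 < N \<and> mu n = 0 \<and> nu N = 0 \<and> lam N \<noteq> 0 then 1 else 0)"
  proof -
    have "(N - 1, 1) \<in> diagram lam \<and> (N, 1) \<in> diagram lam \<and> T2 (N - 1, 1) = Plain N \<and> T2 (N, 1) = Barred N \<longleftrightarrow>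
      1 < N \<and> mu n = 0 \<and> nu N = 0 \<and> lam N \<noteq> 0"
      using plain[of "(N - 1, 1)"] barred[of "(N, 1)"] row N by (auto simp: dl dn dm not_le)
    then show ?thesis by (simp only: zeta_at_def)
  qed
  have zeta: "zeta N lam T2 = zeta n mu T + zeta_at lam T2 N"
    unfolding zeta_def N by (simp add: zeta_old N)
  have wB: "(\<Prod>i = 1..N. \<Prod>j = Suc (nu i)..lam i. eo_wgt N x a i j (Barred N)) =
      (\<Prod>i = 1..n. \<Prod>j = Suc (nu i)..lam i. inverse (x N) + a (int N + int j - int i)) *
      (\<Prod>s = Suc (nu N)..lam N. inverse (x N) + a (int s))"
    by (simp add: N)
  \<comment> \<open>In row \<open>N\<close> the \<delta> correction raises the index
    \<open>n + j - N\<close> to \<open>j\<close>, so the letters \<open>N\<close> there contribute a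
    factorial power.\<close>
  have wP: "(\<Prod>i = 1..N. \<Prod>j = Suc (mu i)..nu i. eo_wgt N x a i j (Plain N)) =
      (\<Prod>i = 1..n. \<Prod>j = Suc (mu i)..nu i. x N + a (int n + int j - int i)) * fact_pow (x N) a (nu N)"
    using mu(2) by (simp add: N fact_pow_def)
  have wT: "(\<Prod>(i, j)\<in>diagram mu. eo_wgt N x a i j (T (i, j))) =
      (\<Prod>(i, j)\<in>diagram mu. eo_wgt n x (\<lambda>m. a (m - 1)) i j (T (i, j)))"
    unfolding N using TA by (intro prod.cong) (auto simp: eo_wgt_shift)
  have weight: "(\<Prod>(i, j)\<in>diagram lam. eo_wgt N x a i j (T2 (i, j))) =
    (\<Prod>i = 1..N. \<Prod>j = Suc (nu i)..lam i. eo_wgt N x a i j (Barred N)) *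
    ((\<Prod>i = 1..N. \<Prod>j = Suc (mu i)..nu i. eo_wgt N x a i j (Plain N)) *
     (\<Prod>(i, j)\<in>diagram mu. eo_wgt N x a i j (T (i, j))))"
    unfolding T2_def
    by (simp only: prod_diagram_fill[OF lam nub nu_le, where w = "eo_wgt N x a"]
        prod_diagram_fill[OF nub mub mu_le, where w = "eo_wgt N x a"])
  show ?thesis
    unfolding T2_def[symmetric] eo_term_def eo_row_weight_def cond_eq weight wB wP wT zeta zeta_N
    by (simp add: power_add mult_ac)
qed

lemma sum_eo_tableaux_step:
  fixes x :: "nat \<Rightarrow> 'a::field_char_0" and a :: "int \<Rightarrow> 'a"
  assumes lam: "bounded_partition N lam" and N: "N = Suc n"
  shows "(\<Sum>T\<in>tableaux (barred_alphabet N) {} row_ok lam. eo_term N x a lam T) =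
    (\<Sum>nu\<in>hstrips lam. \<Sum>mu | mu \<in> hstrips nu \<and> mu N = 0.
      ((\<Prod>i = 1..n. \<Prod>j = Suc (nu i)..lam i. inverse (x N) + a (int N + int j - int i)) *
       (\<Prod>i = 1..n. \<Prod>j = Suc (mu i)..nu i. x N + a (int n + int j - int i)) *
       (\<Sum>T\<in>tableaux (barred_alphabet n) {} row_ok mu. eo_term n x (\<lambda>m. a (m - 1)) mu T)) *
      eo_row_weight N (x N) a (lam N) (mu n) (nu N))"
proof -
  have "(\<Sum>T\<in>tableaux (barred_alphabet N) {} row_ok lam. eo_term N x a lam T) =
    (\<Sum>nu\<in>hstrips lam. \<Sum>T\<in>tableaux (insert (Plain N) (barred_alphabet n)) {} row_ok nu.
       eo_term N x a lam (fill lam nu (Barred N) T))"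
    unfolding N barred_alphabet_Suc using finite_barred_alphabet less_Barred_Suc lam N
    by (subst sum_tableaux_insert[where n = N]) auto
  also have "\<dots> = (\<Sum>nu\<in>hstrips lam. \<Sum>mu\<in>hstrips nu. \<Sum>T\<in>tableaux (barred_alphabet n) {} row_ok mu.
       eo_term N x a lam (fill lam nu (Barred N) (fill nu mu (Plain N) T)))"
  proof (rule sum.cong[OF refl])
    fix nu assume nu: "nu \<in> hstrips lam"
    show "(\<Sum>T\<in>tableaux (insert (Plain N) (barred_alphabet n)) {} row_ok nu.
       eo_term N x a lam (fill lam nu (Barred N) T)) =
      (\<Sum>mu\<in>hstrips nu. \<Sum>T\<in>tableaux (barred_alphabet n) {} row_ok mu.
       eo_term N x a lam (fill lam nu (Barred N) (fill nu mu (Plain N) T)))"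
      using finite_barred_alphabet less_Plain_Suc[of _ n] hstrips_bounded_partition[OF lam nu] N
      by (subst sum_tableaux_insert[where n = N]) auto
  qed
  also have "\<dots> = (\<Sum>nu\<in>hstrips lam. \<Sum>mu | mu \<in> hstrips nu \<and> mu N = 0. \<Sum>T\<in>tableaux (barred_alphabet n) {} row_ok mu.
       eo_term N x a lam (fill lam nu (Barred N) (fill nu mu (Plain N) T)))"
  proof (intro sum.cong[OF refl] sum.mono_neutral_right)
    fix nu assume nu: "nu \<in> hstrips lam"
    note nub = hstrips_bounded_partition[OF lam nu]
    show "finite (hstrips nu)" by (rule finite_hstrips[OF nub])
    show "\<forall>mu\<in>hstrips nu - {mu. mu \<in> hstrips nu \<and> mu N = 0}. (\<Sum>T\<in>tableaux (barred_alphabet n) {} row_ok mu.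
       eo_term N x a lam (fill lam nu (Barred N) (fill nu mu (Plain N) T))) = 0"
      using tableaux_barred_alphabet_empty[of n] hstrips_bounded_partition[OF nub] N by auto
  qed auto
  also have "\<dots> = (\<Sum>nu\<in>hstrips lam. \<Sum>mu | mu \<in> hstrips nu \<and> mu N = 0.
      ((\<Prod>i = 1..n. \<Prod>j = Suc (nu i)..lam i. inverse (x N) + a (int N + int j - int i)) *
       (\<Prod>i = 1..n. \<Prod>j = Suc (mu i)..nu i. x N + a (int n + int j - int i)) *
       (\<Sum>T\<in>tableaux (barred_alphabet n) {} row_ok mu. eo_term n x (\<lambda>m. a (m - 1)) mu T)) *
      eo_row_weight N (x N) a (lam N) (mu n) (nu N))"
    by (intro sum.cong refl)
      (simp add: eo_term_fill[OF lam N] sum_distrib_left sum_distrib_right mult_ac)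
  finally show ?thesis .
qed

text \<open>The entries of the column of exponent \<open>0\<close> are \<open>2\<close> in the determinant defining the even
  orthogonal character; normalizing them to \<open>1\<close> absorbs the factor \<open>\<eta>\<close>.\<close>

definition eo_column :: "(nat \<Rightarrow> 'a::field_char_0) \<Rightarrow> (int \<Rightarrow> 'a) \<Rightarrow> nat \<Rightarrow> nat \<Rightarrow> 'a" where
  "eo_column x a l i = (if l = 0 then 1 else symmetrized (x i) (inverse (x i)) (fact_poly a l))"

lemma eo_det_eq_tableau_sum:
  fixes x :: "nat \<Rightarrow> 'a::field_char_0"
  assumes "bounded_partition n lam" "\<And>m. m \<le> 0 \<Longrightarrow> a m = 0" "\<And>i. i \<in> {1..n} \<Longrightarrow> x i \<noteq> 0"
  shows "det1 n (\<lambda>i j. eo_column x a (lam j + n - j) i) =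
    vandermonde (\<lambda>i. x i + inverse (x i)) n *
    (\<Sum>T\<in>tableaux (barred_alphabet n) {} row_ok lam. eo_term n x a lam T)"
  using assms
proof (induction n arbitrary: lam a)
  case 0
  then show ?case
    by (simp add: diagram_bounded_0 tableaux_empty_diagram eo_term_def even_orth_cond_def zeta_def)
next
  case (Suc n)
  define N where "N = Suc n"
  define y where "y = x N"
  define t where "t i = x i + inverse (x i)" for i
  define a' where "a' = (\<lambda>m. a (m - 1))"
  define C where "C i = symmetrized (x i) (inverse (x i))" for i
  \<comment> \<open>The remainder of the last column: it is already normalized to 1 if its exponent
    is 0, and otherwise it is the functional's value 2 at the polynomial 1.\<close>
  define \<epsilon> :: 'a where "\<epsilon> = (if lam N = 0 then 1 else 2)"
  \<comment> \<open>The index is the degree: the factor \<open>z - 1/y\<close> accounts for one, and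
    index 0 holds the interpolation remainder.\<close>
  define \<psi> where "\<psi> k i = (if k = 0 then \<epsilon> else C i ([:- inverse y, 1:] * fact_poly a (k - 1)))" for k i
  define w where "w k l = (\<Prod>s = Suc k..l - 1. y + a (int s))" for k l :: nat
  define w' where "w' k l = (\<Prod>s = Suc k..l. inverse y + a (int s))" for k l :: nat
  have lam: "bounded_partition N lam" using Suc.prems(1) by (simp add: N_def)
  have x0: "x i \<noteq> 0" if "i \<in> {1..N}" for i using Suc.prems(3) that by (simp add: N_def)
  then have y0: "y \<noteq> 0" by (simp add: y_def N_def)
  have \<epsilon>0: "\<epsilon> \<noteq> 0" by (simp add: \<epsilon>_def)
  have C: "poly_functional (C i)" for i by (simp add: C_def poly_functional_symmetrized)
  have C1: "C i 1 = 2" for i by (simp add: C_def symmetrized_def)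
  have shift: "pCons 0 (fact_poly a k) = fact_poly a' (Suc k)" for k
    by (rule pCons_fact_poly) (use Suc.prems(2) in \<open>auto simp: a'_def\<close>)
  have quad: "C i ([:- inverse y, 1:] * [:- y, 1:] * fact_poly a k) = (t i - t N) * eo_column x a' (Suc k) i"
    if "i \<in> {1..N}" for i k
    unfolding quadratic_factor[OF y0] C_def symmetrized_quadratic[OF x0[OF that]] shift
    by (simp add: t_def y_def eo_column_def)
  have newton: "C i ([:- inverse y, 1:] * fact_poly a l) -
      (\<Prod>s = Suc l'..l. y + a (int s)) * C i ([:- inverse y, 1:] * fact_poly a l') =
      (t i - t N) * (\<Sum>k = Suc l'..<Suc l. w k (Suc l) * eo_column x a' k i)"
    if "l' \<le> l" "i \<in> {1..N}" for l l' i
    unfolding functional_newton[OF C that(1)] quad[OF that(2)] sum_distrib_left w_def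
      sum.shift_bounds_Suc_ivl by (simp add: mult.left_commute)
  let ?S = "\<lambda>n a lam. \<Sum>T\<in>tableaux (barred_alphabet n) {} row_ok lam. eo_term n x a lam T"
  have inner: "det1 N (\<lambda>i j. \<psi> (nu j + N - j) i) =
      vandermonde t N * (\<Sum>mu | mu \<in> hstrips nu \<and> mu N = 0.
        (\<Prod>j = 1..n. w (mu j + n - j) (nu j + N - j)) * ?S n a' mu * eo_corner y a (lam N) (nu N))"
    if nu: "nu \<in> hstrips lam" for nu
  proof -
    have nub: "bounded_partition (Suc n) nu"
      using hstrips_bounded_partition[OF lam nu] by (simp add: N_def)
    have "det1 N (\<lambda>i j. \<psi> (nu j + N - j) i) =
      \<psi> (nu N) N * (\<Prod>i = 1..n. t i - t N) *
      (\<Sum>mu | mu \<in> hstrips nu \<and> mu N = 0. (\<Prod>j = 1..n. w (mu j + n - j) (nu j + N - j)) *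
         det1 n (\<lambda>i j. eo_column x a' (mu j + n - j) i))"
      unfolding N_def
    proof (rule det1_hstrip_smaller[OF nub])
      fix l l' :: nat assume "l' < l"
      then obtain L where L: "l = Suc L" "l' \<le> L" by (cases l) auto
      have "\<exists>c. \<forall>i\<in>{1..N}. \<psi> l i - c * \<psi> l' i = (t i - t N) * (\<Sum>k = l'..<l. w k l * eo_column x a' k i)"
      proof (cases l')
        case 0
        \<comment> \<open>Expansion at \<open>y\<close> leaves \<open>(y|a)^L (t i - 2/y)\<close>.
          Subtracting \<open>(y|a)^L (y - 1/y)\<close> turns it into
          \<open>(y|a)^L (t i - t N)\<close>, which is the missing summand
          \<open>k = 0\<close>.\<close>
        have "\<psi> l i - ((y - inverse y) * fact_pow y a L / \<epsilon>) * \<psi> l' i =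
            (t i - t N) * (\<Sum>k = l'..<l. w k l * eo_column x a' k i)" if "i \<in> {1..N}" for i
        proof -
          have lin: "C i [:- inverse y, 1:] = t i - 2 * inverse y"
            by (simp add: C_def symmetrized_def t_def)
          have "C i ([:- inverse y, 1:] * fact_poly a L) - fact_pow y a L * C i [:- inverse y, 1:] =
              (t i - t N) * (\<Sum>k = Suc 0..<Suc L. w k (Suc L) * eo_column x a' k i)"
            using newton[of 0 L i, OF le0 that] by (simp only: fact_poly_0 mult_1_right fact_pow_def One_nat_def)
          then have "C i ([:- inverse y, 1:] * fact_poly a L) =
              fact_pow y a L * (t i - 2 * inverse y) +
              (t i - t N) * (\<Sum>k = Suc 0..<Suc L. w k (Suc L) * eo_column x a' k i)"
            unfolding lin by (simp only: diff_eq_eq add.commute)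
          moreover have "(\<Sum>k = 0..<Suc L. w k (Suc L) * eo_column x a' k i) =
              fact_pow y a L + (\<Sum>k = Suc 0..<Suc L. w k (Suc L) * eo_column x a' k i)"
            by (subst sum.atLeast_Suc_lessThan) (simp_all add: w_def fact_pow_def eo_column_def)
          ultimately show ?thesis
            using \<epsilon>0 by (simp add: 0 L \<psi>_def del: sum.op_ivl_Suc mult_pCons_left mult_pCons_right)
              (simp add: t_def y_def algebra_simps del: sum.op_ivl_Suc)
        qed
        then show ?thesis by blast
      next
        case (Suc L')
        then have "L' \<le> L" using L by simp
        then show ?thesis
          using newton[of L' L]
          by (intro exI[of _ "\<Prod>s = Suc L'..L. y + a (int s)"] ballI)
            (simp add: \<psi>_def L Suc del: sum.op_ivl_Suc)
      qed
      then show "\<exists>c. \<forall>i\<in>{1..Suc n}. \<psi> l i - c * \<psi> l' i =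
          (t i - t (Suc n)) * (\<Sum>k = l'..<l. w k l * eo_column x a' k i)"
        by (simp only: N_def)
    qed simp
    also have "\<psi> (nu N) N = eo_corner y a (lam N) (nu N)"
    proof (cases "nu N = 0")
      case False
      then show ?thesis
        by (simp add: \<psi>_def eo_corner_def C_def symmetrized_def poly_fact_poly y_def algebra_simps)
    qed (simp add: \<psi>_def eo_corner_def \<epsilon>_def)
    also have "(\<Sum>mu | mu \<in> hstrips nu \<and> mu N = 0. (\<Prod>j = 1..n. w (mu j + n - j) (nu j + N - j)) *
         det1 n (\<lambda>i j. eo_column x a' (mu j + n - j) i)) =
      (\<Sum>mu | mu \<in> hstrips nu \<and> mu N = 0. vandermonde t n * ((\<Prod>j = 1..n. w (mu j + n - j) (nu j + N - j)) * ?S n a' mu))"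
    proof (intro sum.cong refl)
      fix mu assume "mu \<in> {mu. mu \<in> hstrips nu \<and> mu N = 0}"
      then have mu: "mu \<in> hstrips nu" "mu N = 0" by auto
      have "bounded_partition n mu"
        using hstrips_bounded_partition[OF nub mu(1)] mu(2) unfolding N_def by (rule bounded_partition_pred)
      then have "det1 n (\<lambda>i j. eo_column x a' (mu j + n - j) i) = vandermonde t n * ?S n a' mu"
        unfolding t_def by (rule Suc.IH) (use Suc.prems in \<open>auto simp: a'_def\<close>)
      then show "(\<Prod>j = 1..n. w (mu j + n - j) (nu j + N - j)) * det1 n (\<lambda>i j. eo_column x a' (mu j + n - j) i) =
          vandermonde t n * ((\<Prod>j = 1..n. w (mu j + n - j) (nu j + N - j)) * ?S n a' mu)"
        by (simp only: mult.left_commute)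
    qed
    also have "eo_corner y a (lam N) (nu N) * (\<Prod>i = 1..n. t i - t N) *
        (\<Sum>mu | mu \<in> hstrips nu \<and> mu N = 0. vandermonde t n * ((\<Prod>j = 1..n. w (mu j + n - j) (nu j + N - j)) * ?S n a' mu)) =
      vandermonde t N * (\<Sum>mu | mu \<in> hstrips nu \<and> mu N = 0.
        (\<Prod>j = 1..n. w (mu j + n - j) (nu j + N - j)) * ?S n a' mu * eo_corner y a (lam N) (nu N))"
      unfolding sum_distrib_left[symmetric] sum_distrib_right[symmetric]
      by (simp only: N_def vandermonde_Suc mult_ac)
    finally show ?thesis .
  qed
  \<comment> \<open>The factors common to the determinant and tableau recursions; rows
    \<open>1..n\<close> only, hence independent of \<open>nu N\<close>.\<close>
  let ?g = "\<lambda>nu mu. (\<Prod>i = 1..n. \<Prod>j = Suc (nu i)..lam i. inverse y + a (int N + int j - int i)) *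
       (\<Prod>i = 1..n. \<Prod>j = Suc (mu i)..nu i. y + a (int n + int j - int i)) * ?S n a' mu"
  have g: "?g (nu(N := v)) mu = ?g nu mu" for nu v mu
    by (intro arg_cong2[of _ _ _ _ "(*)"] prod.cong refl) (auto simp: N_def)
  let ?M = "\<lambda>mu. if N \<le> 1 then lam N else min (lam N) (mu n)"
  have "det1 N (\<lambda>i j. eo_column x a (lam j + N - j) i) =
    (\<Sum>nu\<in>hstrips lam. (\<Prod>j = 1..N. w' (nu j + N - j) (lam j + N - j)) * det1 N (\<lambda>i j. \<psi> (nu j + N - j) i))"
  proof (rule det1_hstrip_same[OF lam])
    fix l l' :: nat assume l: "l' < l"
    \<comment> \<open>The factor 2 undoes the normalization of the column of exponent 0.\<close>
    have "eo_column x a l i - ((\<Prod>s = Suc l'..l. inverse y + a (int s)) * (if l' = 0 then 2 else 1)) * eo_column x a l' i =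
        (\<Sum>k = Suc l'..l. w' k l * \<psi> k i)" for i
    proof -
      have "eo_column x a l i = C i (fact_poly a l)" "(if l' = 0 then 2 else 1) * eo_column x a l' i = C i (fact_poly a l')"
        using l C1 by (auto simp: eo_column_def C_def)
      moreover have "(\<Sum>k = Suc l'..l. w' k l * \<psi> k i) = (\<Sum>k = l'..<l. w' (Suc k) l * \<psi> (Suc k) i)"
        unfolding atLeastLessThanSuc_atLeastAtMost[symmetric] sum.shift_bounds_Suc_ivl ..
      ultimately show ?thesis
        using functional_newton[OF C less_imp_le[OF l], of i 1 a "inverse y"]
        by (simp add: w'_def \<psi>_def mult.assoc)
    qed
    then show "\<exists>c. \<forall>i\<in>{1..N}. eo_column x a l i - c * eo_column x a l' i = (\<Sum>k = Suc l'..l. w' k l * \<psi> k i)"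
      by blast
  next
    fix i
    show "eo_column x a (lam N) i = (\<Sum>k = 0..lam N. w' k (lam N) * \<psi> k i)"
    proof (cases "lam N = 0")
      case True
      then show ?thesis by (simp add: eo_column_def w'_def \<psi>_def \<epsilon>_def)
    next
      case False
      have "(\<Sum>k = 0..lam N. w' k (lam N) * \<psi> k i) =
          w' 0 (lam N) * \<psi> 0 i + (\<Sum>k = Suc 0..lam N. w' k (lam N) * \<psi> k i)"
        by (simp add: sum.atLeast_Suc_atMost)
      also have "(\<Sum>k = Suc 0..lam N. w' k (lam N) * \<psi> k i) = (\<Sum>k = 0..<lam N. w' (Suc k) (lam N) * \<psi> (Suc k) i)"
        unfolding atLeastLessThanSuc_atLeastAtMost[symmetric] sum.shift_bounds_Suc_ivl ..
      finally show ?thesis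
        using False functional_newton_0[OF C, of i a "lam N" "inverse y"]
        by (simp add: eo_column_def C1 \<psi>_def w'_def \<epsilon>_def fact_pow_def flip: C_def)
    qed
  qed
  also have "\<dots> = vandermonde t N * (\<Sum>nu\<in>hstrips lam. \<Sum>mu | mu \<in> hstrips nu \<and> mu N = 0.
      ?g nu mu * ((\<Prod>s = Suc (nu N)..lam N. inverse y + a (int s)) * eo_corner y a (lam N) (nu N)))"
  proof -
    have W': "(\<Prod>j = 1..N. w' (nu j + N - j) (lam j + N - j)) =
        (\<Prod>i = 1..n. \<Prod>j = Suc (nu i)..lam i. inverse y + a (int N + int j - int i)) *
        (\<Prod>s = Suc (nu N)..lam N. inverse y + a (int s))" for nu
    proof -
      have "(\<Prod>j = Suc (nu i)..lam i. inverse y + a (int N + int j - int i)) = w' (nu i + N - i) (lam i + N - i)"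
        if "i \<in> {1..n}" for i
        unfolding w'_def using that by (intro prod_row_cells[where k = "N - i"]) (auto simp: N_def)
      then show ?thesis by (simp add: N_def w'_def)
    qed
    have W: "(\<Prod>j = 1..n. w (mu j + n - j) (nu j + N - j)) =
        (\<Prod>i = 1..n. \<Prod>j = Suc (mu i)..nu i. y + a (int n + int j - int i))" for nu mu
    proof -
      have "(\<Prod>j = Suc (mu i)..nu i. y + a (int n + int j - int i)) = w (mu i + n - i) (nu i + N - i)"
        if "i \<in> {1..n}" for i
        unfolding w_def using that by (intro prod_row_cells[where k = "n - i"]) (auto simp: N_def)
      then show ?thesis by (intro prod.cong refl) simp
    qed
    show ?thesis
    proof (subst sum_distrib_left, intro sum.cong refl)
      fix nu assume nu: "nu \<in> hstrips lam"
      show "(\<Prod>j = 1..N. w' (nu j + N - j) (lam j + N - j)) * det1 N (\<lambda>i j. \<psi> (nu j + N - j) i) =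
        vandermonde t N * (\<Sum>mu | mu \<in> hstrips nu \<and> mu N = 0.
          ?g nu mu * ((\<Prod>s = Suc (nu N)..lam N. inverse y + a (int s)) * eo_corner y a (lam N) (nu N)))"
        unfolding inner[OF nu] W' W mult.left_commute[of _ "vandermonde t N"]
          sum_distrib_left[where A = "{mu. mu \<in> hstrips nu \<and> mu N = 0}"]
        by (intro sum.cong refl) (simp only: mult_ac)
    qed
  qed
  \<comment> \<open>The two recursions differ only in the factor of row \<open>N\<close>. These
    factors agree once summed over \<open>nu N\<close>, so that sum is isolated, exchanged and
    merged back.\<close>
  also have "(\<Sum>nu\<in>hstrips lam. \<Sum>mu | mu \<in> hstrips nu \<and> mu N = 0.
      ?g nu mu * ((\<Prod>s = Suc (nu N)..lam N. inverse y + a (int s)) * eo_corner y a (lam N) (nu N))) =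
    (\<Sum>nu | nu \<in> hstrips lam \<and> nu N = 0. \<Sum>mu | mu \<in> hstrips nu \<and> mu N = 0. ?g nu mu *
      (\<Sum>v = 0..?M mu. (\<Prod>s = Suc v..lam N. inverse y + a (int s)) * eo_corner y a (lam N) v))"
    by (rule sum_hstrips_split_last[OF lam N_def g])
  also have "\<dots> = (\<Sum>nu | nu \<in> hstrips lam \<and> nu N = 0. \<Sum>mu | mu \<in> hstrips nu \<and> mu N = 0. ?g nu mu *
      (\<Sum>v = 0..?M mu. eo_row_weight N y a (lam N) (mu n) v))"
    by (intro sum.cong refl arg_cong2[of _ _ _ _ "(*)"] sum_eo_row_weight[symmetric])
  also have "\<dots> = (\<Sum>nu\<in>hstrips lam. \<Sum>mu | mu \<in> hstrips nu \<and> mu N = 0.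
      ?g nu mu * eo_row_weight N y a (lam N) (mu n) (nu N))"
    by (rule sum_hstrips_split_last[OF lam N_def g, symmetric])
  also have "\<dots> = ?S N a lam"
    unfolding sum_eo_tableaux_step[OF lam N_def] y_def a'_def ..
  finally show ?case by (simp add: N_def t_def)
qed

subsection \<open>Characters as quotients\<close>

text \<open>Columns increase strictly from a value of at least 1, so the row bound
  \<open>(\<le>)\<close> built into \<open>tableaux\<close> costs nothing here.\<close>

lemma gl_tableau_row_le:
  assumes lam: "bounded_partition n lam" and T: "T \<in> gl_tableaux n lam"
  shows "(i, j) \<in> diagram lam \<Longrightarrow> i \<le> T (i, j)"
proof (induction i)
  case (Suc i)
  show ?case
  proof (cases "i = 0")
    case True
    then show ?thesis using T Suc.prems by (force simp: gl_tableaux_def PiE_iff)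
  next
    case False
    then have "lam (Suc i) \<le> lam i" using lam by (simp add: bounded_partition_def)
    then have d: "(i, j) \<in> diagram lam"
      using Suc.prems False by (auto simp: diagram_eq[OF lam])
    have "T (i, j) \<le> T (Suc i, j)"
      using T d Suc.prems le_SucI[OF order_refl, of i] unfolding gl_tableaux_def cols_weak_def by blast
    moreover have "T (i, j) \<noteq> T (Suc i, j)"
      using T d Suc.prems n_not_Suc_n[of i] unfolding gl_tableaux_def cols_distinct_def by blast
    ultimately show ?thesis using Suc.IH[OF d] by simp
  qed
qed simp

lemma gl_tableaux_eq:
  assumes "bounded_partition n lam"
  shows "gl_tableaux n lam = tableaux {1..n} {} (\<le>) lam"
proof (intro equalityI subsetI)
  fix T assume "T \<in> gl_tableaux n lam"
  then show "T \<in> tableaux {1..n} {} (\<le>) lam"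
    using gl_tableau_row_le[OF assms] by (simp add: tableaux_def gl_tableaux_def)
qed (simp add: tableaux_def gl_tableaux_def)

lemma row_bound_iff: "row_bound lam T \<longleftrightarrow> (\<forall>i j. (i, j) \<in> diagram lam \<longrightarrow> row_ok i (T (i, j)))"
proof -
  have "(\<forall>k. e = Plain k \<or> e = Barred k \<longrightarrow> i \<le> k) \<longleftrightarrow> row_ok i e" for i e
    by (cases e) auto
  then show ?thesis unfolding row_bound_def by blast
qed

lemma sp_tableaux_eq: "sp_tableaux n lam = tableaux (barred_alphabet n) {} row_ok lam"
  by (simp add: sp_tableaux_def tableaux_def row_bound_iff)

lemma oo_tableaux_eq: "oo_tableaux n lam = tableaux (insert Zero (barred_alphabet n)) {Zero} row_ok lam"
proof -
  have "rows_one_zero lam T \<longleftrightarrow> (\<forall>i j j'. (i, j) \<in> diagram lam \<longrightarrow> (i, j') \<in> diagram lam \<longrightarrow>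
      T (i, j) \<in> {Zero} \<longrightarrow> T (i, j) = T (i, j') \<longrightarrow> j = j')" for T
    unfolding rows_one_zero_def by (metis singletonD singletonI)
  then show ?thesis
    unfolding oo_tableaux_def tableaux_def row_bound_iff by (intro Collect_cong) blast
qed

lemma sum_eo_tableaux:
  assumes "bounded_partition n lam"
  shows "(\<Sum>T\<in>eo_tableaux n lam. 2 ^ zeta n lam T * (\<Prod>(i, j)\<in>diagram lam. eo_wgt n x a i j (T (i, j)))) =
    (\<Sum>T\<in>tableaux (barred_alphabet n) {} row_ok lam. eo_term n x a lam T)"
proof -
  have "eo_tableaux n lam = {T \<in> tableaux (barred_alphabet n) {} row_ok lam. even_orth_cond lam T}"
    by (auto simp: eo_tableaux_def tableaux_def row_bound_iff)
  then show ?thesis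
    using finite_tableaux[OF assms finite_barred_alphabet[of n], of "{}" row_ok]
    by (simp add: eo_term_def sum.inter_filter)
qed

section \<open>The empty shape and the denominators\<close>

lemma bounded_partition_zero: "bounded_partition n (\<lambda>_. 0)"
  by (simp add: bounded_partition_def)

lemma diagram_zero: "diagram (\<lambda>_. 0) = {}"
  by (auto simp: diagram_eq[OF bounded_partition_zero])

text \<open>A denominator is the numerator for the zero partition, whose single tableau has weight
  1, so the numerator formulas evaluate the denominators as well.\<close>

lemma sum_tableaux_zero:
  "(\<Sum>T\<in>tableaux A V R (\<lambda>_. 0). \<Prod>(i, j)\<in>diagram (\<lambda>_. 0). w i j (T (i, j))) = 1"
  by (simp add: tableaux_empty_diagram diagram_zero)

lemma eo_term_zero: "(\<Sum>T\<in>tableaux A V R (\<lambda>_. 0). eo_term n x a (\<lambda>_. 0) T) = 1"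
  by (simp add: tableaux_empty_diagram diagram_zero eo_term_def even_orth_cond_def zeta_def zeta_at_def)

text \<open>Exponent 0 occurs only in the last column and only if \<open>lam n = 0\<close>; undoing
  its normalization costs the factor 2 that \<eta> compensates.\<close>

lemma o_det_eq:
  fixes x :: "nat \<Rightarrow> 'a::field_char_0"
  assumes "n \<ge> 1"
  shows "det1 n (\<lambda>i j. fact_pow (x i) a (lam j + n - j) + fact_pow (inverse (x i)) a (lam j + n - j)) =
    (if lam n = 0 then 2 else 1) * det1 n (\<lambda>i j. eo_column x a (lam j + n - j) i)"
proof -
  have "det1 n (\<lambda>i j. fact_pow (x i) a (lam j + n - j) + fact_pow (inverse (x i)) a (lam j + n - j)) =
    det1 n (\<lambda>i j. (if lam j + n - j = 0 then 2 else 1) * eo_column x a (lam j + n - j) i)"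
    by (rule det1_cong) (simp add: eo_column_def symmetrized_def poly_fact_poly fact_pow_def)
  also have "\<dots> = (\<Prod>j = 1..n. if lam j + n - j = 0 then 2 else 1) * det1 n (\<lambda>i j. eo_column x a (lam j + n - j) i)"
    by (rule det1_column_scale)
  also have "(\<Prod>j = 1..n. if lam j + n - j = 0 then 2 else 1) = (\<Prod>j\<in>{n}. if lam j + n - j = 0 then 2 else (1 :: 'a))"
    using assms by (intro prod.mono_neutral_right) auto
  finally show ?thesis by simp
qed

text \<open>The premises of the four parts make the denominators nonzero: these are Vandermonde
  products in \<open>x i\<close> or in \<open>x i + 1 / x i\<close>, with further factors
  \<open>s i - 1 / s i\<close> or \<open>x i - 1 / x i\<close> in the odd orthogonal and symplectic
  cases.\<close>

theorem theorem2:
  fixes n :: nat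
    and x :: "nat \<Rightarrow> 'a::field_char_0"
    and a :: "int \<Rightarrow> 'a"
    and lam :: "nat \<Rightarrow> nat"
  assumes "n \<ge> 1"
    and "is_partition lam"
    and "num_parts lam \<le> n"
    and "\<And>m. m \<le> 0 \<Longrightarrow> a m = 0"
    and "\<And>i. i \<in> {1..n} \<Longrightarrow> x i \<noteq> 0"
  shows
    "(inj_on x {1..n} \<longrightarrow>
        gl_char n x a lam =
          (\<Sum>T\<in>gl_tableaux n lam. \<Prod>(i, j)\<in>diagram lam. gl_wgt x a i j (T (i, j)))) \<and>
     (\<forall>s. (\<forall>i\<in>{1..n}. s i ^ 2 = x i) \<longrightarrow>
        inj_on (\<lambda>i. x i + inverse (x i)) {1..n} \<longrightarrow> (\<forall>i\<in>{1..n}. x i \<noteq> 1) \<longrightarrow>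
        so_char n x s a lam =
          (\<Sum>T\<in>oo_tableaux n lam. \<Prod>(i, j)\<in>diagram lam. oo_wgt n x a i j (T (i, j)))) \<and>
     (inj_on (\<lambda>i. x i + inverse (x i)) {1..n} \<longrightarrow> (\<forall>i\<in>{1..n}. x i ^ 2 \<noteq> 1) \<longrightarrow>
        sp_char n x a lam =
          (\<Sum>T\<in>sp_tableaux n lam. \<Prod>(i, j)\<in>diagram lam. sp_wgt n x a i j (T (i, j)))) \<and>
     (inj_on (\<lambda>i. x i + inverse (x i)) {1..n} \<longrightarrow>
        o_char n x a lam =
          (\<Sum>T\<in>eo_tableaux n lam.
             2 ^ zeta n lam T * (\<Prod>(i, j)\<in>diagram lam. eo_wgt n x a i j (T (i, j)))))"
proof -
  let ?t = "\<lambda>i. x i + inverse (x i)"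
  have lam: "bounded_partition n lam"
    using assms(2,3) by (rule is_partition_imp_bounded)
  note zero = bounded_partition_zero[of n]
  have gl: "gl_char n x a lam = (\<Sum>T\<in>gl_tableaux n lam. \<Prod>(i, j)\<in>diagram lam. gl_wgt x a i j (T (i, j)))"
    if "inj_on x {1..n}"
  proof -
    have "det1 n (\<lambda>i j. fact_pow (x i) a (n - j)) = vandermonde x n"
      using gl_det_eq_tableau_sum[OF zero, of x a] by (simp add: sum_tableaux_zero)
    then show ?thesis
      using gl_det_eq_tableau_sum[OF lam, of x a] vandermonde_nonzero[OF that]
      by (simp add: gl_char_def gl_tableaux_eq[OF lam])
  qed
  have so: "so_char n x s a lam = (\<Sum>T\<in>oo_tableaux n lam. \<Prod>(i, j)\<in>diagram lam. oo_wgt n x a i j (T (i, j)))"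
    if s: "\<forall>i\<in>{1..n}. s i ^ 2 = x i" and inj: "inj_on ?t {1..n}" and x1: "\<forall>i\<in>{1..n}. x i \<noteq> 1" for s
  proof -
    have "s i - inverse (s i) \<noteq> 0" if "i \<in> {1..n}" for i
    proof
      assume "s i - inverse (s i) = 0"
      moreover have "s i \<noteq> 0" using s assms(5) that by force
      ultimately have "s i ^ 2 = 1" by (simp add: power2_eq_square field_simps)
      then show False using s x1 that by simp
    qed
    then have nz: "(\<Prod>i = 1..n. s i - inverse (s i)) * vandermonde ?t n \<noteq> 0"
      using vandermonde_nonzero[OF inj] by simp
    have det: "det1 n (\<lambda>i j. s i * fact_pow (x i) a (mu j + n - j)
          - inverse (s i) * fact_pow (inverse (x i)) a (mu j + n - j)) =
        (\<Prod>i = 1..n. s i - inverse (s i)) * vandermonde ?t n *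
        (\<Sum>T\<in>tableaux (insert Zero (barred_alphabet n)) {Zero} row_ok mu.
           \<Prod>(i, j)\<in>diagram mu. oo_wgt n x a i j (T (i, j)))"
      if "bounded_partition n mu" for mu
      using that assms(1,4,5) s by (intro so_det_eq_tableau_sum) auto
    have "det1 n (\<lambda>i j. s i * fact_pow (x i) a (n - j) - inverse (s i) * fact_pow (inverse (x i)) a (n - j)) =
        (\<Prod>i = 1..n. s i - inverse (s i)) * vandermonde ?t n"
      using det[OF zero] by (simp add: sum_tableaux_zero)
    then show ?thesis
      unfolding so_char_def det[OF lam] oo_tableaux_eq by (simp only: nonzero_mult_div_cancel_left[OF nz])
  qed
  have sp: "sp_char n x a lam = (\<Sum>T\<in>sp_tableaux n lam. \<Prod>(i, j)\<in>diagram lam. sp_wgt n x a i j (T (i, j)))"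
    if inj: "inj_on ?t {1..n}" and x1: "\<forall>i\<in>{1..n}. x i ^ 2 \<noteq> 1"
  proof -
    have "x i - inverse (x i) \<noteq> 0" if "i \<in> {1..n}" for i
      using x1 assms(5)[OF that] that by (auto simp: power2_eq_square field_simps)
    then have nz: "(\<Prod>i = 1..n. x i - inverse (x i)) * vandermonde ?t n \<noteq> 0"
      using vandermonde_nonzero[OF inj] by simp
    have det: "det1 n (\<lambda>i j. x i * fact_pow (x i) a (mu j + n - j)
          - inverse (x i) * fact_pow (inverse (x i)) a (mu j + n - j)) =
        (\<Prod>i = 1..n. x i - inverse (x i)) * vandermonde ?t n *
        (\<Sum>T\<in>tableaux (barred_alphabet n) {} row_ok mu.
           \<Prod>(i, j)\<in>diagram mu. sp_wgt n x a i j (T (i, j)))"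
      if "bounded_partition n mu" for mu
      using that assms(4,5) by (intro sp_det_eq_tableau_sum) auto
    have "det1 n (\<lambda>i j. x i * fact_pow (x i) a (n - j) - inverse (x i) * fact_pow (inverse (x i)) a (n - j)) =
        (\<Prod>i = 1..n. x i - inverse (x i)) * vandermonde ?t n"
      using det[OF zero] by (simp add: sum_tableaux_zero)
    then show ?thesis
      unfolding sp_char_def det[OF lam] sp_tableaux_eq by (simp only: nonzero_mult_div_cancel_left[OF nz])
  qed
  have o: "o_char n x a lam = (\<Sum>T\<in>eo_tableaux n lam.
      2 ^ zeta n lam T * (\<Prod>(i, j)\<in>diagram lam. eo_wgt n x a i j (T (i, j))))"
    if inj: "inj_on ?t {1..n}"
  proof -
    have det: "det1 n (\<lambda>i j. eo_column x a (mu j + n - j) i) =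
        vandermonde ?t n * (\<Sum>T\<in>tableaux (barred_alphabet n) {} row_ok mu. eo_term n x a mu T)"
      if "bounded_partition n mu" for mu
      using that assms(4,5) by (intro eo_det_eq_tableau_sum) auto
    \<comment> \<open>The zero partition has last part 0, so the denominator always carries the
      factor 2, which its prefactor \<open>1 / 2\<close> cancels.\<close>
    have "det1 n (\<lambda>i j. fact_pow (x i) a (n - j) + fact_pow (inverse (x i)) a (n - j)) = 2 * vandermonde ?t n"
      using o_det_eq[OF assms(1), of x a "\<lambda>_. 0"] det[OF zero] by (simp add: eo_term_zero)
    moreover have "vandermonde ?t n \<noteq> 0" by (rule vandermonde_nonzero[OF inj])
    ultimately show ?thesis
      unfolding o_char_def o_det_eq[OF assms(1)] det[OF lam] sum_eo_tableaux[OF lam] by simp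
  qed
  show ?thesis using gl so sp o by blast
qed

end
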